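(* Let $q>2$, $\boldsymbol\mu\in\mathbb R^d$, $\sigma_p,\sigma_0,\eta>0$, and let the two-layer CNN with $\mathrm{ReLU}^q$ activation be trained by gradient descent on $n$ samples from the distribution $\mathcal D$, all as described in the context. Fix any $\epsilon>0$ and let $$T=\tilde\Theta\big(\eta^{-1}m\,\sigma_0^{-(q-2)}\|\boldsymbol\mu\|_2^{-q}+\eta^{-1}\epsilon^{-1}m^{3}\|\boldsymbol\mu\|_2^{-2}\big).$$ Suppose the following conditions hold: (1) $d=\tilde\Omega\big(m^{2\vee[4/(q-2)]}n^{4\vee[(2q-2)/(q-2)]}\big)$; (2) $n,m=\Omega(\mathrm{polylog}(d))$; (3) $\eta\le\tilde O\big(\min\{\|\boldsymbol\mu\|_2^{-2},\sigma_p^{-2}d^{-1}\}\big)$; (4) $\tilde O(nd^{-1/2})\cdot\min\{(\sigma_p\sqrt d)^{-1},\|\boldsymbol\mu\|_2^{-1}\}\le\sigma_0\le\tilde O\big(m^{-2/(q-2)}n^{-[1/(q-2)]\vee1}\big)\cdot\min\{(\sigma_p\sqrt d)^{-1},\|\boldsymbol\mu\|_2^{-1}\}$. If moreover $n\cdot\mathrm{SNR}^q=\tilde\Omega(1)$ (where this $\tilde\Omega$ also hides a $\mathrm{polylog}(\epsilon^{-1})$ factor), then with probability at least $1-d^{-1}$ there exists $0\le t\le T$ such that: 1. $\max_r\gamma_{j,r}^{(t)}=\Omega(1)$ for $j\in\{\pm1\}$; 2. $\max_{j,r,i}|\rho_{j,r,i}^{(T)}|=\tilde O(\sigma_0\sigma_p\sqrt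 d)$; 3. $L_S(\mathbf W^{(t)})\le\epsilon$; 4. $L_{\mathcal D}(\mathbf W^{(t)})\le 6\epsilon+\exp(-n^2)$.
   Context: Data distribution $\mathcal D$: fix a nonzero signal vector $\boldsymbol\mu\in\mathbb R^d$ and $\sigma_p>0$. A sample $(\mathbf x,y)$ with $\mathbf x=[\mathbf x_1^\top,\mathbf x_2^\top]^\top\in\mathbb R^{2d}$ is generated as follows: $y$ is a Rademacher random variable; a noise vector $\boldsymbol\xi\sim N\big(\mathbf 0,\sigma_p^2(\mathbf I-\boldsymbol\mu\boldsymbol\mu^\top\|\boldsymbol\mu\|_2^{-2})\big)$ is drawn; one of $\mathbf x_1,\mathbf x_2$ equals $y\boldsymbol\mu$ and the other equals $\boldsymbol\xi$. Define $\mathrm{SNR}=\|\boldsymbol\mu\|_2/(\sigma_p\sqrt d)$. The training set is $S=\{(\mathbf x_i,y_i)\}_{i=1}^n$ drawn i.i.d. from $\mathcal D$, and $\boldsymbol\xi_i$ denotes the noise patch of $\mathbf x_i$. Network: $\sigma(z)=(\max\{0,z\})^q$ with $q>2$; weights $\mathbf W=(\mathbf W_{+1},\mathbf W_{-1})$, $\mathbf W_j=(\mathbf w_{j,1},\dots,\mathbf w_{j,m})$, $\mathbf w_{j,r}\in\mathbb R^d$; $F_j(\mathbf W_j,\mathbf x)=\frac1m\sum_{r=1}^m[\sigma(\langle\mathbf w_{j,r},\mathbf x_1\rangle)+\sigma(\langle\mathbf w_{j,r},\mathbf x_2\rangle)]$ and $f(\mathbf W,\mathbf x)=F_{+1}(\mathbf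 W_{+1},\mathbf x)-F_{-1}(\mathbf W_{-1},\mathbf x)$. Loss $\ell(z)=\log(1+e^{-z})$, training loss $L_S(\mathbf W)=\frac1n\sum_{i=1}^n\ell(y_if(\mathbf W,\mathbf x_i))$, test loss $L_{\mathcal D}(\mathbf W)=\mathbb E_{(\mathbf x,y)\sim\mathcal D}\ell(yf(\mathbf W,\mathbf x))$. Training: every entry of $\mathbf W^{(0)}$ is i.i.d. $N(0,\sigma_0^2)$, and $\mathbf w_{j,r}^{(t+1)}=\mathbf w_{j,r}^{(t)}-\eta\nabla_{\mathbf w_{j,r}}L_S(\mathbf W^{(t)})$. Signal-noise decomposition: there are unique coefficients $\gamma_{j,r}^{(t)}\ge0$ and $\rho_{j,r,i}^{(t)}$ with $\mathbf w_{j,r}^{(t)}=\mathbf w_{j,r}^{(0)}+j\gamma_{j,r}^{(t)}\|\boldsymbol\mu\|_2^{-2}\boldsymbol\mu+\sum_{i=1}^n\rho_{j,r,i}^{(t)}\|\boldsymbol\xi_i\|_2^{-2}\boldsymbol\xi_i$. $\tilde O,\tilde\Omega,\tilde\Theta$ hide logarithmic factors; $a\vee b=\max\{a,b\}$. *)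

theory Defs
  imports "HOL-Probability.Probability"
begin

definition vinner :: "nat \<Rightarrow> (nat \<Rightarrow> real) \<Rightarrow> (nat \<Rightarrow> real) \<Rightarrow> real" where
  "vinner d u v = (\<Sum>k<d. u k * v k)"

definition vnorm :: "nat \<Rightarrow> (nat \<Rightarrow> real) \<Rightarrow> real" where
  "vnorm d u = sqrt (vinner d u u)"

text \<open>Index set of the elementary random variables:
  Lab i       : label y_i (Rademacher),
  Pos i       : which patch carries the signal (fair coin),
  Noise i k   : k-th coordinate of a standard Gaussian vector g_i (noise of sample i),
  Init j r k  : k-th coordinate of w_{j,r}^(0), N(0, sigma_0^2).\<close>

datatype idx = Lab nat | Pos nat | Noise nat nat | Init int nat nat

definition rademacher :: "real measure" where
  "rademacher = measure_pmf (pmf_of_set {-1, 1})"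

definition coin :: "real measure" where
  "coin = measure_pmf (pmf_of_set {0, 1})"

definition comp_dist :: "real \<Rightarrow> idx \<Rightarrow> real measure" where
  "comp_dist \<sigma>\<^sub>0 i = (case i of
      Lab _ \<Rightarrow> rademacher
    | Pos _ \<Rightarrow> coin
    | Noise _ _ \<Rightarrow> density lborel (normal_density 0 1)
    | Init _ _ _ \<Rightarrow> density lborel (normal_density 0 \<sigma>\<^sub>0))"

definition idx_set :: "nat \<Rightarrow> nat \<Rightarrow> nat \<Rightarrow> idx set" where
  "idx_set n m d =
     {Lab i | i. i < n} \<union> {Pos i | i. i < n} \<union> {Noise i k | i k. i < n \<and> k < d}
     \<union> {Init j r k | j r k. j \<in> {-1, 1} \<and> r < m \<and> k < d}"

definition train_space :: "nat \<Rightarrow> nat \<Rightarrow> nat \<Rightarrow> real \<Rightarrow> (idx \<Rightarrow> real) measure" where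
  "train_space n m d \<sigma>\<^sub>0 = PiM (idx_set n m d) (comp_dist \<sigma>\<^sub>0)"

text \<open>Law of one fresh sample from D (indices Lab 0, Pos 0, Noise 0 k).\<close>
definition data_space :: "nat \<Rightarrow> (idx \<Rightarrow> real) measure" where
  "data_space d = PiM (idx_set 1 0 d) (comp_dist 1)"

text \<open>Noise: xi = sigma_p (I - mu mu^T / |mu|^2) g with g ~ N(0, I_d), so that
  xi ~ N(0, sigma_p^2 (I - mu mu^T |mu|^-2)).\<close>
definition noise :: "nat \<Rightarrow> (nat \<Rightarrow> real) \<Rightarrow> real \<Rightarrow> (idx \<Rightarrow> real) \<Rightarrow> nat \<Rightarrow> nat \<Rightarrow> real" where
  "noise d \<mu> \<sigma>\<^sub>p \<omega> i k =
     (let g = (\<lambda>k. \<omega> (Noise i k)) in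
      \<sigma>\<^sub>p * (g k - (vinner d g \<mu> / (vnorm d \<mu>)\<^sup>2) * \<mu> k))"

definition label :: "(idx \<Rightarrow> real) \<Rightarrow> nat \<Rightarrow> real" where
  "label \<omega> i = \<omega> (Lab i)"

definition patches :: "nat \<Rightarrow> (nat \<Rightarrow> real) \<Rightarrow> real \<Rightarrow> (idx \<Rightarrow> real) \<Rightarrow> nat
                        \<Rightarrow> (nat \<Rightarrow> real) \<times> (nat \<Rightarrow> real)" where
  "patches d \<mu> \<sigma>\<^sub>p \<omega> i =
     (let s = (\<lambda>k. label \<omega> i * \<mu> k); \<xi> = noise d \<mu> \<sigma>\<^sub>p \<omega> i in
      if \<omega> (Pos i) = 0 then (s, \<xi>) else (\<xi>, s))"

text \<open>Weights: W j r k is the k-th coordinate of w_{j,r}, j \<in> {-1,1}, r < m, k < d.\<close>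
type_synonym weights = "int \<Rightarrow> nat \<Rightarrow> nat \<Rightarrow> real"

definition init_weights :: "(idx \<Rightarrow> real) \<Rightarrow> weights" where
  "init_weights \<omega> = (\<lambda>j r k. \<omega> (Init j r k))"

definition act :: "real \<Rightarrow> real \<Rightarrow> real" where
  "act q z = (max 0 z) powr q"

definition Fnet :: "nat \<Rightarrow> nat \<Rightarrow> real \<Rightarrow> weights \<Rightarrow> int
                    \<Rightarrow> (nat \<Rightarrow> real) \<times> (nat \<Rightarrow> real) \<Rightarrow> real" where
  "Fnet d m q W j x = (1 / real m) *
     (\<Sum>r<m. act q (vinner d (W j r) (fst x)) + act q (vinner d (W j r) (snd x)))"

definition fnet :: "nat \<Rightarrow> nat \<Rightarrow> real \<Rightarrow> weights \<Rightarrow> (nat \<Rightarrow> real) \<times> (nat \<Rightarrow> real) \<Rightarrow> real" where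
  "fnet d m q W x = Fnet d m q W 1 x - Fnet d m q W (-1) x"

definition logloss :: "real \<Rightarrow> real" where
  "logloss z = ln (1 + exp (- z))"

definition train_loss :: "nat \<Rightarrow> nat \<Rightarrow> real \<Rightarrow> nat \<Rightarrow> (nat \<Rightarrow> real) \<Rightarrow> real
                          \<Rightarrow> (idx \<Rightarrow> real) \<Rightarrow> weights \<Rightarrow> real" where
  "train_loss d m q n \<mu> \<sigma>\<^sub>p \<omega> W =
     (1 / real n) * (\<Sum>i<n. logloss (label \<omega> i * fnet d m q W (patches d \<mu> \<sigma>\<^sub>p \<omega> i)))"

definition test_loss :: "nat \<Rightarrow> nat \<Rightarrow> real \<Rightarrow> (nat \<Rightarrow> real) \<Rightarrow> real \<Rightarrow> weights \<Rightarrow> ennreal" where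
  "test_loss d m q \<mu> \<sigma>\<^sub>p W =
     (\<integral>\<^sup>+ \<omega>. ennreal (logloss (label \<omega> 0 * fnet d m q W (patches d \<mu> \<sigma>\<^sub>p \<omega> 0))) \<partial>data_space d)"

definition partial_LS :: "nat \<Rightarrow> nat \<Rightarrow> real \<Rightarrow> nat \<Rightarrow> (nat \<Rightarrow> real) \<Rightarrow> real
                          \<Rightarrow> (idx \<Rightarrow> real) \<Rightarrow> weights \<Rightarrow> int \<Rightarrow> nat \<Rightarrow> nat \<Rightarrow> real" where
  "partial_LS d m q n \<mu> \<sigma>\<^sub>p \<omega> W j r k =
     deriv (\<lambda>s. train_loss d m q n \<mu> \<sigma>\<^sub>p \<omega> (W(j := (W j)(r := (W j r)(k := s))))) (W j r k)"

definition gd_step :: "nat \<Rightarrow> nat \<Rightarrow> real \<Rightarrow> nat \<Rightarrow> (nat \<Rightarrow> real) \<Rightarrow> real \<Rightarrow> real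
                       \<Rightarrow> (idx \<Rightarrow> real) \<Rightarrow> weights \<Rightarrow> weights" where
  "gd_step d m q n \<mu> \<sigma>\<^sub>p \<eta> \<omega> W = (\<lambda>j r k.
     if j \<in> {-1, 1} \<and> r < m \<and> k < d
     then W j r k - \<eta> * partial_LS d m q n \<mu> \<sigma>\<^sub>p \<omega> W j r k
     else W j r k)"

definition gd_iter :: "nat \<Rightarrow> nat \<Rightarrow> real \<Rightarrow> nat \<Rightarrow> (nat \<Rightarrow> real) \<Rightarrow> real \<Rightarrow> real
                       \<Rightarrow> (idx \<Rightarrow> real) \<Rightarrow> nat \<Rightarrow> weights" where
  "gd_iter d m q n \<mu> \<sigma>\<^sub>p \<eta> \<omega> t = (gd_step d m q n \<mu> \<sigma>\<^sub>p \<eta> \<omega> ^^ t) (init_weights \<omega>)"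

text \<open>The unique (gamma, rho) with
  w_{j,r}^(t) = w_{j,r}^(0) + j gamma |mu|^-2 mu + sum_i rho_i |xi_i|^-2 xi_i
  (rho_i := 0 for i >= n to make the pair unique).\<close>
definition sn_coeffs :: "nat \<Rightarrow> nat \<Rightarrow> (nat \<Rightarrow> real) \<Rightarrow> real \<Rightarrow> (idx \<Rightarrow> real)
                         \<Rightarrow> weights \<Rightarrow> int \<Rightarrow> nat \<Rightarrow> real \<times> (nat \<Rightarrow> real)" where
  "sn_coeffs d n \<mu> \<sigma>\<^sub>p \<omega> W j r =
     (THE (\<gamma>, \<rho>). (\<forall>i\<ge>n. \<rho> i = 0) \<and>
        (\<forall>k<d. W j r k = init_weights \<omega> j r k
              + real_of_int j * \<gamma> / (vnorm d \<mu>)\<^sup>2 * \<mu> k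
              + (\<Sum>i<n. \<rho> i / (vnorm d (noise d \<mu> \<sigma>\<^sub>p \<omega> i))\<^sup>2 * noise d \<mu> \<sigma>\<^sub>p \<omega> i k)))"

definition gamma_coeff where
  "gamma_coeff d n \<mu> \<sigma>\<^sub>p \<omega> W j r = fst (sn_coeffs d n \<mu> \<sigma>\<^sub>p \<omega> W j r)"

definition rho_coeff where
  "rho_coeff d n \<mu> \<sigma>\<^sub>p \<omega> W j r i = snd (sn_coeffs d n \<mu> \<sigma>\<^sub>p \<omega> W j r) i"

definition plog :: "nat \<Rightarrow> nat \<Rightarrow> real" where
  "plog k d = (1 + ln (real d)) ^ k"

end

theory Submission
  imports Defs
begin

text \<open>
  Since the noise patches are orthogonal to \<open>\<mu>\<close>, the signal components
  \<open>A = \<langle>j w, \<mu>\<rangle>\<close> evolve on their own: they never decrease, and a positive one satisfies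
  \<open>A' = A + a p A^(q-1)\<close>, where \<open>p\<close> is the average of the loss derivatives over the samples with
  label \<open>j\<close>. As \<open>\<integral> A^(1-q) dA\<close> converges at infinity, the total \<open>\<Sum> a p\<close> over the \<^emph>\<open>whole\<close> trajectory is
  bounded by a multiple of \<open>A(0)^(2-q)\<close>. All samples with the same label have margins that differ by
  a bounded amount, so this also bounds the total drift of every noise coefficient, and
  \<open>n SNR^q\<close> being large closes the bootstrap: the noise coefficients stay at their initial
  scale forever, with no separate treatment of early and late training.
  The same bound, used from below, gives the speed: as long as the loss exceeds \<open>\<epsilon>\<close>, \<open>p\<close> is at least of
  order \<open>\<epsilon>\<close>, so this cannot last longer than the stated time. Hence \<open>t = T\<close> works.
  The test loss follows from the Gaussian moment generating function of \<open>\<langle>w, \<xi>\<rangle>\<close> for fresh noise \<open>\<xi>\<close>.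
\<close>

section \<open>Gradients of the network\<close>

text \<open>The argument looks circular: margins within a class stay close only while noise inner
  products are small, and these are bounded through the sum of the loss derivatives.
  \<open>ok\<close> resolves this by strong induction on time, which works because the bound on the
  sum is free of the number of steps. Passing from the integral to discrete steps requires that a
  signal component at most doubles per step, however large it is. This holds since A^(q-2) is at
  most m exp(S), with S the average signal activation of the class, while p is at most exp(2 - S).
  Let \<alpha>, of order \<open>\<sigma>\<^sub>0\<close> |\<mu>|, bound the best initial signal
  component from below, and let \<beta>, of order s \<open>\<sigma>\<^sub>0 \<sigma>\<^sub>p\<close>
  sqrt d, be the noise scale. The drift of a noise coefficient is bounded by a constant times
  \<beta>^(q-1) \<alpha>^(2-q) / (n SNR^2). This is at most \<beta> once n SNR^q exceeds a constant
  times s^(q-2); \<open>\<sigma>\<^sub>0\<close> cancels. The slack s is a multiple of 1 + ln d,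
  which pays for the union bound. For fresh noise the activation is dominated by an exponential with
  rate 4 n^2, whose Gaussian mean yields the exp(-n^2).\<close>

lemma vinner_commute: "vinner d u v = vinner d v u"
  by (simp add: vinner_def mult.commute)

lemma vinner_upd:
  assumes "k < d"
  shows "vinner d (u(k := s)) v = vinner d u v + (s - u k) * v k"
proof -
  have "vinner d (u(k := s)) v = (\<Sum>l<d. u l * v l + (if l = k then (s - u k) * v k else 0))"
    unfolding vinner_def by (rule sum.cong) (auto simp: algebra_simps)
  then show ?thesis
    using assms by (simp add: sum.distrib vinner_def)
qed

lemma vinner_scale_right: "vinner d u (\<lambda>k. c * v k) = c * vinner d u v"
  by (simp add: vinner_def sum_distrib_left algebra_simps)

lemma vinner_nonneg: "vinner d u u \<ge> 0"
  unfolding vinner_def by (simp add: sum_nonneg)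

lemma vnorm_nonneg: "vnorm d u \<ge> 0"
  by (simp add: vnorm_def vinner_nonneg)

lemma vnorm_sq: "(vnorm d u)\<^sup>2 = vinner d u u"
  by (simp add: vnorm_def vinner_nonneg)

definition dact :: "real \<Rightarrow> real \<Rightarrow> real" where
  "dact q z = q * (max 0 z) powr (q - 1)"

lemma act_nonneg: "act q z \<ge> 0"
  by (simp add: act_def)

lemma dact_nonneg: "q \<ge> 0 \<Longrightarrow> dact q z \<ge> 0"
  by (simp add: dact_def)

lemma dact_le:
  assumes "q \<ge> 1" "z \<le> b" "b \<ge> 0"
  shows "dact q z \<le> q * b powr (q - 1)"
  using assms unfolding dact_def by (intro mult_left_mono powr_mono2) auto

lemma act_mono: "q \<ge> 0 \<Longrightarrow> x \<le> y \<Longrightarrow> act q x \<le> act q y"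
  unfolding act_def by (intro powr_mono2) auto

lemma act_le_one:
  assumes "q \<ge> 0" "z \<le> 1"
  shows "act q z \<le> 1"
  using assms unfolding act_def by (simp add: powr_le1)

text \<open>Away from zero \<open>act\<close> agrees locally with a power or with the zero function.
  At the kink the difference quotient is at most |h|^(q-1), which tends to zero because q >
  1.\<close>

lemma act_has_derivative:
  assumes q: "q > 1"
  shows "(act q has_real_derivative dact q z) (at z)"
proof -
  consider "z > 0" | "z < 0" | "z = 0" by linarith
  then show ?thesis
  proof cases
    case 1
    have "((\<lambda>x. x powr q) has_real_derivative q * z powr (q - 1)) (at z)"
      using 1 by (auto intro!: derivative_eq_intros)
    moreover have "eventually (\<lambda>x. x powr q = act q x) (nhds z)"
      using eventually_nhds_in_open[OF open_greaterThan, of z 0] 1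
      by (auto elim!: eventually_mono simp: act_def)
    ultimately show ?thesis
      using 1 by (subst DERIV_cong_ev[OF refl _ refl, symmetric]) (auto simp: dact_def)
  next
    case 2
    have "((\<lambda>x. 0) has_real_derivative 0) (at z)" by simp
    moreover have "eventually (\<lambda>x. 0 = act q x) (nhds z)"
      using eventually_nhds_in_open[OF open_lessThan, of z 0] 2
      by (auto elim!: eventually_mono simp: act_def max_def)
    ultimately have "(act q has_real_derivative 0) (at z)"
      using DERIV_cong_ev[of z z "\<lambda>x. 0" "act q" 0 0] by blast
    then show ?thesis
      using 2 by (simp add: dact_def max_def)
  next
    case 3
    have "((\<lambda>h. act q h / h) \<longlongrightarrow> 0) (at 0)"
    proof (rule Lim_null_comparison)
      show "\<forall>\<^sub>F h in at 0. norm (act q h / h) \<le> \<bar>h\<bar> powr (q - 1)"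
      proof (rule eventuallyI)
        fix h :: real
        show "norm (act q h / h) \<le> \<bar>h\<bar> powr (q - 1)"
          by (cases "h > 0") (simp_all add: act_def powr_diff divide_nonneg_nonpos)
      qed
      have "((\<lambda>h::real. \<bar>h\<bar> powr (q - 1)) \<longlongrightarrow> \<bar>0\<bar> powr (q - 1)) (at 0)"
        using q by (intro tendsto_powr2 tendsto_intros) auto
      then show "((\<lambda>h::real. \<bar>h\<bar> powr (q - 1)) \<longlongrightarrow> 0) (at 0)" by simp
    qed
    then show ?thesis
      using 3 by (simp add: DERIV_def act_def dact_def)
  qed
qed

section \<open>Margins and partial derivatives of the training loss\<close>

definition marg :: "nat \<Rightarrow> nat \<Rightarrow> real \<Rightarrow> (nat \<Rightarrow> real) \<Rightarrow> real \<Rightarrow> (idx \<Rightarrow> real) \<Rightarrow> weights \<Rightarrow> nat \<Rightarrow> real" where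
  "marg d m q \<mu> \<sigma>\<^sub>p \<omega> W i = label \<omega> i * fnet d m q W (patches d \<mu> \<sigma>\<^sub>p \<omega> i)"

text \<open>Minus the derivative of \<open>logloss\<close>, hence positive and decreasing.\<close>

definition lgrad :: "real \<Rightarrow> real" where
  "lgrad u = 1 / (1 + exp u)"

lemma lgrad_pos: "lgrad u > 0"
  by (simp add: lgrad_def add_pos_pos)

lemma lgrad_le: "lgrad u \<le> exp (- u)"
  by (simp add: lgrad_def exp_minus field_simps add_pos_pos)

text \<open>Margins that differ by a bounded amount give loss derivatives that differ by a bounded
  factor; this transfers information between samples of one class.\<close>

lemma lgrad_compare:
  assumes "v \<le> u + c" "c \<ge> 0"
  shows "lgrad u \<le> exp c * lgrad v"
proof -
  have "1 + exp v \<le> exp c * 1 + exp c * exp u"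
    using assms by (intro add_mono) (auto simp flip: exp_add)
  then show ?thesis
    by (simp add: lgrad_def field_simps add_pos_pos)
qed

lemma lgrad_ge:
  assumes "u \<le> v" "v \<ge> 0"
  shows "lgrad u \<ge> exp (- v) / 2"
proof -
  have "1 + exp u \<le> 2 * exp v" using assms
    by (smt (verit) exp_le_cancel_iff one_le_exp_iff)
  then show ?thesis
    by (simp add: lgrad_def exp_minus field_simps add_pos_pos)
qed

lemma logloss_has_derivative: "(logloss has_real_derivative - lgrad z) (at z)"
  unfolding logloss_def[abs_def] lgrad_def
  by (auto intro!: derivative_eq_intros simp: exp_minus field_simps add_pos_pos)

lemma logloss_le: "logloss u \<le> exp (- u)"
  unfolding logloss_def by (rule ln_add_one_self_le_self) simp

text \<open>Both patches pass through the same filters and the activations are summed, so the coin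
  deciding which patch carries the signal drops out.\<close>

lemma Fnet_patches:
  "Fnet d m q W j (patches d \<mu> \<sigma>\<^sub>p \<omega> i) = (1 / real m) *
     (\<Sum>r<m. act q (label \<omega> i * vinner d (W j r) \<mu>) + act q (vinner d (W j r) (noise d \<mu> \<sigma>\<^sub>p \<omega> i)))"
  by (auto simp: Fnet_def patches_def Let_def vinner_scale_right add.commute)

text \<open>The scalar \<open>c\<close> and the vector \<open>v\<close> cover both patches: the
  label with \<mu>, and 1 with the noise. A \<open>j'\<close> different from \<open>j\<close> stands
  for the filters of the other output sign, which do not move.\<close>

lemma deriv_sum_act:
  fixes W :: weights
  assumes q: "q > 1" and r: "r < m" and k: "k < d"
  shows "((\<lambda>s. \<Sum>r'<m. act q (c * vinner d ((W(j := (W j)(r := (W j r)(k := s)))) j' r') v))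
      has_real_derivative (if j' = j then dact q (c * vinner d (W j r) v) * (c * v k) else 0)) (at (W j r k))"
proof (cases "j' = j")
  case True
  have "((\<lambda>s. \<Sum>r'<m. act q (c * vinner d ((W(j := (W j)(r := (W j r)(k := s)))) j' r') v))
     has_real_derivative (\<Sum>r'<m. if r' = r then dact q (c * vinner d (W j r) v) * (c * v k) else 0)) (at (W j r k))"
  proof (rule DERIV_sum)
    fix r' assume "r' \<in> {..<m}"
    show "((\<lambda>s. act q (c * vinner d ((W(j := (W j)(r := (W j r)(k := s)))) j' r') v)) has_real_derivative
      (if r' = r then dact q (c * vinner d (W j r) v) * (c * v k) else 0)) (at (W j r k))"
    proof (cases "r' = r")
      case True
      have "((\<lambda>s. act q (c * (vinner d (W j r) v + (s - W j r k) * v k))) has_real_derivative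
         dact q (c * (vinner d (W j r) v + (W j r k - W j r k) * v k)) * (c * v k)) (at (W j r k))"
        by (rule DERIV_chain2[OF act_has_derivative[OF q]]) (auto intro!: derivative_eq_intros)
      then show ?thesis using True \<open>j' = j\<close> k by (simp add: vinner_upd)
    qed (use \<open>j' = j\<close> in simp)
  qed
  moreover have "(\<Sum>r'<m. if r' = r then dact q (c * vinner d (W j r) v) * (c * v k) else 0)
      = dact q (c * vinner d (W j r) v) * (c * v k)"
    using r by (subst sum.delta) auto
  ultimately show ?thesis by (simp only: True simp_thms if_True)
next
  case False
  then show ?thesis by simp
qed

lemma deriv_marg:
  assumes q: "q > 1" and r: "r < m" and k: "k < d" and j: "j \<in> {-1, 1}"
  shows "((\<lambda>s. marg d m q \<mu> \<sigma>\<^sub>p \<omega> (W(j := (W j)(r := (W j r)(k := s)))) i)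
      has_real_derivative (label \<omega> i * of_int j / real m *
         (dact q (label \<omega> i * vinner d (W j r) \<mu>) * (label \<omega> i * \<mu> k)
        + dact q (vinner d (W j r) (noise d \<mu> \<sigma>\<^sub>p \<omega> i)) * noise d \<mu> \<sigma>\<^sub>p \<omega> i k))) (at (W j r k))"
proof -
  let ?y = "label \<omega> i" and ?x = "noise d \<mu> \<sigma>\<^sub>p \<omega> i"
  let ?D = "\<lambda>j'. (if j' = j then dact q (?y * vinner d (W j r) \<mu>) * (?y * \<mu> k) else 0) +
       (if j' = j then dact q (1 * vinner d (W j r) ?x) * (1 * ?x k) else 0)"
  have F: "((\<lambda>s. Fnet d m q (W(j := (W j)(r := (W j r)(k := s)))) j' (patches d \<mu> \<sigma>\<^sub>p \<omega> i))
     has_real_derivative (1 / real m) * ?D j') (at (W j r k))" for j'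
    using DERIV_cmult[OF DERIV_add[OF deriv_sum_act[OF q r k, of ?y W j j' \<mu>]
            deriv_sum_act[OF q r k, of 1 W j j' ?x]], of "1 / real m"]
    unfolding Fnet_patches sum.distrib mult_1 .
  have "((\<lambda>s. marg d m q \<mu> \<sigma>\<^sub>p \<omega> (W(j := (W j)(r := (W j r)(k := s)))) i)
     has_real_derivative ?y * ((1 / real m) * ?D 1 - (1 / real m) * ?D (-1))) (at (W j r k))"
    unfolding marg_def fnet_def by (intro DERIV_cmult DERIV_diff F)
  then show ?thesis using j by (auto simp: algebra_simps)
qed

lemma partial_LS_eq:
  assumes q: "q > 1" and r: "r < m" and k: "k < d" and j: "j \<in> {-1, 1}"
  shows "partial_LS d m q n \<mu> \<sigma>\<^sub>p \<omega> W j r k = - (1 / (real n * real m)) *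
    (\<Sum>i<n. lgrad (marg d m q \<mu> \<sigma>\<^sub>p \<omega> W i) * (label \<omega> i * of_int j *
         (dact q (label \<omega> i * vinner d (W j r) \<mu>) * (label \<omega> i * \<mu> k)
        + dact q (vinner d (W j r) (noise d \<mu> \<sigma>\<^sub>p \<omega> i)) * noise d \<mu> \<sigma>\<^sub>p \<omega> i k)))"
proof -
  have W: "W(j := (W j)(r := (W j r)(k := W j r k))) = W" by simp
  have "((\<lambda>s. train_loss d m q n \<mu> \<sigma>\<^sub>p \<omega> (W(j := (W j)(r := (W j r)(k := s)))))
    has_real_derivative (1 / real n) * (\<Sum>i<n. - lgrad (marg d m q \<mu> \<sigma>\<^sub>p \<omega>
          (W(j := (W j)(r := (W j r)(k := W j r k)))) i) *
       (label \<omega> i * of_int j / real m *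
         (dact q (label \<omega> i * vinner d (W j r) \<mu>) * (label \<omega> i * \<mu> k)
        + dact q (vinner d (W j r) (noise d \<mu> \<sigma>\<^sub>p \<omega> i)) * noise d \<mu> \<sigma>\<^sub>p \<omega> i k)))) (at (W j r k))"
    unfolding train_loss_def marg_def[symmetric]
    by (intro DERIV_cmult DERIV_sum DERIV_chain2[OF logloss_has_derivative] deriv_marg[OF q r k j])
  from DERIV_imp_deriv[OF this] show ?thesis
    unfolding partial_LS_def W sum_distrib_left
    by (auto intro!: sum.cong simp: divide_simps)
qed

section \<open>Training dynamics on a good sample\<close>

text \<open>The factor 1/(q-2) comes from integrating x^(1-q); the factor 2^(q-1) is the price of
  steps that may double x.\<close>

definition track_const :: "real \<Rightarrow> real" where
  "track_const q = 2 powr (q - 1) / (q - 2)"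

lemma track_const_pos: "q > 2 \<Longrightarrow> track_const q > 0"
  by (simp add: track_const_def)

text \<open>Mean value theorem for x^(2-q): on an interval where x at most doubles, the factor
  x^(1-q) in the derivative loses at most 2^(q-1) against its value at the left end.\<close>

lemma powr_increment_bound:
  fixes q u v :: real
  assumes q: "q > 2" and u: "u > 0" "u \<le> v" "v \<le> 2 * u"
  shows "v - u \<le> track_const q * u powr (q - 1) * (u powr (-(q - 2)) - v powr (-(q - 2)))"
proof (cases "u = v")
  case False
  with u have uv: "u < v" by simp
  have "\<exists>z. u < z \<and> z < v \<and> v powr (-(q-2)) - u powr (-(q-2)) = (v - u) * ((-(q-2)) * z powr (-(q-2) - 1))"
  proof (rule MVT2[OF uv])
    fix x assume "u \<le> x" "x \<le> v"
    then have "x > 0" using u by simp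
    then show "((\<lambda>z. z powr (-(q-2))) has_real_derivative (-(q-2)) * x powr (-(q-2) - 1)) (at x)"
      by (auto intro!: derivative_eq_intros)
  qed
  then obtain z where z: "u < z" "z < v"
    and eq: "v powr (-(q-2)) - u powr (-(q-2)) = (v - u) * ((-(q-2)) * z powr (-(q-2) - 1))" by blast
  have "(2 * u) powr (-(q-1)) \<le> z powr (-(q-1))"
    using z u q by (intro powr_mono2') auto
  moreover have "(2 * u) powr (-(q-1)) * (2 powr (q-1) * u powr (q-1)) = 1"
    using u by (simp add: powr_mult powr_diff)
  ultimately have "1 \<le> z powr (-(q-1)) * (2 powr (q-1) * u powr (q-1))"
    by (metis mult_right_mono mult_nonneg_nonneg powr_ge_zero)
  then have "(v - u) * 1 \<le> (v - u) * (z powr (-(q-1)) * (2 powr (q-1) * u powr (q-1)))"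
    using u by (intro mult_left_mono) auto
  also have "\<dots> = track_const q * u powr (q - 1) * ((v - u) * ((q-2) * z powr (-(q-2) - 1)))"
    using q by (simp add: track_const_def)
  also have "(v - u) * ((q-2) * z powr (-(q-2) - 1)) = u powr (-(q - 2)) - v powr (-(q - 2))"
    using eq by (simp add: algebra_simps)
  finally show ?thesis by simp
qed simp

text \<open>Discrete form of the comparison of \<open>x' = a p x^(q-1)\<close> with the convergent integral of
  \<open>x^(1-q)\<close>; the bound does not depend on the number of steps.\<close>
lemma tracking_bound:
  fixes q a :: real and x p :: "nat \<Rightarrow> real"
  assumes q: "q > 2" and a: "a \<ge> 0" and p: "\<And>t. p t \<ge> 0"
    and \<tau>: "\<tau> \<le> T" "x \<tau> \<ge> x0" "x0 > 0"
    and step: "\<And>t. t < T \<Longrightarrow> x t > 0 \<Longrightarrow> x (Suc t) = x t + a * p t * x t powr (q - 1)"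
    and small: "\<And>t. t < T \<Longrightarrow> x t > 0 \<Longrightarrow> a * p t * x t powr (q - 2) \<le> 1"
  shows "(\<Sum>t=\<tau>..<T. a * p t) \<le> track_const q * x0 powr (-(q - 2))"
proof -
  let ?f = "\<lambda>x. x powr (-(q - 2))"
  \<comment> \<open>The difference of the two powers telescopes; \<open>x T' \<ge> x0\<close> is
    carried along to keep the recursion in its positive regime.\<close>
  have "T' \<le> T \<Longrightarrow> x T' \<ge> x0 \<and> (\<Sum>t=\<tau>..<T'. a * p t) \<le> track_const q * (?f (x \<tau>) - ?f (x T'))"
    if "T' \<ge> \<tau>" for T'
    using that
  proof (induction T' rule: dec_induct)
    case (step t)
    then have t: "t < T" and pos: "x t > 0" and ge: "x t \<ge> x0"
      and IH: "(\<Sum>t=\<tau>..<t. a * p t) \<le> track_const q * (?f (x \<tau>) - ?f (x t))"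
      using \<tau> by auto
    note eq = assms(7)[OF t pos]
    have "a * p t * x t powr (q - 1) = (a * p t * x t powr (q - 2)) * x t"
      using pos powr_add[of "x t" "q - 2" 1] by simp
    also have "\<dots> \<le> 1 * x t"
      using small[OF t pos] pos by (intro mult_right_mono) auto
    finally have le2: "x (Suc t) \<le> 2 * x t" using eq by simp
    have ge': "x t \<le> x (Suc t)" using eq a p[of t] by simp
    have "a * p t * x t powr (q - 1) \<le> x t powr (q - 1) * (track_const q * (?f (x t) - ?f (x (Suc t))))"
      using powr_increment_bound[OF q pos ge' le2] eq by (simp add: mult.commute mult.left_commute)
    then have "a * p t \<le> track_const q * (?f (x t) - ?f (x (Suc t)))"
      using pos by (simp add: mult.commute[of "a * p t"])
    then show ?case using IH ge ge' step.hyps by (simp add: algebra_simps)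
  qed (use \<tau> in auto)
  from this[of T] \<tau> have "(\<Sum>t=\<tau>..<T. a * p t) \<le> track_const q * (?f (x \<tau>) - ?f (x T))" by simp
  also have "\<dots> \<le> track_const q * ?f x0"
  proof (rule mult_left_mono)
    have "?f (x \<tau>) \<le> ?f x0" using q \<tau> by (intro powr_mono2') auto
    then show "?f (x \<tau>) - ?f (x T) \<le> ?f x0" by (smt (verit) powr_ge_zero)
  qed (use track_const_pos[OF q] in simp)
  finally show ?thesis .
qed

text \<open>Beyond 1, the inequality \<open>ln z \<le> z - 1\<close> turns z^q = exp(q ln z) into an
  exponential of a linear function, whose Gaussian mean is explicit. The rate \<open>L\<close> stays
  free so that it can be tuned for the test loss.\<close>

lemma act_le_exp:
  assumes "q \<ge> 0" "L \<ge> q"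
  shows "act q z \<le> 1 + exp (L * (z - 1))"
proof (cases "z \<le> 1")
  case True
  then show ?thesis using act_le_one[OF assms(1) True] by (smt (verit) exp_gt_zero)
next
  case False
  then have "act q z = exp (q * ln z)" by (simp add: act_def powr_def)
  also have "q * ln z \<le> L * (z - 1)"
    using False assms ln_le_minus_one[of z] by (intro mult_mono) auto
  finally show ?thesis by (smt (verit) exp_le_cancel_iff)
qed

text \<open>The argument of the logarithm grows by a factor of at most e^c. Through this Lipschitz
  property excess fresh noise enters the test loss additively.\<close>

lemma logloss_shift:
  assumes "v \<ge> u - c" "c \<ge> 0"
  shows "logloss v \<le> logloss u + c"
proof -
  have "exp (- v) \<le> exp c * exp (- u)" using assms by (simp flip: exp_add)
  then have "1 + exp (- v) \<le> exp c * (1 + exp (- u))"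
    unfolding distrib_left using assms(2) by (intro add_mono) auto
  then have "ln (1 + exp (- v)) \<le> ln (exp c * (1 + exp (- u)))"
    by (simp add: add_pos_pos)
  moreover have "1 + exp (- u) > 0" by (simp add: add_pos_pos)
  ultimately show ?thesis by (simp add: logloss_def ln_mult)
qed

section \<open>Projection onto the orthogonal complement of the signal\<close>

definition proj :: "nat \<Rightarrow> (nat \<Rightarrow> real) \<Rightarrow> (nat \<Rightarrow> real) \<Rightarrow> nat \<Rightarrow> real" where
  "proj d \<mu> v k = v k - vinner d v \<mu> / (vnorm d \<mu>)\<^sup>2 * \<mu> k"

lemma noise_eq_proj: "noise d \<mu> \<sigma>\<^sub>p \<omega> i k = \<sigma>\<^sub>p * proj d \<mu> (\<lambda>k. \<omega> (Noise i k)) k"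
  by (simp add: noise_def proj_def Let_def)

lemma vinner_proj: "vinner d (proj d \<mu> u) v = vinner d u v - vinner d u \<mu> * vinner d v \<mu> / (vnorm d \<mu>)\<^sup>2"
proof -
  have "vinner d (proj d \<mu> u) v = (\<Sum>k<d. u k * v k - vinner d u \<mu> / (vnorm d \<mu>)\<^sup>2 * (v k * \<mu> k))"
    unfolding vinner_def[of d "proj d \<mu> u"] proj_def by (simp add: algebra_simps)
  also have "\<dots> = vinner d u v - vinner d u \<mu> / (vnorm d \<mu>)\<^sup>2 * vinner d v \<mu>"
    unfolding sum_subtractf sum_distrib_left[symmetric] by (simp add: vinner_def)
  finally show ?thesis by simp
qed

lemma vinner_proj_\<mu>: "vnorm d \<mu> > 0 \<Longrightarrow> vinner d (proj d \<mu> u) \<mu> = 0"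
  by (simp add: vinner_proj vnorm_sq[symmetric])

lemma vinner_proj_proj:
  "vnorm d \<mu> > 0 \<Longrightarrow> vinner d (proj d \<mu> u) (proj d \<mu> v) = vinner d u v - vinner d u \<mu> * vinner d v \<mu> / (vnorm d \<mu>)\<^sup>2"
  using vinner_proj[of d \<mu> u "proj d \<mu> v"] vinner_proj[of d \<mu> v u] vinner_proj_\<mu>[of d \<mu> v]
  by (simp add: vinner_commute mult.commute)

lemma vinner_proj_proj_le:
  assumes "vnorm d \<mu> > 0"
  shows "vinner d (proj d \<mu> u) (proj d \<mu> u) \<le> (vnorm d u)\<^sup>2"
  unfolding vinner_proj_proj[OF assms] vnorm_sq[of d u] by simp

text \<open>Everything the dynamics uses about the sample, with no probability left. \<beta> bounds
  the initial noise inner products from above, \<alpha> the best initial signal component of each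
  class from below. \<open>cross\<close> says that the Gram matrix of the noise, scaled by its
  diagonal, is diagonally dominant. \<open>signal_dominates\<close> is where n SNR^q enters: its
  left side bounds the drift of a noise coefficient over the whole training.\<close>

locale cnn_training =
  fixes d n m :: nat and q \<sigma>\<^sub>p \<eta> \<beta> \<alpha> :: real and \<mu> :: "nat \<Rightarrow> real" and \<omega> :: "idx \<Rightarrow> real"
  assumes q: "q > 2" and n: "n \<ge> 1" and m: "m \<ge> 1" and \<eta>: "\<eta> > 0" and \<mu>: "vnorm d \<mu> > 0"
    and lab: "\<And>i. i < n \<Longrightarrow> label \<omega> i \<in> {-1, 1}"
    and cnt: "\<And>j. j \<in> {-1, 1::int} \<Longrightarrow> real (card {i. i < n \<and> label \<omega> i = of_int j}) \<ge> real n / 8"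
    and orth: "\<And>i. i < n \<Longrightarrow> vinner d (noise d \<mu> \<sigma>\<^sub>p \<omega> i) \<mu> = 0"
    and noise_pos: "\<And>i. i < n \<Longrightarrow> vnorm d (noise d \<mu> \<sigma>\<^sub>p \<omega> i) > 0"
    and noise_le: "\<And>i. i < n \<Longrightarrow> (vnorm d (noise d \<mu> \<sigma>\<^sub>p \<omega> i))\<^sup>2 \<le> 4 * \<sigma>\<^sub>p\<^sup>2 * d"
    and cross: "\<And>l. l < n \<Longrightarrow> (\<Sum>i\<in>{..<n}-{l}. \<bar>vinner d (noise d \<mu> \<sigma>\<^sub>p \<omega> i) (noise d \<mu> \<sigma>\<^sub>p \<omega> l)\<bar> /
                    (vnorm d (noise d \<mu> \<sigma>\<^sub>p \<omega> i))\<^sup>2) \<le> 1/2"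
    and init_noise: "\<And>j r i. j \<in> {-1, 1} \<Longrightarrow> r < m \<Longrightarrow> i < n \<Longrightarrow>
                    \<bar>vinner d (init_weights \<omega> j r) (noise d \<mu> \<sigma>\<^sub>p \<omega> i)\<bar> \<le> \<beta>"
    and init_signal: "\<And>j r. j \<in> {-1, 1} \<Longrightarrow> r < m \<Longrightarrow> \<bar>vinner d (init_weights \<omega> j r) \<mu>\<bar> \<le> 1/2"
    and init_active: "\<And>j. j \<in> {-1, 1} \<Longrightarrow> \<exists>r<m. of_int j * vinner d (init_weights \<omega> j r) \<mu> \<ge> \<alpha>"
    and \<alpha>: "\<alpha> > 0"
    and \<beta>: "3 * \<beta> \<le> 1"
    and step_size: "exp 2 * q * \<eta> * (vnorm d \<mu>)\<^sup>2 \<le> 1"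
    and signal_dominates: "4 * \<sigma>\<^sub>p\<^sup>2 * d / (real n * (vnorm d \<mu>)\<^sup>2) * (3 * \<beta>) powr (q - 1)
             * (8 * exp 3) * (track_const q * \<alpha> powr (-(q - 2))) \<le> \<beta>"
begin

abbreviation "y \<equiv> label \<omega>"
abbreviation "\<xi> \<equiv> noise d \<mu> \<sigma>\<^sub>p \<omega>"
abbreviation "W \<equiv> gd_iter d m q n \<mu> \<sigma>\<^sub>p \<eta> \<omega>"

text \<open>In the paper's notation \<open>A t j r - A 0 j r\<close> is \<open>\<gamma>\<close> and \<open>R t j r i\<close> is \<open>\<rho>\<close>; the margin of every
  sample with label \<open>j\<close> is \<open>S t j\<close> up to a bounded error.\<close>

definition "G t i = lgrad (marg d m q \<mu> \<sigma>\<^sub>p \<omega> (W t) i)"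
definition "A t j r = of_int j * vinner d (W t j r) \<mu>"
definition "Z t j r i = vinner d (W t j r) (\<xi> i)"
definition "P t j = (1 / real n) * (\<Sum>i | i < n \<and> y i = of_int j. G t i)"
definition "S t j = (1 / real m) * (\<Sum>r<m. act q (A t j r))"
definition "a = \<eta> * q * (vnorm d \<mu>)\<^sup>2 / real m"

text \<open>The coefficients read off from the gradient update. Their vanishing for
  \<open>i \<ge> n\<close> matches the normalisation that makes \<open>sn_coeffs\<close>
  unique.\<close>

primrec R :: "nat \<Rightarrow> int \<Rightarrow> nat \<Rightarrow> nat \<Rightarrow> real" where
  "R 0 = (\<lambda>j r i. 0)"
| "R (Suc t) = (\<lambda>j r i. R t j r i +
     (if i < n then \<eta> / (real n * real m) * (G t i * (y i * of_int j * dact q (Z t j r i)))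
                      * (vnorm d (\<xi> i))\<^sup>2 else 0))"

lemma G_pos: "G t i > 0"
  by (simp add: G_def lgrad_pos)

lemma P_nonneg: "P t j \<ge> 0"
  unfolding P_def using G_pos by (intro mult_nonneg_nonneg sum_nonneg) (auto intro: less_imp_le)

lemma a_pos: "a > 0"
  using q n m \<eta> \<mu> by (simp add: a_def)

lemma \<beta>_nonneg: "\<beta> \<ge> 0"
proof -
  have "0 < m" "0 < n" using n m by auto
  from init_noise[of 1, OF _ this] show ?thesis by simp
qed

section \<open>One gradient step along the signal and along the noise\<close>

lemma W_0: "W 0 = init_weights \<omega>"
  by (simp add: gd_iter_def)

lemma W_Suc:
  assumes "j \<in> {-1, 1}" "r < m" "k < d"
  shows "W (Suc t) j r k = W t j r k + \<eta> / (real n * real m) * (\<Sum>i<n. G t i * (y i * of_int j *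
     (dact q (y i * vinner d (W t j r) \<mu>) * (y i * \<mu> k) + dact q (Z t j r i) * \<xi> i k)))"
proof -
  have "W (Suc t) = gd_step d m q n \<mu> \<sigma>\<^sub>p \<eta> \<omega> (W t)" by (simp add: gd_iter_def)
  moreover have "q > 1" using q by simp
  ultimately show ?thesis
    using assms by (simp add: gd_step_def partial_LS_eq G_def Z_def)
qed

lemma vinner_W_Suc:
  assumes "j \<in> {-1, 1}" "r < m"
  shows "vinner d (W (Suc t) j r) v = vinner d (W t j r) v + \<eta> / (real n * real m) *
     (\<Sum>i<n. G t i * (y i * of_int j *
     (dact q (y i * vinner d (W t j r) \<mu>) * (y i * vinner d \<mu> v) + dact q (Z t j r i) * vinner d (\<xi> i) v)))"
proof -
  have "vinner d (W (Suc t) j r) v = (\<Sum>k<d. W t j r k * v k + \<eta> / (real n * real m) *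
     (\<Sum>i<n. G t i * (y i * of_int j *
     (dact q (y i * vinner d (W t j r) \<mu>) * (y i * (\<mu> k * v k)) + dact q (Z t j r i) * (\<xi> i k * v k)))))"
    unfolding vinner_def[of d "W (Suc t) j r"]
  proof (rule sum.cong)
    fix k assume "k \<in> {..<d}"
    then have k: "k < d" by simp
    have e: "G t i * (y i * of_int j * (dact q (y i * vinner d (W t j r) \<mu>) * (y i * (\<mu> k * v k))
          + dact q (Z t j r i) * (\<xi> i k * v k)))
       = G t i * (y i * of_int j * (dact q (y i * vinner d (W t j r) \<mu>) * (y i * \<mu> k)
          + dact q (Z t j r i) * \<xi> i k)) * v k" for i
      by (simp add: algebra_simps)
    show "W (Suc t) j r k * v k = W t j r k * v k + \<eta> / (real n * real m) *
     (\<Sum>i<n. G t i * (y i * of_int j *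
     (dact q (y i * vinner d (W t j r) \<mu>) * (y i * (\<mu> k * v k)) + dact q (Z t j r i) * (\<xi> i k * v k))))"
      unfolding W_Suc[OF assms k] e by (simp add: distrib_right sum_distrib_right)
  qed simp
  also have "\<dots> = vinner d (W t j r) v + \<eta> / (real n * real m) *
     (\<Sum>k<d. \<Sum>i<n. G t i * (y i * of_int j *
     (dact q (y i * vinner d (W t j r) \<mu>) * (y i * (\<mu> k * v k)) + dact q (Z t j r i) * (\<xi> i k * v k))))"
    by (simp add: sum.distrib vinner_def sum_distrib_left)
  also have "(\<Sum>k<d. \<Sum>i<n. G t i * (y i * of_int j *
     (dact q (y i * vinner d (W t j r) \<mu>) * (y i * (\<mu> k * v k)) + dact q (Z t j r i) * (\<xi> i k * v k))))
     = (\<Sum>i<n. G t i * (y i * of_int j *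
     (dact q (y i * vinner d (W t j r) \<mu>) * (y i * vinner d \<mu> v) + dact q (Z t j r i) * vinner d (\<xi> i) v)))"
    unfolding vinner_def[of d \<mu> v] vinner_def[of d "\<xi> _" v]
    by (subst sum.swap) (simp add: sum_distrib_left sum.distrib distrib_left)
  finally show ?thesis .
qed

lemma y_sq: "i < n \<Longrightarrow> y i * y i = 1"
  using lab[of i] by auto

text \<open>Orthogonality removes every noise term when the update is paired with \<mu>, and j^2 =
  y_i^2 = 1 absorbs the signs. What remains is a sum of non-negative terms, which is why
  \<open>A\<close> never decreases.\<close>

lemma A_Suc:
  assumes j: "j \<in> {-1, 1}" and r: "r < m"
  shows "A (Suc t) j r = A t j r + \<eta> * (vnorm d \<mu>)\<^sup>2 / (real n * real m) *
     (\<Sum>i<n. G t i * dact q (y i * of_int j * A t j r))"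
proof -
  have j2: "real_of_int j * real_of_int j = 1" using j by auto
  have "(\<Sum>i<n. G t i * (y i * of_int j *
     (dact q (y i * vinner d (W t j r) \<mu>) * (y i * vinner d \<mu> \<mu>) + dact q (Z t j r i) * vinner d (\<xi> i) \<mu>)))
    = (\<Sum>i<n. of_int j * (vnorm d \<mu>)\<^sup>2 * (G t i * dact q (y i * of_int j * A t j r)))"
  proof (rule sum.cong)
    fix i assume "i \<in> {..<n}"
    then have i: "i < n" by simp
    have "y i * of_int j * A t j r = (of_int j * of_int j) * (y i * vinner d (W t j r) \<mu>)"
      unfolding A_def by (simp only: ac_simps)
    with j2 have e: "y i * of_int j * A t j r = y i * vinner d (W t j r) \<mu>" by simp
    show "G t i * (y i * of_int j *
     (dact q (y i * vinner d (W t j r) \<mu>) * (y i * vinner d \<mu> \<mu>) + dact q (Z t j r i) * vinner d (\<xi> i) \<mu>))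
     = of_int j * (vnorm d \<mu>)\<^sup>2 * (G t i * dact q (y i * of_int j * A t j r))"
      unfolding e orth[OF i] vnorm_sq using y_sq[OF i] by (simp add: algebra_simps)
  qed simp
  then have "A (Suc t) j r = of_int j * vinner d (W t j r) \<mu> + of_int j * (\<eta> / (real n * real m) *
     (\<Sum>i<n. of_int j * (vnorm d \<mu>)\<^sup>2 * (G t i * dact q (y i * of_int j * A t j r))))"
    unfolding A_def[of "Suc t"] vinner_W_Suc[OF j r] by (simp only: distrib_left)
  also have "\<dots> = A t j r + (real_of_int j * real_of_int j) * (\<eta> * (vnorm d \<mu>)\<^sup>2 / (real n * real m) *
     (\<Sum>i<n. G t i * dact q (y i * of_int j * A t j r)))"
    by (simp add: A_def sum_distrib_left[symmetric])
  finally show ?thesis using j2 by simp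
qed

lemma A_mono_Suc: "j \<in> {-1, 1} \<Longrightarrow> r < m \<Longrightarrow> A t j r \<le> A (Suc t) j r"
  unfolding A_Suc le_add_same_cancel1 using \<eta> q
  by (intro mult_nonneg_nonneg divide_nonneg_nonneg sum_nonneg dact_nonneg less_imp_le[OF G_pos]) auto

lemma A_mono: "j \<in> {-1, 1} \<Longrightarrow> r < m \<Longrightarrow> s \<le> t \<Longrightarrow> A s j r \<le> A t j r"
  using A_mono_Suc lift_Suc_mono_le[of "\<lambda>t. A t j r"] by blast

lemma A_0: "j \<in> {-1, 1} \<Longrightarrow> r < m \<Longrightarrow> \<bar>A 0 j r\<bar> \<le> 1/2"
  using init_signal[of j r] by (auto simp: A_def W_0)

lemma A_ge: "j \<in> {-1, 1} \<Longrightarrow> r < m \<Longrightarrow> A t j r \<ge> - (1/2)"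
  using A_mono[of j r 0 t] A_0[of j r] by fastforce

text \<open>For a positive component the activation derivative vanishes at -A, so only samples with
  label \<open>j\<close> contribute, and their average \<open>P\<close> factors out.\<close>

lemma A_Suc_pos:
  assumes j: "j \<in> {-1, 1}" and r: "r < m" and pos: "A t j r > 0"
  shows "A (Suc t) j r = A t j r + a * P t j * A t j r powr (q - 1)"
proof -
  have "(\<Sum>i<n. G t i * dact q (y i * of_int j * A t j r))
      = (\<Sum>i<n. if y i = of_int j then G t i * (q * A t j r powr (q - 1)) else 0)"
  proof (rule sum.cong)
    fix i assume "i \<in> {..<n}"
    then have "y i \<in> {-1,1}" using lab by simp
    then show "G t i * dact q (y i * of_int j * A t j r) =
        (if y i = of_int j then G t i * (q * A t j r powr (q - 1)) else 0)"
      using j pos by (auto simp: dact_def max_def)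
  qed simp
  also have "\<dots> = (\<Sum>i | i < n \<and> y i = of_int j. G t i * (q * A t j r powr (q - 1)))"
    by (simp add: sum.inter_filter[symmetric] lessThan_def)
  also have "\<dots> = n * P t j * (q * A t j r powr (q - 1))"
    using n by (simp add: P_def sum_distrib_right)
  finally show ?thesis
    unfolding A_Suc[OF j r] a_def using n by (simp add: field_simps)
qed

lemma S_mono: "j \<in> {-1, 1} \<Longrightarrow> s \<le> t \<Longrightarrow> S s j \<le> S t j"
  unfolding S_def using q by (intro mult_left_mono sum_mono act_mono A_mono) auto

text \<open>\<open>R\<close> is defined by its recursion and \<open>A\<close> has one by
  \<open>A_Suc\<close>; the induction matches both with the gradient update term by term. The result
  serves to bound inner products as well as to identify \<open>sn_coeffs\<close>.\<close>

lemma W_decomposition: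
  assumes j: "j \<in> {-1, 1}" and r: "r < m" and k: "k < d"
  shows "W t j r k = init_weights \<omega> j r k + of_int j * (A t j r - A 0 j r) / (vnorm d \<mu>)\<^sup>2 * \<mu> k
     + (\<Sum>i<n. R t j r i / (vnorm d (\<xi> i))\<^sup>2 * \<xi> i k)"
proof (induction t)
  case 0
  then show ?case by (simp add: W_0)
next
  case (Suc t)
  let ?c = "\<eta> / (real n * real m)"
  have j2: "real_of_int j * real_of_int j = 1" using j by auto
  have A: "of_int j * (A (Suc t) j r - A 0 j r) / (vnorm d \<mu>)\<^sup>2 * \<mu> k =
     of_int j * (A t j r - A 0 j r) / (vnorm d \<mu>)\<^sup>2 * \<mu> k +
     ?c * (\<Sum>i<n. G t i * (of_int j * dact q (y i * vinner d (W t j r) \<mu>) * \<mu> k))"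
  proof -
    have "y i * of_int j * A t j r = (of_int j * of_int j) * (y i * vinner d (W t j r) \<mu>)" for i
      unfolding A_def by (simp only: ac_simps)
    with j2 have e: "y i * of_int j * A t j r = y i * vinner d (W t j r) \<mu>" for i by simp
    show ?thesis
      unfolding A_Suc[OF j r] e using \<mu>
      by (simp add: field_simps sum_distrib_left sum_distrib_right)
  qed
  have B: "(\<Sum>i<n. R (Suc t) j r i / (vnorm d (\<xi> i))\<^sup>2 * \<xi> i k) = (\<Sum>i<n. R t j r i / (vnorm d (\<xi> i))\<^sup>2 * \<xi> i k)
     + ?c * (\<Sum>i<n. G t i * (y i * of_int j * dact q (Z t j r i) * \<xi> i k))"
    unfolding sum_distrib_left sum.distrib[symmetric]
  proof (rule sum.cong)
    fix i assume "i \<in> {..<n}"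
    then have "i < n" "vnorm d (\<xi> i) > 0" using noise_pos by auto
    then show "R (Suc t) j r i / (vnorm d (\<xi> i))\<^sup>2 * \<xi> i k = R t j r i / (vnorm d (\<xi> i))\<^sup>2 * \<xi> i k +
       ?c * (G t i * (y i * of_int j * dact q (Z t j r i) * \<xi> i k))"
      by (simp add: add_divide_distrib distrib_right)
  qed simp
  have "(\<Sum>i<n. G t i * (y i * of_int j *
     (dact q (y i * vinner d (W t j r) \<mu>) * (y i * \<mu> k) + dact q (Z t j r i) * \<xi> i k)))
    = (\<Sum>i<n. G t i * (of_int j * dact q (y i * vinner d (W t j r) \<mu>) * \<mu> k))
    + (\<Sum>i<n. G t i * (y i * of_int j * dact q (Z t j r i) * \<xi> i k))"
    unfolding sum.distrib[symmetric]
  proof (rule sum.cong)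
    fix i assume "i \<in> {..<n}"
    then have "y i = 1 \<or> y i = -1" using lab[of i] by auto
    then show "G t i * (y i * of_int j *
     (dact q (y i * vinner d (W t j r) \<mu>) * (y i * \<mu> k) + dact q (Z t j r i) * \<xi> i k))
     = G t i * (of_int j * dact q (y i * vinner d (W t j r) \<mu>) * \<mu> k) +
       G t i * (y i * of_int j * dact q (Z t j r i) * \<xi> i k)"
      by (auto simp: algebra_simps)
  qed simp
  then show ?case
    unfolding W_Suc[OF j r k] A B Suc.IH by (simp add: distrib_left)
qed

lemma vinner_decomposition:
  assumes j: "j \<in> {-1, 1}" and r: "r < m"
  shows "vinner d (W t j r) v = vinner d (init_weights \<omega> j r) v
     + of_int j * (A t j r - A 0 j r) / (vnorm d \<mu>)\<^sup>2 * vinner d \<mu> v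
     + (\<Sum>i<n. R t j r i / (vnorm d (\<xi> i))\<^sup>2 * vinner d (\<xi> i) v)"
proof -
  have "vinner d (W t j r) v = (\<Sum>k<d. init_weights \<omega> j r k * v k
     + of_int j * (A t j r - A 0 j r) / (vnorm d \<mu>)\<^sup>2 * (\<mu> k * v k)
     + (\<Sum>i<n. R t j r i / (vnorm d (\<xi> i))\<^sup>2 * (\<xi> i k * v k)))"
    unfolding vinner_def[of d "W t j r"]
  proof (rule sum.cong)
    fix k assume "k \<in> {..<d}"
    then have k: "k < d" by simp
    show "W t j r k * v k = init_weights \<omega> j r k * v k
     + of_int j * (A t j r - A 0 j r) / (vnorm d \<mu>)\<^sup>2 * (\<mu> k * v k)
     + (\<Sum>i<n. R t j r i / (vnorm d (\<xi> i))\<^sup>2 * (\<xi> i k * v k))"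
      unfolding W_decomposition[OF j r k] by (simp add: distrib_right sum_distrib_right mult.assoc)
  qed simp
  also have "\<dots> = vinner d (init_weights \<omega> j r) v
     + of_int j * (A t j r - A 0 j r) / (vnorm d \<mu>)\<^sup>2 * vinner d \<mu> v
     + (\<Sum>k<d. \<Sum>i<n. R t j r i / (vnorm d (\<xi> i))\<^sup>2 * (\<xi> i k * v k))"
    by (simp add: sum.distrib vinner_def sum_distrib_left)
  also have "(\<Sum>k<d. \<Sum>i<n. R t j r i / (vnorm d (\<xi> i))\<^sup>2 * (\<xi> i k * v k)) =
     (\<Sum>i<n. R t j r i / (vnorm d (\<xi> i))\<^sup>2 * vinner d (\<xi> i) v)"
    by (subst sum.swap) (simp add: vinner_def sum_distrib_left)
  finally show ?thesis .
qed

text \<open>Pairing a noise combination with one noise vector returns its own coefficient up to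
  off-diagonal terms, which \<open>cross\<close> limits to half the coefficient bound. The estimate
  serves three times: for \<open>Z_bound\<close>, for uniqueness of the coefficients, and for the
  norm in \<open>proj_W_sq_le\<close>.\<close>

lemma weighted_noise_sum_bound:
  assumes c: "\<And>i. i < n \<Longrightarrow> \<bar>c i\<bar> \<le> b" and l: "l < n" and b: "b \<ge> 0"
  shows "\<bar>(\<Sum>i<n. c i / (vnorm d (\<xi> i))\<^sup>2 * vinner d (\<xi> i) (\<xi> l)) - c l\<bar> \<le> b / 2"
proof -
  have "(\<Sum>i<n. c i / (vnorm d (\<xi> i))\<^sup>2 * vinner d (\<xi> i) (\<xi> l))
     = c l / (vnorm d (\<xi> l))\<^sup>2 * vinner d (\<xi> l) (\<xi> l)
      + (\<Sum>i\<in>{..<n}-{l}. c i / (vnorm d (\<xi> i))\<^sup>2 * vinner d (\<xi> i) (\<xi> l))"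
    using l by (subst sum.remove[of _ l]) auto
  also have "c l / (vnorm d (\<xi> l))\<^sup>2 * vinner d (\<xi> l) (\<xi> l) = c l"
    using noise_pos[OF l] by (simp flip: vnorm_sq)
  finally have "\<bar>(\<Sum>i<n. c i / (vnorm d (\<xi> i))\<^sup>2 * vinner d (\<xi> i) (\<xi> l)) - c l\<bar>
     = \<bar>\<Sum>i\<in>{..<n}-{l}. c i / (vnorm d (\<xi> i))\<^sup>2 * vinner d (\<xi> i) (\<xi> l)\<bar>" by simp
  also have "\<dots> \<le> (\<Sum>i\<in>{..<n}-{l}. b * (\<bar>vinner d (\<xi> i) (\<xi> l)\<bar> / (vnorm d (\<xi> i))\<^sup>2))"
  proof (rule order_trans[OF sum_abs sum_mono])
    fix i assume "i \<in> {..<n} - {l}"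
    then have "\<bar>c i\<bar> \<le> b" using c by simp
    then have "\<bar>c i\<bar> * (\<bar>vinner d (\<xi> i) (\<xi> l)\<bar> / (vnorm d (\<xi> i))\<^sup>2)
        \<le> b * (\<bar>vinner d (\<xi> i) (\<xi> l)\<bar> / (vnorm d (\<xi> i))\<^sup>2)"
      by (intro mult_right_mono) auto
    then show "\<bar>c i / (vnorm d (\<xi> i))\<^sup>2 * vinner d (\<xi> i) (\<xi> l)\<bar>
        \<le> b * (\<bar>vinner d (\<xi> i) (\<xi> l)\<bar> / (vnorm d (\<xi> i))\<^sup>2)"
      by (simp add: abs_mult)
  qed
  also have "\<dots> \<le> b * (1/2)"
    unfolding sum_distrib_left[symmetric] by (rule mult_left_mono[OF cross[OF l] b])
  finally show ?thesis by simp
qed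

text \<open>The bootstrap invariant: noise coefficients stay within the scale \<beta> of the initial
  inner products.\<close>

definition "ok t \<longleftrightarrow> (\<forall>j\<in>{-1,1}. \<forall>r<m. \<forall>i<n. \<bar>R t j r i\<bar> \<le> \<beta>)"

lemma Z_bound:
  assumes "ok t" and j: "j \<in> {-1, 1}" and r: "r < m" and i: "i < n"
  shows "\<bar>Z t j r i\<bar> \<le> 3 * \<beta>"
proof -
  have R: "\<bar>R t j r l\<bar> \<le> \<beta>" if "l < n" for l using assms that unfolding ok_def by blast
  have \<mu>\<xi>: "vinner d \<mu> (\<xi> i) = 0" using orth[OF i] by (simp add: vinner_commute)
  \<comment> \<open>Initial inner product, own coefficient and cross terms contribute at most
    \<beta>, \<beta> and \<beta>/2.\<close>
  have "Z t j r i = vinner d (init_weights \<omega> j r) (\<xi> i) + R t j r i +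
     ((\<Sum>l<n. R t j r l / (vnorm d (\<xi> l))\<^sup>2 * vinner d (\<xi> l) (\<xi> i)) - R t j r i)"
    unfolding Z_def vinner_decomposition[OF j r] \<mu>\<xi> by simp
  then show ?thesis
    using init_noise[OF j r i] R[OF i] weighted_noise_sum_bound[of "R t j r" \<beta> i, OF R i \<beta>_nonneg]
      \<beta>_nonneg by linarith
qed

section \<open>Margins and class averages of the loss derivative\<close>

lemma mean_act_le_one:
  assumes "\<And>r. r < m \<Longrightarrow> f r \<le> 1"
  shows "(1 / real m) * (\<Sum>r<m. act q (f r)) \<in> {0..1}"
proof -
  have "(\<Sum>r<m. act q (f r)) \<le> (\<Sum>r<m. 1)"
    using assms q by (intro sum_mono act_le_one) auto
  moreover have "(\<Sum>r<m. act q (f r)) \<ge> 0" by (intro sum_nonneg act_nonneg)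
  ultimately show ?thesis using m by (simp add: field_simps)
qed

text \<open>The margin is the own-class signal average plus the own-class noise average minus the
  two averages of the opposite class. All but the first lie in [0,1]: the noise ones by
  \<open>Zm\<close>, the opposite signal by \<open>Am\<close>. One such term with a plus sign and
  two with a minus sign give the asymmetric range from -2 to +1.\<close>

lemma margin_general:
  assumes j: "j \<in> {-1, 1}" and yi: "label \<omega>' i = of_int j"
    and Zm: "\<And>j r. j \<in> {-1, 1} \<Longrightarrow> r < m \<Longrightarrow> vinner d (V j r) (noise d \<mu> \<sigma>\<^sub>p \<omega>' i) \<le> 1"
    and Am: "\<And>r. r < m \<Longrightarrow> of_int (-j) * vinner d (V (-j) r) \<mu> \<ge> - 1"
  shows "marg d m q \<mu> \<sigma>\<^sub>p \<omega>' V i \<ge> (1 / real m) * (\<Sum>r<m. act q (of_int j * vinner d (V j r) \<mu>)) - 2"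
    and "marg d m q \<mu> \<sigma>\<^sub>p \<omega>' V i \<le> (1 / real m) * (\<Sum>r<m. act q (of_int j * vinner d (V j r) \<mu>)) + 1"
proof -
  have mj: "- j \<in> {-1, 1}" using j by auto
  have eq: "marg d m q \<mu> \<sigma>\<^sub>p \<omega>' V i = Fnet d m q V j (patches d \<mu> \<sigma>\<^sub>p \<omega>' i) - Fnet d m q V (-j) (patches d \<mu> \<sigma>\<^sub>p \<omega>' i)"
    unfolding marg_def fnet_def yi using j by auto
  have Z1: "(1 / real m) * (\<Sum>r<m. act q (vinner d (V j' r) (noise d \<mu> \<sigma>\<^sub>p \<omega>' i))) \<in> {0..1}"
    if "j' \<in> {-1, 1}" for j' using that by (intro mean_act_le_one Zm)
  have A1: "(1 / real m) * (\<Sum>r<m. act q (of_int j * vinner d (V (-j) r) \<mu>)) \<in> {0..1}"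
    using Am by (intro mean_act_le_one) fastforce
  show "marg d m q \<mu> \<sigma>\<^sub>p \<omega>' V i \<ge> (1 / real m) * (\<Sum>r<m. act q (of_int j * vinner d (V j r) \<mu>)) - 2"
    "marg d m q \<mu> \<sigma>\<^sub>p \<omega>' V i \<le> (1 / real m) * (\<Sum>r<m. act q (of_int j * vinner d (V j r) \<mu>)) + 1"
    using Z1[OF j] Z1[OF mj] A1 unfolding eq Fnet_patches sum.distrib distrib_left yi by auto
qed

lemma margin:
  assumes ok: "ok t" and j: "j \<in> {-1, 1}" and i: "i < n" and yi: "y i = of_int j"
  shows "marg d m q \<mu> \<sigma>\<^sub>p \<omega> (W t) i \<ge> S t j - 2" "marg d m q \<mu> \<sigma>\<^sub>p \<omega> (W t) i \<le> S t j + 1"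
proof -
  have Z: "vinner d (W t j r) (\<xi> i) \<le> 1" if "j \<in> {-1, 1}" "r < m" for j r
    using Z_bound[OF ok that i] \<beta> by (simp add: Z_def)
  have "- j \<in> {-1, 1}" using j by auto
  then have A: "of_int (-j) * vinner d (W t (-j) r) \<mu> \<ge> -1" if "r < m" for r
    using A_ge[of "-j" r t] that by (simp add: A_def)
  show "marg d m q \<mu> \<sigma>\<^sub>p \<omega> (W t) i \<ge> S t j - 2" "marg d m q \<mu> \<sigma>\<^sub>p \<omega> (W t) i \<le> S t j + 1"
    using margin_general[where V = "W t", OF j yi Z A] by (simp_all add: S_def A_def)
qed

lemma S_nonneg: "S t j \<ge> 0"
  unfolding S_def by (intro mult_nonneg_nonneg sum_nonneg act_nonneg) simp

lemma P_le:
  assumes ok: "ok t" and j: "j \<in> {-1, 1}"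
  shows "P t j \<le> exp (2 - S t j)"
proof -
  have "(\<Sum>i | i < n \<and> y i = of_int j. G t i) \<le> (\<Sum>i | i < n \<and> y i = of_int j. exp (2 - S t j))"
  proof (rule sum_mono)
    fix i assume "i \<in> {i. i < n \<and> y i = of_int j}"
    then have "marg d m q \<mu> \<sigma>\<^sub>p \<omega> (W t) i \<ge> S t j - 2" using margin[OF ok j] by simp
    then show "G t i \<le> exp (2 - S t j)"
      unfolding G_def by (intro order_trans[OF lgrad_le]) simp
  qed
  also have "\<dots> = real (card {i. i < n \<and> y i = of_int j}) * exp (2 - S t j)" by simp
  also have "\<dots> \<le> real n * exp (2 - S t j)"
    using card_mono[of "{..<n}" "{i. i < n \<and> y i = of_int j}"] by (intro mult_right_mono) auto
  finally show ?thesis using n by (simp add: P_def field_simps)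
qed

lemma P_ge:
  assumes "\<And>i. i < n \<Longrightarrow> y i = of_int j \<Longrightarrow> G t i \<ge> g" and j: "j \<in> {-1, 1}" and g: "g \<ge> 0"
  shows "P t j \<ge> g / 8"
proof -
  have "real n / 8 * g \<le> real (card {i. i < n \<and> y i = of_int j}) * g"
    using cnt[OF j] g by (intro mult_right_mono)
  also have "\<dots> = (\<Sum>i | i < n \<and> y i = of_int j. g)" by simp
  also have "\<dots> \<le> (\<Sum>i | i < n \<and> y i = of_int j. G t i)" using assms by (intro sum_mono) auto
  finally show ?thesis using n by (simp add: P_def field_simps)
qed

text \<open>Within a class the margins spread by at most 3, which costs e^3, and a class holds at
  least n/8 of the samples, which costs 8. Every single loss derivative is thus controlled by the
  average that drives the signal recursion.\<close>

lemma G_le_P: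
  assumes ok: "ok t" and j: "j \<in> {-1, 1}" and i: "i < n" and yi: "y i = of_int j"
  shows "G t i \<le> 8 * exp 3 * P t j"
proof -
  have "P t j \<ge> (G t i / exp 3) / 8"
  proof (rule P_ge[OF _ j])
    fix l assume l: "l < n" "y l = of_int j"
    have "G t i \<le> exp 3 * G t l"
      unfolding G_def using margin[OF ok j i yi] margin[OF ok j l] by (intro lgrad_compare) auto
    then show "G t l \<ge> G t i / exp 3" by (simp add: field_simps)
  qed (use G_pos in \<open>simp add: less_imp_le\<close>)
  then show ?thesis by (simp add: field_simps)
qed

lemma P_ge_S:
  assumes ok: "ok t" and j: "j \<in> {-1, 1}" and s: "S t j \<le> s"
  shows "P t j \<ge> exp (- (s + 1)) / 16"
proof -
  have s0: "s + 1 \<ge> 0" using s S_nonneg[of t j] by simp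
  have "P t j \<ge> (exp (- (s + 1)) / 2) / 8"
  proof (rule P_ge[OF _ j])
    fix l assume l: "l < n" "y l = of_int j"
    then have "marg d m q \<mu> \<sigma>\<^sub>p \<omega> (W t) l \<le> s + 1" using margin[OF ok j l] s by simp
    then show "G t l \<ge> exp (- (s + 1)) / 2"
      unfolding G_def using lgrad_ge s0 by blast
  qed simp
  then show ?thesis by simp
qed

text \<open>The doubling condition of \<open>tracking_bound\<close>, uniformly in the size of the
  component: a large component forces a large \<open>S\<close>, and the resulting decay of
  \<open>P\<close> outweighs the power of \<open>A\<close>. The width m cancels against the one in
  \<open>a\<close>, which leaves the left side of \<open>step_size\<close>.\<close>

lemma small_step:
  assumes ok: "ok t" and j: "j \<in> {-1, 1}" and r: "r < m" and pos: "A t j r > 0"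
  shows "a * P t j * A t j r powr (q - 2) \<le> 1"
proof -
  let ?x = "A t j r"
  have "act q ?x \<le> (\<Sum>r<m. act q (A t j r))"
    using r by (intro member_le_sum) (auto simp: act_nonneg)
  then have S: "?x powr q \<le> real m * S t j"
    using m pos by (simp add: S_def act_def)
  have "?x powr (q - 2) \<le> 1 + ?x powr q"
  proof (cases "?x \<le> 1")
    case True
    then have "?x powr (q - 2) \<le> 1" using pos q by (simp add: powr_le1)
    then show ?thesis by (smt (verit) powr_ge_zero)
  next
    case False
    then have "?x powr (q - 2) \<le> ?x powr q" by (intro powr_mono) auto
    then show ?thesis by simp
  qed
  also have "\<dots> \<le> real m * (1 + S t j)" using S m by (simp add: algebra_simps)
  also have "\<dots> \<le> real m * exp (S t j)" by (intro mult_left_mono exp_ge_add_one_self) simp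
  finally have x: "?x powr (q - 2) \<le> real m * exp (S t j)" .
  have "a * P t j * ?x powr (q - 2) \<le> a * exp (2 - S t j) * (real m * exp (S t j))"
    using x P_le[OF ok j] a_pos P_nonneg[of t j] by (intro mult_mono mult_left_mono) auto
  also have "\<dots> = exp 2 * q * \<eta> * (vnorm d \<mu>)\<^sup>2"
    using m by (simp add: a_def exp_diff)
  finally show ?thesis using step_size by simp
qed

section \<open>Closing the bootstrap on the noise coefficients\<close>

lemma sum_P_bound:
  assumes ok: "\<And>t. t < T \<Longrightarrow> ok t" and j: "j \<in> {-1, 1}" and r: "r < m"
    and "\<tau> \<le> T" "A \<tau> j r \<ge> x" "x > 0"
  shows "(\<Sum>t=\<tau>..<T. a * P t j) \<le> track_const q * x powr (-(q - 2))"
  by (rule tracking_bound[OF q less_imp_le[OF a_pos] P_nonneg, where x = "\<lambda>t. A t j r"])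
     (use assms A_Suc_pos small_step in auto)

text \<open>The increment is charged to the class of the sample's label \<open>j'\<close> and not to
  the sign \<open>j\<close> of the filter, because the loss derivative of the sample is comparable
  to \<open>P t j'\<close>, whose sum over time is bounded.\<close>

lemma R_step:
  assumes ok: "ok t" and j: "j \<in> {-1, 1}" and r: "r < m" and i: "i < n" and yi: "y i = of_int j'"
    and j': "j' \<in> {-1, 1}"
  shows "\<bar>R (Suc t) j r i\<bar> \<le> \<bar>R t j r i\<bar> + \<eta> / (real n * real m) * (8 * exp 3) *
     (q * (3 * \<beta>) powr (q - 1)) * (4 * \<sigma>\<^sub>p\<^sup>2 * d) * P t j'"
proof -
  have "\<bar>y i * of_int j\<bar> = 1" using yi j j' by auto
  then have "\<bar>\<eta> / (real n * real m) * (G t i * (y i * of_int j * dact q (Z t j r i))) * (vnorm d (\<xi> i))\<^sup>2\<bar>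
     = \<eta> / (real n * real m) * (G t i * dact q (Z t j r i)) * (vnorm d (\<xi> i))\<^sup>2"
    using \<eta> G_pos[of t i] dact_nonneg[of q] q by (simp add: abs_mult)
  also have "\<dots> \<le> \<eta> / (real n * real m) * ((8 * exp 3 * P t j') * (q * (3 * \<beta>) powr (q - 1))) * (4 * \<sigma>\<^sub>p\<^sup>2 * d)"
  proof (intro mult_mono mult_left_mono)
    show "dact q (Z t j r i) \<le> q * (3 * \<beta>) powr (q - 1)"
      using Z_bound[OF ok j r i] \<beta>_nonneg q by (intro dact_le) auto
    show "G t i \<le> 8 * exp 3 * P t j'" by (rule G_le_P[OF ok j' i yi])
    show "(vnorm d (\<xi> i))\<^sup>2 \<le> 4 * \<sigma>\<^sub>p\<^sup>2 * d" by (rule noise_le[OF i])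
  qed (use \<eta> P_nonneg G_pos[of t i] dact_nonneg[of q] q in \<open>auto intro!: mult_nonneg_nonneg\<close>)
  finally have "\<bar>\<eta> / (real n * real m) * (G t i * (y i * of_int j * dact q (Z t j r i))) * (vnorm d (\<xi> i))\<^sup>2\<bar>
     \<le> \<eta> / (real n * real m) * (8 * exp 3) * (q * (3 * \<beta>) powr (q - 1)) * (4 * \<sigma>\<^sub>p\<^sup>2 * d) * P t j'"
    by (simp only: ac_simps)
  moreover have "R (Suc t) j r i = R t j r i
     + \<eta> / (real n * real m) * (G t i * (y i * of_int j * dact q (Z t j r i))) * (vnorm d (\<xi> i))\<^sup>2"
    using i by simp
  ultimately show ?thesis by linarith
qed

text \<open>Validity at all earlier times bounds the past sum of \<open>P\<close> by a quantity free
  of T, so the accumulated drift of a coefficient cannot exceed \<beta> at time T either.\<close>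

lemma ok: "ok t"
proof (induction t rule: less_induct)
  case (less T)
  show ?case unfolding ok_def
  proof (intro ballI allI impI)
    fix j r i assume j: "j \<in> {-1, 1::int}" and r: "r < m" and i: "i < n"
    obtain j' :: int where j': "j' \<in> {-1, 1}" and yi: "y i = of_int j'"
      using lab[OF i] by (metis insert_iff of_int_1 of_int_minus singletonD)
    obtain r' where r': "r' < m" "A 0 j' r' \<ge> \<alpha>"
      using init_active[OF j'] by (auto simp: A_def W_0)
    define c where "c = \<eta> / (real n * real m) * (8 * exp 3) * (q * (3 * \<beta>) powr (q - 1)) * (4 * \<sigma>\<^sub>p\<^sup>2 * d)"
    have c0: "c \<ge> 0" using \<eta> q by (auto simp: c_def intro!: mult_nonneg_nonneg)
    have "s \<le> T \<Longrightarrow> \<bar>R s j r i\<bar> \<le> c * (\<Sum>t<s. P t j')" for s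
    proof (induction s)
      case (Suc s)
      have "\<bar>R (Suc s) j r i\<bar> \<le> \<bar>R s j r i\<bar> + c * P s j'"
        unfolding c_def using Suc.prems by (intro R_step[OF less.IH[of s] j r i yi j']) simp
      also have "\<dots> \<le> c * (\<Sum>t<s. P t j') + c * P s j'" using Suc by simp
      finally show ?case by (simp add: distrib_left)
    qed simp
    from this[of T] have "\<bar>R T j r i\<bar> \<le> c * (\<Sum>t<T. P t j')" by simp
    also have "\<dots> = c / a * (\<Sum>t=0..<T. a * P t j')"
      using a_pos by (simp add: sum_distrib_left[symmetric] atLeast0LessThan)
    also have "\<dots> \<le> c / a * (track_const q * \<alpha> powr (-(q - 2)))"
      using sum_P_bound[OF less.IH j' r'(1) _ r'(2) \<alpha>] c0 a_pos by (intro mult_left_mono) auto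
    \<comment> \<open>The step size, q and the width cancel in \<open>c / a\<close>; the remaining
      quotient is 1/(n SNR^2) up to constants and the power of 3 \<beta>.\<close>
    also have "\<dots> = 4 * \<sigma>\<^sub>p\<^sup>2 * d / (real n * (vnorm d \<mu>)\<^sup>2) * (3 * \<beta>) powr (q - 1)
             * (8 * exp 3) * (track_const q * \<alpha> powr (-(q - 2)))"
      using \<eta> q m by (simp add: c_def a_def)
    finally show "\<bar>R T j r i\<bar> \<le> \<beta>" using signal_dominates by simp
  qed
qed

section \<open>Speed of the signal growth\<close>

lemma S_after_warmup:
  assumes j: "j \<in> {-1, 1}" and T: "real T * a > 16 * exp 2 * (track_const q * \<alpha> powr (-(q - 2)))"
  shows "S T j > 1"
proof (rule ccontr)
  assume "\<not> S T j > 1"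
  \<comment> \<open>By monotonicity, failure at time T means a small \<open>S\<close> all along,
    hence \<open>P\<close> at least exp(-2)/16 at every step; so many steps would exceed the bound
    on the sum.\<close>
  then have S: "S t j \<le> 1" if "t \<le> T" for t using S_mono[OF j that] by simp
  obtain r where r: "r < m" "A 0 j r \<ge> \<alpha>"
    using init_active[OF j] by (auto simp: A_def W_0)
  have "real T * (a * (exp (- 2) / 16)) = (\<Sum>t=0..<T. a * (exp (- 2) / 16))" by simp
  also have "\<dots> \<le> (\<Sum>t=0..<T. a * P t j)"
    using P_ge_S[OF ok j S] a_pos by (intro sum_mono mult_left_mono) auto
  also have "\<dots> \<le> track_const q * \<alpha> powr (-(q - 2))"
    by (rule sum_P_bound[OF ok j r(1) _ r(2) \<alpha>]) simp
  finally show False using T by (simp add: exp_minus field_simps)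
qed

lemma S_large_imp_active:
  assumes "S t j > 1"
  shows "\<exists>r<m. A t j r > 1"
proof (rule ccontr)
  assume "\<not> ?thesis"
  then have "A t j r \<le> 1" if "r < m" for r using that by (meson linorder_not_less)
  from mean_act_le_one[of "A t j", OF this] assms show False by (simp add: S_def)
qed

lemma S_converged:
  assumes j: "j \<in> {-1, 1}" and T1: "real T1 * a > 16 * exp 2 * (track_const q * \<alpha> powr (-(q - 2)))"
    and e: "0 < e" "e \<le> 1" and T2: "real T2 * a * e > 16 * exp 3 * track_const q"
  shows "exp (2 - S (T1 + T2) j) \<le> e"
proof (rule ccontr)
  assume "\<not> ?thesis"
  then have "ln e < 2 - S (T1 + T2) j" using e by (metis exp_ln exp_less_cancel_iff linorder_not_le)
  then have S: "S t j \<le> 2 - ln e" if "t \<le> T1 + T2" for t using S_mono[OF j that] by simp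
  \<comment> \<open>The count restarts at \<open>T1\<close> from a component above 1 instead of
    \<alpha>, so the bound on the remaining sum does not depend on the initialisation scale.\<close>
  obtain r where r: "r < m" "A T1 j r > 1"
    using S_large_imp_active[OF S_after_warmup[OF j T1]] by auto
  have "exp (- ((2 - ln e) + 1)) = e * exp (-3)" using e by (simp add: exp_diff exp_add exp_minus divide_inverse)
  then have Pge: "P t j \<ge> e * exp (-3) / 16" if "t \<le> T1 + T2" for t
    using P_ge_S[OF ok j S[OF that]] by simp
  have "real T2 * (a * (e * exp (- 3) / 16)) = (\<Sum>t=T1..<T1+T2. a * (e * exp (- 3) / 16))" by simp
  also have "\<dots> \<le> (\<Sum>t=T1..<T1+T2. a * P t j)"
    using Pge a_pos by (intro sum_mono mult_left_mono) auto
  also have "\<dots> \<le> track_const q * 1 powr (-(q - 2))"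
    using r by (intro sum_P_bound[OF ok j r(1)]) auto
  finally show False using T2 by (simp add: exp_minus field_simps)
qed

text \<open>For uniqueness, pairing the difference of two decompositions with \<mu> isolates
  \<gamma>; pairing it with the noise vector of the largest coefficient difference b gives b \<le>
  b/2.\<close>

lemma sn_coeffs_eq:
  assumes j: "j \<in> {-1, 1}" and r: "r < m"
  shows "sn_coeffs d n \<mu> \<sigma>\<^sub>p \<omega> (W t) j r = (A t j r - A 0 j r, R t j r)"
proof -
  let ?Q = "\<lambda>\<gamma> \<rho>. (\<forall>i\<ge>n. \<rho> i = 0) \<and>
        (\<forall>k<d. W t j r k = init_weights \<omega> j r k
              + real_of_int j * \<gamma> / (vnorm d \<mu>)\<^sup>2 * \<mu> k
              + (\<Sum>i<n. \<rho> i / (vnorm d (\<xi> i))\<^sup>2 * \<xi> i k))"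
  have R0: "R t j r i = 0" if "i \<ge> n" for i using that by (induction t) auto
  have ex: "?Q (A t j r - A 0 j r) (R t j r)"
    using R0 W_decomposition[OF j r, of _ t] by auto
  have uniq: "\<gamma> = \<gamma>' \<and> \<rho> = \<rho>'" if 1: "?Q \<gamma> \<rho>" and 2: "?Q \<gamma>' \<rho>'" for \<gamma> \<gamma>' \<rho> \<rho>'
  proof -
    have eq0: "real_of_int j * (\<gamma> - \<gamma>') / (vnorm d \<mu>)\<^sup>2 * \<mu> k
              + (\<Sum>i<n. (\<rho> i - \<rho>' i) / (vnorm d (\<xi> i))\<^sup>2 * \<xi> i k) = 0" if k: "k < d" for k
      using 1 2 k by (auto simp: algebra_simps diff_divide_distrib sum_subtractf)
    have eqv: "real_of_int j * (\<gamma> - \<gamma>') / (vnorm d \<mu>)\<^sup>2 * vinner d \<mu> v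
              + (\<Sum>i<n. (\<rho> i - \<rho>' i) / (vnorm d (\<xi> i))\<^sup>2 * vinner d (\<xi> i) v) = 0" for v
    proof -
      have "(\<Sum>k<d. (real_of_int j * (\<gamma> - \<gamma>') / (vnorm d \<mu>)\<^sup>2 * \<mu> k
              + (\<Sum>i<n. (\<rho> i - \<rho>' i) / (vnorm d (\<xi> i))\<^sup>2 * \<xi> i k)) * v k) = 0"
        using eq0 by (intro sum.neutral) simp
      moreover have "(\<Sum>k<d. \<Sum>i<n. (\<rho> i - \<rho>' i) / (vnorm d (\<xi> i))\<^sup>2 * \<xi> i k * v k) =
         (\<Sum>i<n. (\<rho> i - \<rho>' i) / (vnorm d (\<xi> i))\<^sup>2 * vinner d (\<xi> i) v)"
        by (subst sum.swap) (simp add: vinner_def sum_distrib_left mult.assoc)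
      ultimately show ?thesis
        by (simp add: distrib_right sum.distrib sum_distrib_right vinner_def sum_distrib_left mult.assoc)
    qed
    have "(\<Sum>i<n. (\<rho> i - \<rho>' i) / (vnorm d (\<xi> i))\<^sup>2 * vinner d (\<xi> i) \<mu>) = 0"
      using orth by (intro sum.neutral) simp
    with eqv[of \<mu>] have "real_of_int j * (\<gamma> - \<gamma>') = 0"
      using \<mu> by (simp add: vnorm_sq[symmetric])
    then have g: "\<gamma> = \<gamma>'" using j by auto
    define b where "b = Max ((\<lambda>i. \<bar>\<rho> i - \<rho>' i\<bar>) ` {..<n})"
    have b: "\<bar>\<rho> i - \<rho>' i\<bar> \<le> b" if "i < n" for i
      unfolding b_def using that by (intro Max_ge) auto
    have "b \<in> (\<lambda>i. \<bar>\<rho> i - \<rho>' i\<bar>) ` {..<n}"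
      unfolding b_def using n by (intro Max_in) (auto simp: lessThan_empty_iff)
    then obtain l where l: "l < n" "b = \<bar>\<rho> l - \<rho>' l\<bar>" by auto
    have "\<bar>(\<Sum>i<n. (\<rho> i - \<rho>' i) / (vnorm d (\<xi> i))\<^sup>2 * vinner d (\<xi> i) (\<xi> l)) - (\<rho> l - \<rho>' l)\<bar> \<le> b / 2"
      using weighted_noise_sum_bound[of "\<lambda>i. \<rho> i - \<rho>' i" b l] b l by simp
    with eqv[of "\<xi> l"] g l have "b \<le> b / 2" by (simp add: abs_minus_commute)
    with b have "\<bar>\<rho> i - \<rho>' i\<bar> \<le> 0" if "i < n" for i using that by fastforce
    then have "\<rho> i = \<rho>' i" for i using 1 2 by (cases "i < n") auto
    then show ?thesis using g by auto
  qed
  show ?thesis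
    unfolding sn_coeffs_def
  proof (rule the_equality)
    show "case (A t j r - A 0 j r, R t j r) of (\<gamma>, \<rho>) \<Rightarrow> ?Q \<gamma> \<rho>" using ex by simp
    fix x assume "case x of (\<gamma>, \<rho>) \<Rightarrow> ?Q \<gamma> \<rho>"
    then obtain \<gamma> \<rho> where x: "x = (\<gamma>, \<rho>)" and Q: "?Q \<gamma> \<rho>" by (cases x) auto
    show "x = (A t j r - A 0 j r, R t j r)" unfolding x using uniq[OF Q ex] by simp
  qed
qed

theorem training_result:
  assumes T1: "real T1 * a > 16 * exp 2 * (track_const q * \<alpha> powr (-(q - 2)))"
    and e: "0 < e" "e \<le> 1" and T2: "real T2 * a * e > 16 * exp 3 * track_const q"
    and T: "T = T1 + T2"
  shows "\<And>j. j \<in> {-1, 1} \<Longrightarrow> Max ((\<lambda>r. gamma_coeff d n \<mu> \<sigma>\<^sub>p \<omega> (W T) j r) ` {..<m}) \<ge> 1 / 2"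
    and "\<And>j r i. j \<in> {-1, 1} \<Longrightarrow> r < m \<Longrightarrow> i < n \<Longrightarrow> \<bar>rho_coeff d n \<mu> \<sigma>\<^sub>p \<omega> (W T) j r i\<bar> \<le> \<beta>"
    and "train_loss d m q n \<mu> \<sigma>\<^sub>p \<omega> (W T) \<le> e"
proof -
  fix j :: int assume j: "j \<in> {-1, 1}"
  obtain r where r: "r < m" "A T1 j r > 1"
    using S_large_imp_active[OF S_after_warmup[OF j T1]] by auto
  \<comment> \<open>The signal component ends above 1 and starts at most at 1/2, which is the origin
    of the bound 1/2 on \<gamma>.\<close>
  have "A T j r > 1" using A_mono[OF j r(1), of T1 T] r T by simp
  then have "gamma_coeff d n \<mu> \<sigma>\<^sub>p \<omega> (W T) j r \<ge> 1/2"
    unfolding gamma_coeff_def sn_coeffs_eq[OF j r(1)] using A_0[OF j r(1)] by simp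
  also have "gamma_coeff d n \<mu> \<sigma>\<^sub>p \<omega> (W T) j r \<le> Max ((\<lambda>r. gamma_coeff d n \<mu> \<sigma>\<^sub>p \<omega> (W T) j r) ` {..<m})"
    using r by (intro Max_ge) auto
  finally show "Max ((\<lambda>r. gamma_coeff d n \<mu> \<sigma>\<^sub>p \<omega> (W T) j r) ` {..<m}) \<ge> 1 / 2" .
next
  fix j :: int and r i assume "j \<in> {-1, 1}" "r < m" "i < n"
  then show "\<bar>rho_coeff d n \<mu> \<sigma>\<^sub>p \<omega> (W T) j r i\<bar> \<le> \<beta>"
    using ok[of T, unfolded ok_def] by (auto simp: rho_coeff_def sn_coeffs_eq)
next
  have "(\<Sum>i<n. logloss (y i * fnet d m q (W T) (patches d \<mu> \<sigma>\<^sub>p \<omega> i))) \<le> (\<Sum>i<n. e)"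
  proof (rule sum_mono)
    fix i assume "i \<in> {..<n}"
    then have i: "i < n" by simp
    obtain j :: int where j: "j \<in> {-1, 1}" and yi: "y i = of_int j"
      using lab[OF i] by (metis insert_iff of_int_1 of_int_minus singletonD)
    have "logloss (marg d m q \<mu> \<sigma>\<^sub>p \<omega> (W T) i) \<le> exp (- (marg d m q \<mu> \<sigma>\<^sub>p \<omega> (W T) i))" by (rule logloss_le)
    also have "\<dots> \<le> exp (2 - S T j)" using margin[OF ok j i yi, of T] by simp
    also have "\<dots> \<le> e" using S_converged[OF j T1 e T2] T by simp
    finally show "logloss (y i * fnet d m q (W T) (patches d \<mu> \<sigma>\<^sub>p \<omega> i)) \<le> e" by (simp add: marg_def)
  qed
  then show "train_loss d m q n \<mu> \<sigma>\<^sub>p \<omega> (W T) \<le> e"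
    using n by (simp add: train_loss_def field_simps)
qed

text \<open>Up to the factor \<open>\<sigma>\<^sub>p\<^sup>2\<close> this is the variance of the
  inner product with fresh noise, which has no component along \<mu>. The trained part
  \<open>u\<close> lies in the span of the training noise; expanding its square norm once more gives
  inner products with the \<xi>_l, each at most 3\<beta>/2.\<close>

lemma proj_W_sq_le:
  assumes j: "j \<in> {-1, 1}" and r: "r < m"
    and \<nu>: "\<nu> > 0" "\<And>i. i < n \<Longrightarrow> (vnorm d (\<xi> i))\<^sup>2 \<ge> \<nu>"
  shows "vinner d (proj d \<mu> (W t j r)) (proj d \<mu> (W t j r))
     \<le> 2 * (vnorm d (init_weights \<omega> j r))\<^sup>2 + 3 * real n * \<beta>\<^sup>2 / \<nu>"
proof -
  let ?w = "init_weights \<omega> j r"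
  define u where "u k = (\<Sum>i<n. R t j r i / (vnorm d (\<xi> i))\<^sup>2 * \<xi> i k)" for k
  have j2: "real_of_int j * real_of_int j = 1" using j by auto
  have Rb: "\<bar>R t j r i\<bar> \<le> \<beta>" if "i < n" for i
    using ok[of t, unfolded ok_def] j r that by auto
  have "(\<Sum>i<n. R t j r i / (vnorm d (\<xi> i))\<^sup>2 * vinner d (\<xi> i) \<mu>) = 0"
    using orth by (intro sum.neutral) simp
  then have W\<mu>: "vinner d (W t j r) \<mu> = vinner d ?w \<mu> + of_int j * (A t j r - A 0 j r)"
    using vinner_decomposition[OF j r, of t \<mu>] \<mu> by (simp add: vnorm_sq[symmetric])
  have p: "proj d \<mu> (W t j r) k = proj d \<mu> ?w k + u k" if "k < d" for k
    unfolding proj_def W\<mu> W_decomposition[OF j r that] u_def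
    by (simp add: algebra_simps add_divide_distrib diff_divide_distrib)
  have uu: "vinner d u u \<le> real n * (\<beta> / \<nu> * (3/2 * \<beta>))"
  proof -
    have "vinner d u u = (\<Sum>k<d. (\<Sum>l<n. R t j r l / (vnorm d (\<xi> l))\<^sup>2 * \<xi> l k) * u k)"
      by (simp add: vinner_def u_def)
    also have "\<dots> = (\<Sum>l<n. R t j r l / (vnorm d (\<xi> l))\<^sup>2 * vinner d u (\<xi> l))"
      unfolding sum_distrib_right
      by (subst sum.swap) (simp add: vinner_def sum_distrib_left sum_divide_distrib ac_simps)
    also have "\<dots> \<le> (\<Sum>l<n. \<beta> / \<nu> * (3/2 * \<beta>))"
    proof (rule sum_mono)
      fix l assume "l \<in> {..<n}"
      then have l: "l < n" by simp
      have "vinner d u (\<xi> l) = (\<Sum>i<n. R t j r i / (vnorm d (\<xi> i))\<^sup>2 * vinner d (\<xi> i) (\<xi> l))"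
        unfolding vinner_def u_def sum_distrib_right
        by (subst sum.swap) (simp add: sum_distrib_left mult.assoc)
      then have 1: "\<bar>vinner d u (\<xi> l)\<bar> \<le> 3/2 * \<beta>"
        using weighted_noise_sum_bound[of "R t j r" \<beta> l, OF Rb l \<beta>_nonneg] Rb[OF l] by linarith
      have "\<bar>R t j r l / (vnorm d (\<xi> l))\<^sup>2\<bar> \<le> \<beta> / \<nu>"
        unfolding abs_divide using Rb[OF l] \<nu>(1) \<nu>(2)[OF l] \<beta>_nonneg by (intro frac_le) auto
      with 1 have "\<bar>R t j r l / (vnorm d (\<xi> l))\<^sup>2\<bar> * \<bar>vinner d u (\<xi> l)\<bar> \<le> \<beta> / \<nu> * (3/2 * \<beta>)"
        using \<nu>(1) \<beta>_nonneg by (intro mult_mono) auto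
      then show "R t j r l / (vnorm d (\<xi> l))\<^sup>2 * vinner d u (\<xi> l) \<le> \<beta> / \<nu> * (3/2 * \<beta>)"
        unfolding abs_mult[symmetric] by (rule order_trans[OF abs_ge_self])
    qed
    finally show ?thesis by simp
  qed
  have "vinner d (proj d \<mu> (W t j r)) (proj d \<mu> (W t j r)) =
     (\<Sum>k<d. (proj d \<mu> ?w k + u k) * (proj d \<mu> ?w k + u k))"
    unfolding vinner_def[of d "proj d \<mu> (W t j r)"] by (rule sum.cong) (simp_all add: p)
  also have "\<dots> \<le> (\<Sum>k<d. 2 * (proj d \<mu> ?w k * proj d \<mu> ?w k) + 2 * (u k * u k))"
  proof (rule sum_mono)
    fix k
    have "0 \<le> (proj d \<mu> ?w k - u k) * (proj d \<mu> ?w k - u k)" by simp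
    then show "(proj d \<mu> ?w k + u k) * (proj d \<mu> ?w k + u k)
       \<le> 2 * (proj d \<mu> ?w k * proj d \<mu> ?w k) + 2 * (u k * u k)"
      by (simp add: algebra_simps)
  qed
  also have "\<dots> = 2 * vinner d (proj d \<mu> ?w) (proj d \<mu> ?w) + 2 * vinner d u u"
    by (simp add: sum.distrib sum_distrib_left vinner_def)
  also have "\<dots> \<le> 2 * (vnorm d ?w)\<^sup>2 + 2 * (real n * (\<beta> / \<nu> * (3/2 * \<beta>)))"
    using uu vinner_proj_proj_le[OF \<mu>, of ?w] by (intro add_mono mult_left_mono) simp_all
  also have "2 * (real n * (\<beta> / \<nu> * (3/2 * \<beta>))) = 3 * real n * \<beta>\<^sup>2 / \<nu>"
    by (simp add: power2_eq_square)
  finally show ?thesis .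
qed

text \<open>Fresh noise need not be small, so \<open>margin_general\<close> does not apply.
  Own-class noise can only help; opposite-class noise beyond 1 is bounded by an exponential and
  enters through \<open>logloss_shift\<close>. Summing over both signs removes the dependence on the
  fresh label.\<close>

lemma test_logloss_le:
  assumes T1: "real T1 * a > 16 * exp 2 * (track_const q * \<alpha> powr (-(q - 2)))"
    and e: "0 < e" "e \<le> 1" and T2: "real T2 * a * e > 16 * exp 3 * track_const q"
    and T: "T = T1 + T2" and lab': "label \<omega>' i \<in> {-1, 1}" and L: "L \<ge> q"
  shows "logloss (label \<omega>' i * fnet d m q (W T) (patches d \<mu> \<sigma>\<^sub>p \<omega>' i)) \<le> e +
    (1 / real m) * (\<Sum>j\<in>{-1,1}. \<Sum>r<m. exp (L * (vinner d (W T j r) (noise d \<mu> \<sigma>\<^sub>p \<omega>' i) - 1)))"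
proof -
  let ?Z = "\<lambda>j r. vinner d (W T j r) (noise d \<mu> \<sigma>\<^sub>p \<omega>' i)"
  let ?E = "\<lambda>j. (1 / real m) * (\<Sum>r<m. exp (L * (?Z j r - 1)))"
  obtain j :: int where j: "j \<in> {-1, 1}" and yi: "label \<omega>' i = of_int j"
    using lab' by (metis insert_iff of_int_1 of_int_minus singletonD)
  have mj: "- j \<in> {-1, 1}" using j by auto
  have A1: "(1 / real m) * (\<Sum>r<m. act q (of_int j * vinner d (W T (-j) r) \<mu>)) \<in> {0..1}"
    using A_ge[OF mj, of _ T] by (intro mean_act_le_one) (fastforce simp: A_def)
  have "(\<Sum>r<m. act q (?Z (-j) r)) \<le> (\<Sum>r<m. 1 + exp (L * (?Z (-j) r - 1)))"
    using q L by (intro sum_mono act_le_exp) auto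
  then have N: "(1 / real m) * (\<Sum>r<m. act q (?Z (-j) r)) \<le> 1 + ?E (-j)"
    using m by (simp add: sum.distrib field_simps)
  have P: "(1 / real m) * (\<Sum>r<m. act q (?Z j r)) \<ge> 0"
    by (intro mult_nonneg_nonneg sum_nonneg act_nonneg) simp
  have "marg d m q \<mu> \<sigma>\<^sub>p \<omega>' (W T) i = Fnet d m q (W T) j (patches d \<mu> \<sigma>\<^sub>p \<omega>' i)
      - Fnet d m q (W T) (-j) (patches d \<mu> \<sigma>\<^sub>p \<omega>' i)"
    unfolding marg_def fnet_def yi using j by auto
  then have "marg d m q \<mu> \<sigma>\<^sub>p \<omega>' (W T) i \<ge> (S T j - 2) - ?E (-j)"
    using A1 N P unfolding Fnet_patches sum.distrib distrib_left yi S_def A_def by auto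
  then have "logloss (marg d m q \<mu> \<sigma>\<^sub>p \<omega>' (W T) i) \<le> logloss (S T j - 2) + ?E (-j)"
    by (intro logloss_shift) (auto simp: sum_nonneg intro!: divide_nonneg_nonneg)
  also have "logloss (S T j - 2) \<le> e"
    using logloss_le[of "S T j - 2"] S_converged[OF j T1 e T2] T by simp
  also have "?E (-j) \<le> ?E (-1) + ?E 1"
  proof -
    have "?E j \<ge> 0" for j by (intro mult_nonneg_nonneg sum_nonneg) auto
    from this[of 1] this[of "-1"] show ?thesis using j by auto
  qed
  finally show ?thesis by (simp add: marg_def distrib_left)
qed

end

section \<open>Independent coordinates and Gaussian tails\<close>

text \<open>Asking for a large measurable event inside \<open>Q\<close> spares measurability of
  \<open>Q\<close> itself and matches the form in which the theorem states its event. The parameter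
  is the failure probability, so conjunctions add.\<close>

definition whp :: "'a measure \<Rightarrow> real \<Rightarrow> ('a \<Rightarrow> bool) \<Rightarrow> bool" where
  "whp M \<delta> Q \<longleftrightarrow> (\<exists>A\<in>sets M. measure M A \<ge> 1 - \<delta> \<and> (\<forall>\<omega>\<in>A. Q \<omega>))"

lemma whp_mono:
  assumes "whp M \<delta> Q" "\<delta> \<le> \<delta>'" "\<And>\<omega>. Q \<omega> \<Longrightarrow> Q' \<omega>"
  shows "whp M \<delta>' Q'"
proof -
  obtain A where "A \<in> sets M" "measure M A \<ge> 1 - \<delta>" "\<forall>\<omega>\<in>A. Q \<omega>"
    using assms(1) unfolding whp_def by blast
  with assms(2,3) show ?thesis unfolding whp_def by (intro bexI[of _ A]) auto
qed

context prob_space begin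

lemma whp_conj:
  assumes "whp M \<delta> Q" "whp M \<delta>' Q'"
  shows "whp M (\<delta> + \<delta>') (\<lambda>\<omega>. Q \<omega> \<and> Q' \<omega>)"
proof -
  obtain A B where A: "A \<in> sets M" "measure M A \<ge> 1 - \<delta>" "\<forall>\<omega>\<in>A. Q \<omega>"
    and B: "B \<in> sets M" "measure M B \<ge> 1 - \<delta>'" "\<forall>\<omega>\<in>B. Q' \<omega>"
    using assms unfolding whp_def by blast
  have "prob (A \<union> B) = prob A + prob (B - A)"
    using A B by (intro finite_measure_Union')
  moreover have "prob (B - A) = prob B - prob (A \<inter> B)"
    using finite_measure_Diff'[of B A] A B by (simp add: Int_commute)
  ultimately have "prob (A \<inter> B) \<ge> 1 - (\<delta> + \<delta>')"
    using A B prob_le_1[of "A \<union> B"] by linarith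
  then show ?thesis
    unfolding whp_def using A B by (intro bexI[of _ "A \<inter> B"]) auto
qed

lemma whp_ball:
  assumes "finite F" "\<And>a. a \<in> F \<Longrightarrow> whp M \<delta> (Q a)"
  shows "whp M (real (card F) * \<delta>) (\<lambda>\<omega>. \<forall>a\<in>F. Q a \<omega>)"
  using assms
proof (induction F rule: finite_induct)
  case empty
  show ?case unfolding whp_def by (rule bexI[of _ "space M"]) (auto simp: prob_space)
next
  case (insert a F)
  then have "whp M (\<delta> + real (card F) * \<delta>) (\<lambda>\<omega>. Q a \<omega> \<and> (\<forall>a\<in>F. Q a \<omega>))"
    by (intro whp_conj) auto
  then show ?case
    by (rule whp_mono) (use insert in \<open>auto simp: algebra_simps\<close>)
qed

lemma whp_Markov:
  fixes h :: "'a \<Rightarrow> ennreal"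
  assumes h[measurable]: "h \<in> borel_measurable M" and e: "(\<integral>\<^sup>+\<omega>. h \<omega> \<partial>M) \<le> ennreal \<delta>" and \<delta>: "\<delta> \<ge> 0"
  shows "whp M \<delta> (\<lambda>\<omega>. h \<omega> < 1)"
proof -
  let ?B = "{\<omega>\<in>space M. 1 \<le> h \<omega>}"
  have B: "?B \<in> sets M" by measurable
  have "emeasure M ({\<omega>\<in>space M. 1 \<le> 1 * h \<omega>}) \<le> 1 * (\<integral>\<^sup>+\<omega>. h \<omega> * indicator (space M) \<omega> \<partial>M)"
    by (rule nn_integral_Markov_inequality) auto
  also have "1 * (\<integral>\<^sup>+\<omega>. h \<omega> * indicator (space M) \<omega> \<partial>M) = (\<integral>\<^sup>+\<omega>. h \<omega> \<partial>M)"
    unfolding mult_1 by (rule nn_integral_cong) simp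
  finally have "emeasure M ?B \<le> ennreal \<delta>" using e by simp
  then have "prob ?B \<le> \<delta>" using \<delta> by (simp add: emeasure_eq_measure)
  then have "prob (space M - ?B) \<ge> 1 - \<delta>" using prob_compl[OF B] by simp
  then show ?thesis
    unfolding whp_def using B by (intro bexI[of _ "space M - ?B"]) (auto simp: not_le)
qed

end

section \<open>Exponential moments of one Gaussian\<close>

lemma nn_integral_exp_normal:
  assumes "\<sigma> > 0"
  shows "(\<integral>\<^sup>+x. ennreal (exp (c * x)) \<partial>density lborel (normal_density 0 \<sigma>)) = ennreal (exp (c\<^sup>2 * \<sigma>\<^sup>2 / 2))"
proof -
  interpret N: prob_space "density lborel (normal_density (c * \<sigma>\<^sup>2) \<sigma>)"
    by (rule prob_space_normal_density) (use assms in simp)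
  \<comment> \<open>Completing the square: the exponential tilt shifts the mean to
    \<open>c * \<sigma>\<^sup>2\<close>.\<close>
  have eq: "normal_density 0 \<sigma> x * exp (c * x) = exp (c\<^sup>2 * \<sigma>\<^sup>2 / 2) * normal_density (c * \<sigma>\<^sup>2) \<sigma> x" for x
  proof -
    have "- (x - 0)\<^sup>2 / (2 * \<sigma>\<^sup>2) + c * x = c\<^sup>2 * \<sigma>\<^sup>2 / 2 + - (x - c * \<sigma>\<^sup>2)\<^sup>2 / (2 * \<sigma>\<^sup>2)"
      using assms by (simp add: field_simps power2_eq_square)
    then have "exp (- (x - 0)\<^sup>2 / (2 * \<sigma>\<^sup>2)) * exp (c * x) = exp (c\<^sup>2 * \<sigma>\<^sup>2 / 2) * exp (- (x - c * \<sigma>\<^sup>2)\<^sup>2 / (2 * \<sigma>\<^sup>2))"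
      by (simp only: exp_add[symmetric])
    from arg_cong[OF this, of "\<lambda>z. 1 / sqrt (2 * pi * \<sigma>\<^sup>2) * z"] show ?thesis
      unfolding normal_density_def by (simp only: ac_simps)
  qed
  have "(\<integral>\<^sup>+x. ennreal (exp (c * x)) \<partial>density lborel (normal_density 0 \<sigma>))
      = (\<integral>\<^sup>+x. ennreal (normal_density 0 \<sigma> x * exp (c * x)) \<partial>lborel)"
    by (subst nn_integral_density) (auto simp: ennreal_mult)
  also have "\<dots> = ennreal (exp (c\<^sup>2 * \<sigma>\<^sup>2 / 2)) * (\<integral>\<^sup>+x. ennreal (normal_density (c * \<sigma>\<^sup>2) \<sigma> x) \<partial>lborel)"
    unfolding eq by (subst nn_integral_cmult[symmetric]) (auto simp: ennreal_mult)
  also have "(\<integral>\<^sup>+x. ennreal (normal_density (c * \<sigma>\<^sup>2) \<sigma> x) \<partial>lborel) = 1"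
    using N.emeasure_space_1 by (simp add: emeasure_density)
  finally show ?thesis by simp
qed

text \<open>The quadratic tilt rescales the standard deviation to \<sigma>/s with s^2 = 1 - 2 b
  \<sigma>^2. Negative b are allowed, and \<open>whp_square_ge\<close> takes one for the lower
  tail.\<close>

lemma nn_integral_exp_sq_normal:
  assumes "\<sigma> > 0" and b: "2 * b * \<sigma>\<^sup>2 < 1"
  shows "(\<integral>\<^sup>+x. ennreal (exp (b * x\<^sup>2)) \<partial>density lborel (normal_density 0 \<sigma>)) = ennreal (1 / sqrt (1 - 2 * b * \<sigma>\<^sup>2))"
proof -
  define s where "s = sqrt (1 - 2 * b * \<sigma>\<^sup>2)"
  have s: "s > 0" "s\<^sup>2 = 1 - 2 * b * \<sigma>\<^sup>2" using b by (auto simp: s_def)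
  interpret N: prob_space "density lborel (normal_density 0 (\<sigma> / s))"
    by (rule prob_space_normal_density) (use assms s in simp)
  have eq: "normal_density 0 \<sigma> x * exp (b * x\<^sup>2) = 1 / s * normal_density 0 (\<sigma> / s) x" for x
  proof -
    have "- (x - 0)\<^sup>2 / (2 * \<sigma>\<^sup>2) + b * x\<^sup>2 = - (1 - 2 * b * \<sigma>\<^sup>2) * x\<^sup>2 / (2 * \<sigma>\<^sup>2)"
      using assms by (simp add: field_simps)
    also have "\<dots> = - (x - 0)\<^sup>2 / (2 * (\<sigma> / s)\<^sup>2)"
      unfolding s(2)[symmetric] by (simp add: power_divide)
    finally have e: "exp (- (x - 0)\<^sup>2 / (2 * \<sigma>\<^sup>2)) * exp (b * x\<^sup>2) = exp (- (x - 0)\<^sup>2 / (2 * (\<sigma> / s)\<^sup>2))"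
      by (simp only: exp_add[symmetric])
    have "1 / s * (1 / sqrt (2 * pi * (\<sigma> / s)\<^sup>2)) = 1 / sqrt (2 * pi * \<sigma>\<^sup>2)"
      using s(1) assms(1) by (simp add: real_sqrt_mult power_divide real_sqrt_divide)
    with arg_cong[OF e, of "\<lambda>z. 1 / sqrt (2 * pi * \<sigma>\<^sup>2) * z"] show ?thesis
      unfolding normal_density_def by (simp only: mult.assoc[symmetric])
  qed
  have "(\<integral>\<^sup>+x. ennreal (exp (b * x\<^sup>2)) \<partial>density lborel (normal_density 0 \<sigma>))
      = (\<integral>\<^sup>+x. ennreal (normal_density 0 \<sigma> x * exp (b * x\<^sup>2)) \<partial>lborel)"
    by (subst nn_integral_density) (auto simp: ennreal_mult)
  also have "\<dots> = ennreal (1 / s) * (\<integral>\<^sup>+x. ennreal (normal_density 0 (\<sigma> / s) x) \<partial>lborel)"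
    unfolding eq using s by (subst nn_integral_cmult[symmetric])
      (simp_all only: ennreal_mult zero_le_divide_1_iff less_imp_le normal_density_nonneg, simp)
  also have "(\<integral>\<^sup>+x. ennreal (normal_density 0 (\<sigma> / s) x) \<partial>lborel) = 1"
    using N.emeasure_space_1 by (simp add: emeasure_density)
  finally show ?thesis by (simp add: s_def)
qed

section \<open>Independence in a finite product\<close>

locale finite_product_prob = product_prob_space M I for M :: "'i \<Rightarrow> 'a measure" and I :: "'i set" +
  assumes finite_I: "finite I"
begin

lemma nn_integral_prod_coords:
  assumes K: "finite K" and a: "inj_on a K" "a ` K \<subseteq> I"
    and f: "\<And>k. k \<in> K \<Longrightarrow> f k \<in> borel_measurable (M (a k))"
  shows "(\<integral>\<^sup>+\<omega>. (\<Prod>k\<in>K. f k (\<omega> (a k))) \<partial>PiM I M) = (\<Prod>k\<in>K. integral\<^sup>N (M (a k)) (f k))"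
proof -
  \<comment> \<open>Coordinates outside the chosen ones get the constant factor 1, which integrates
    to 1 over a probability measure.\<close>
  define g where "g i = (if i \<in> a ` K then f (the_inv_into K a i) else (\<lambda>_. 1 :: ennreal))" for i
  have ga: "g (a k) = f k" if "k \<in> K" for k
    using that a by (simp add: g_def the_inv_into_f_f)
  have gm: "g i \<in> borel_measurable (M i)" for i
  proof (cases "i \<in> a ` K")
    case True
    then obtain k where "k \<in> K" "i = a k" by auto
    then show ?thesis using ga f by simp
  qed (simp add: g_def)
  have prod: "(\<Prod>k\<in>K. F (a k)) = (\<Prod>i\<in>I. F i)" if "\<And>i. i \<notin> a ` K \<Longrightarrow> F i = (1::ennreal)" for F
  proof -
    have "(\<Prod>k\<in>K. F (a k)) = (\<Prod>i\<in>a ` K. F i)" using a by (simp add: prod.reindex)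
    also have "\<dots> = (\<Prod>i\<in>I. F i)"
      using a finite_I that by (intro prod.mono_neutral_left) auto
    finally show ?thesis .
  qed
  have "(\<integral>\<^sup>+\<omega>. (\<Prod>k\<in>K. f k (\<omega> (a k))) \<partial>PiM I M) = (\<integral>\<^sup>+\<omega>. (\<Prod>k\<in>K. g (a k) (\<omega> (a k))) \<partial>PiM I M)"
    by (intro nn_integral_cong prod.cong) (simp_all add: ga)
  also have "\<dots> = (\<integral>\<^sup>+\<omega>. (\<Prod>i\<in>I. g i (\<omega> i)) \<partial>PiM I M)"
    by (intro nn_integral_cong prod[of "\<lambda>i. g i (_ i)"]) (simp add: g_def)
  also have "\<dots> = (\<Prod>i\<in>I. integral\<^sup>N (M i) (g i))"
    by (rule product_nn_integral_prod[OF finite_I gm])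
  also have "\<dots> = (\<Prod>k\<in>K. integral\<^sup>N (M (a k)) (g (a k)))"
    by (rule prod[symmetric]) (simp add: g_def prob_space.emeasure_space_1[OF prob_space])
  also have "\<dots> = (\<Prod>k\<in>K. integral\<^sup>N (M (a k)) (f k))"
    by (intro prod.cong) (simp_all add: ga)
  finally show ?thesis .
qed

lemma nn_integral_mult_indep:
  fixes f g :: "('i \<Rightarrow> 'a) \<Rightarrow> ennreal"
  assumes J: "J \<subseteq> I" and f[measurable]: "f \<in> borel_measurable (PiM I M)" and g[measurable]: "g \<in> borel_measurable (PiM I M)"
    and fJ: "\<And>\<omega> \<omega>'. (\<And>i. i \<in> J \<Longrightarrow> \<omega> i = \<omega>' i) \<Longrightarrow> f \<omega> = f \<omega>'"
    and gJ: "\<And>\<omega> \<omega>'. (\<And>i. i \<in> I - J \<Longrightarrow> \<omega> i = \<omega>' i) \<Longrightarrow> g \<omega> = g \<omega>'"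
  shows "(\<integral>\<^sup>+\<omega>. f \<omega> * g \<omega> \<partial>PiM I M) = (\<integral>\<^sup>+\<omega>. f \<omega> \<partial>PiM I M) * (\<integral>\<^sup>+\<omega>. g \<omega> \<partial>PiM I M)"
proof -
  let ?I = "I - J" and ?m = "\<lambda>x y. merge (I - J) J (x, y)"
  have U: "?I \<union> J = I" "?I \<inter> J = {}" "finite ?I" "finite J"
    using J finite_I by (auto intro: finite_subset)
  interpret PI: prob_space "PiM ?I M" by (intro prob_space_PiM prob_space)
  interpret PJ: prob_space "PiM J M" by (intro prob_space_PiM prob_space)
  \<comment> \<open>Arbitrary filler points: \<open>f\<close> ignores the coordinates in
    \<open>I - J\<close> and \<open>g\<close> those in \<open>J\<close>, so fixing them there turns
    each into a function of a single block.\<close>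
  obtain x0 where x0: "x0 \<in> space (PiM ?I M)" using PI.not_empty by blast
  obtain y0 where y0: "y0 \<in> space (PiM J M)" using PJ.not_empty by blast
  have fold: "(\<integral>\<^sup>+\<omega>. h \<omega> \<partial>PiM I M) = (\<integral>\<^sup>+ x. (\<integral>\<^sup>+ y. h (?m x y) \<partial>(Pi\<^sub>M J M)) \<partial>(Pi\<^sub>M ?I M))"
    if "h \<in> borel_measurable (PiM I M)" for h
    using product_nn_integral_fold[OF U(2-4), of h] that unfolding U(1) by simp
  have m1: "(\<lambda>y. ?m x0 y) \<in> measurable (PiM J M) (PiM I M)"
    using measurable_compose[OF measurable_Pair1'[OF x0] measurable_merge[of ?I J M]] U(1) by simp
  have m2: "(\<lambda>x. ?m x y0) \<in> measurable (PiM ?I M) (PiM I M)"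
    using measurable_compose[OF measurable_Pair2'[OF y0] measurable_merge[of ?I J M]] U(1) by simp
  have F: "f (?m x y) = f (?m x0 y)" for x y
    by (rule fJ) (simp add: merge_def)
  have G: "g (?m x y) = g (?m x y0)" for x y
    by (rule gJ) (simp add: merge_def)
  note Fm = measurable_compose[OF m1 f] and Gm = measurable_compose[OF m2 g]
  have "(\<integral>\<^sup>+\<omega>. f \<omega> * g \<omega> \<partial>PiM I M) = (\<integral>\<^sup>+ x. (\<integral>\<^sup>+ y. f (?m x0 y) * g (?m x y0) \<partial>(Pi\<^sub>M J M)) \<partial>(Pi\<^sub>M ?I M))"
  proof -
    have "(\<lambda>\<omega>. f \<omega> * g \<omega>) \<in> borel_measurable (PiM I M)" by measurable
    from fold[OF this] have "(\<integral>\<^sup>+\<omega>. f \<omega> * g \<omega> \<partial>PiM I M)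
        = (\<integral>\<^sup>+ x. (\<integral>\<^sup>+ y. f (?m x y) * g (?m x y) \<partial>(Pi\<^sub>M J M)) \<partial>(Pi\<^sub>M ?I M))" .
    also have "\<dots> = (\<integral>\<^sup>+ x. (\<integral>\<^sup>+ y. f (?m x0 y) * g (?m x y0) \<partial>(Pi\<^sub>M J M)) \<partial>(Pi\<^sub>M ?I M))"
      by (rule nn_integral_cong, rule nn_integral_cong, rule arg_cong2[where f = "(*)"], rule F, rule G)
    finally show ?thesis .
  qed
  also have "\<dots> = (\<integral>\<^sup>+ x. (\<integral>\<^sup>+ y. f (?m x0 y) \<partial>(Pi\<^sub>M J M)) * g (?m x y0) \<partial>(Pi\<^sub>M ?I M))"
    by (rule nn_integral_cong, rule nn_integral_multc, rule Fm)
  also have "\<dots> = (\<integral>\<^sup>+ y. f (?m x0 y) \<partial>(Pi\<^sub>M J M)) * (\<integral>\<^sup>+ x. g (?m x y0) \<partial>(Pi\<^sub>M ?I M))"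
    by (rule nn_integral_cmult, rule Gm)
  also have "(\<integral>\<^sup>+ y. f (?m x0 y) \<partial>(Pi\<^sub>M J M)) = (\<integral>\<^sup>+\<omega>. f \<omega> \<partial>PiM I M)"
  proof -
    have "(\<integral>\<^sup>+\<omega>. f \<omega> \<partial>PiM I M) = (\<integral>\<^sup>+ x. (\<integral>\<^sup>+ y. f (?m x0 y) \<partial>(Pi\<^sub>M J M)) \<partial>(Pi\<^sub>M ?I M))"
      unfolding fold[OF f] by (rule nn_integral_cong, rule nn_integral_cong, rule F)
    then show ?thesis by (simp add: PI.emeasure_space_1)
  qed
  also have "(\<integral>\<^sup>+ x. g (?m x y0) \<partial>(Pi\<^sub>M ?I M)) = (\<integral>\<^sup>+\<omega>. g \<omega> \<partial>PiM I M)"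
  proof -
    have "(\<integral>\<^sup>+\<omega>. g \<omega> \<partial>PiM I M) = (\<integral>\<^sup>+ x. (\<integral>\<^sup>+ y. g (?m x y0) \<partial>(Pi\<^sub>M J M)) \<partial>(Pi\<^sub>M ?I M))"
      unfolding fold[OF g] by (rule nn_integral_cong, rule nn_integral_cong, rule G)
    then show ?thesis by (simp add: PJ.emeasure_space_1)
  qed
  finally show ?thesis .
qed

text \<open>\<open>R\<close> grows by induction inside the fixed set \<open>R0\<close>, on which
  disjointness and dependence are assumed; every step splits off one block by
  \<open>nn_integral_mult_indep\<close>.\<close>

lemma nn_integral_prod_blocks:
  fixes f :: "'b \<Rightarrow> ('i \<Rightarrow> 'a) \<Rightarrow> ennreal"
  assumes "finite R" and K: "\<And>r. r \<in> R0 \<Longrightarrow> K r \<subseteq> I" and disj: "disjoint_family_on K R0"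
    and f: "\<And>r. r \<in> R0 \<Longrightarrow> f r \<in> borel_measurable (PiM I M)"
    and dep: "\<forall>r\<in>R0. \<forall>\<omega> \<omega>'. (\<forall>i\<in>K r. \<omega> i = \<omega>' i) \<longrightarrow> f r \<omega> = f r \<omega>'"
    and R0: "R \<subseteq> R0"
  shows "(\<integral>\<^sup>+\<omega>. (\<Prod>r\<in>R. f r \<omega>) \<partial>PiM I M) = (\<Prod>r\<in>R. \<integral>\<^sup>+\<omega>. f r \<omega> \<partial>PiM I M)"
  using \<open>finite R\<close> R0
proof (induction R rule: finite_induct)
  case empty
  show ?case by (simp add: P.emeasure_space_1)
next
  case (insert r R)
  have dep1: "f r \<omega> = f r \<omega>'" if "\<And>i. i \<in> K r \<Longrightarrow> \<omega> i = \<omega>' i" for \<omega> \<omega>'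
  proof (rule dep[rule_format])
    show "r \<in> R0" using insert.prems by simp
  qed (rule that)
  have dep2: "(\<Prod>r\<in>R. f r \<omega>) = (\<Prod>r\<in>R. f r \<omega>')" if eq: "\<And>i. i \<in> I - K r \<Longrightarrow> \<omega> i = \<omega>' i" for \<omega> \<omega>'
  proof (rule prod.cong)
    fix r' assume r': "r' \<in> R"
    have rs: "r \<in> R0" "r' \<in> R0" "r \<noteq> r'" using insert.prems insert.hyps(2) r' by auto
    have "K r \<inter> K r' = {}" by (rule disjoint_family_onD[OF disj rs])
    moreover have "K r' \<subseteq> I" by (rule K[OF rs(2)])
    ultimately have "K r' \<subseteq> I - K r" by blast
    then have "\<omega> i = \<omega>' i" if "i \<in> K r'" for i using eq that by blast
    then have eqall: "\<forall>i\<in>K r'. \<omega> i = \<omega>' i" by (rule ballI)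
    from dep[THEN bspec, OF rs(2), THEN spec, THEN spec, THEN mp, OF eqall]
    show "f r' \<omega> = f r' \<omega>'" .
  qed simp
  have "(\<integral>\<^sup>+\<omega>. f r \<omega> * (\<Prod>r\<in>R. f r \<omega>) \<partial>PiM I M) = (\<integral>\<^sup>+\<omega>. f r \<omega> \<partial>PiM I M) * (\<integral>\<^sup>+\<omega>. (\<Prod>r\<in>R. f r \<omega>) \<partial>PiM I M)"
  proof (rule nn_integral_mult_indep[where J = "K r" and f = "f r" and g = "\<lambda>\<omega>. \<Prod>r\<in>R. f r \<omega>"])
    show "K r \<subseteq> I" "f r \<in> borel_measurable (PiM I M)" using insert.prems by (auto intro!: K f)
    show "(\<lambda>\<omega>. \<Prod>r\<in>R. f r \<omega>) \<in> borel_measurable (PiM I M)"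
    proof (rule borel_measurable_prod_ennreal)
      fix r' assume "r' \<in> R"
      then show "f r' \<in> borel_measurable (PiM I M)" using insert.prems by (intro f) auto
    qed
    show "f r \<omega> = f r \<omega>'" if "\<And>i. i \<in> K r \<Longrightarrow> \<omega> i = \<omega>' i" for \<omega> \<omega>'
      by (rule dep1) (rule that)
    show "(\<Prod>r\<in>R. f r \<omega>) = (\<Prod>r\<in>R. f r \<omega>')" if "\<And>i. i \<in> I - K r \<Longrightarrow> \<omega> i = \<omega>' i" for \<omega> \<omega>'
      by (rule dep2) (rule that)
  qed
  then show ?case using insert.hyps insert.IH insert.prems by simp
qed

end

section \<open>Tail bounds for Gaussian coordinates\<close>

lemma (in prob_space) whp_exp_tail:
  assumes [measurable]: "X \<in> borel_measurable M" and B: "(\<integral>\<^sup>+\<omega>. ennreal (exp (X \<omega>)) \<partial>M) \<le> ennreal B" "B \<ge> 0"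
  shows "whp M (B * exp (- s)) (\<lambda>\<omega>. X \<omega> < s)"
proof -
  have "(\<integral>\<^sup>+\<omega>. ennreal (exp (- s)) * ennreal (exp (X \<omega>)) \<partial>M) = ennreal (exp (- s)) * (\<integral>\<^sup>+\<omega>. ennreal (exp (X \<omega>)) \<partial>M)"
    by (rule nn_integral_cmult) measurable
  also have "\<dots> \<le> ennreal (exp (- s)) * ennreal B" by (rule mult_left_mono[OF B(1)]) simp
  also have "\<dots> = ennreal (B * exp (- s))" using B(2) by (simp add: ennreal_mult mult.commute)
  finally have "(\<integral>\<^sup>+\<omega>. ennreal (exp (- s)) * ennreal (exp (X \<omega>)) \<partial>M) \<le> ennreal (B * exp (- s))" .
  then have "whp M (B * exp (- s)) (\<lambda>\<omega>. ennreal (exp (- s)) * ennreal (exp (X \<omega>)) < 1)"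
    by (intro whp_Markov) (use B in auto)
  then show ?thesis
  proof (rule whp_mono)
    fix \<omega> assume "ennreal (exp (- s)) * ennreal (exp (X \<omega>)) < 1"
    then have "ennreal (exp (X \<omega> - s)) < ennreal 1"
      by (simp add: ennreal_mult[symmetric] exp_add[symmetric])
    then show "X \<omega> < s" by (subst (asm) ennreal_less_iff) auto
  qed simp
qed

lemma prod_mono_ennreal:
  fixes f g :: "'a \<Rightarrow> ennreal"
  assumes "\<And>i. i \<in> A \<Longrightarrow> f i \<le> g i"
  shows "prod f A \<le> prod g A"
  using assms by (induction A rule: infinite_finite_induct) (auto intro!: mult_mono)

locale real_product_prob = finite_product_prob M I for M :: "'i \<Rightarrow> real measure" and I :: "'i set"
begin

definition gaussian_coords :: "(nat \<Rightarrow> 'i) \<Rightarrow> nat \<Rightarrow> real \<Rightarrow> bool" where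
  "gaussian_coords a d \<sigma> \<longleftrightarrow> inj_on a {..<d} \<and> a ` {..<d} \<subseteq> I \<and> \<sigma> > 0 \<and>
     (\<forall>k<d. M (a k) = density lborel (normal_density 0 \<sigma>))"

lemma measurable_coord:
  assumes "gaussian_coords a d \<sigma>" "k < d"
  shows "(\<lambda>\<omega>. \<omega> (a k)) \<in> borel_measurable (PiM I M)"
proof -
  have "(\<lambda>\<omega>. \<omega> (a k)) \<in> measurable (PiM I M) (M (a k))"
    using assms by (intro measurable_component_singleton) (auto simp: gaussian_coords_def)
  moreover have "sets (M (a k)) = sets borel" using assms by (simp add: gaussian_coords_def)
  ultimately show ?thesis using measurable_cong_sets[OF refl, of "M (a k)" borel "PiM I M"] by blast
qed

lemma measurable_vinner:
  assumes "gaussian_coords a d \<sigma>"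
  shows "(\<lambda>\<omega>. vinner d u (\<lambda>k. \<omega> (a k))) \<in> borel_measurable (PiM I M)"
  unfolding vinner_def
  by (intro borel_measurable_sum borel_measurable_times borel_measurable_const measurable_coord[OF assms]) auto

lemma mgf_linear:
  assumes a: "gaussian_coords a d \<sigma>"
  shows "(\<integral>\<^sup>+\<omega>. ennreal (exp (vinner d u (\<lambda>k. \<omega> (a k)))) \<partial>PiM I M) = ennreal (exp (\<sigma>\<^sup>2 * (vnorm d u)\<^sup>2 / 2))"
proof -
  have "(\<integral>\<^sup>+\<omega>. ennreal (exp (vinner d u (\<lambda>k. \<omega> (a k)))) \<partial>PiM I M)
     = (\<integral>\<^sup>+\<omega>. (\<Prod>k<d. ennreal (exp (u k * \<omega> (a k)))) \<partial>PiM I M)"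
    by (rule nn_integral_cong) (simp add: vinner_def exp_sum prod_ennreal)
  also have "\<dots> = (\<Prod>k<d. \<integral>\<^sup>+x. ennreal (exp (u k * x)) \<partial>M (a k))"
    using a by (intro nn_integral_prod_coords[where f = "\<lambda>k x. ennreal (exp (u k * x))"])
      (auto simp: gaussian_coords_def)
  also have "\<dots> = (\<Prod>k<d. ennreal (exp ((u k)\<^sup>2 * \<sigma>\<^sup>2 / 2)))"
    using a by (intro prod.cong) (auto simp: gaussian_coords_def nn_integral_exp_normal)
  also have "\<dots> = ennreal (exp (\<Sum>k<d. (u k)\<^sup>2 * \<sigma>\<^sup>2 / 2))"
    by (simp add: exp_sum prod_ennreal)
  also have "(\<Sum>k<d. (u k)\<^sup>2 * \<sigma>\<^sup>2 / 2) = \<sigma>\<^sup>2 * (vnorm d u)\<^sup>2 / 2"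
    unfolding vnorm_sq
    by (simp add: vinner_def sum_distrib_left sum_divide_distrib power2_eq_square ac_simps)
  finally show ?thesis .
qed

lemma mgf_square:
  assumes a: "gaussian_coords a d \<sigma>" and b: "2 * b * \<sigma>\<^sup>2 < 1"
  shows "(\<integral>\<^sup>+\<omega>. ennreal (exp (b * (\<Sum>k<d. (\<omega> (a k))\<^sup>2))) \<partial>PiM I M) = ennreal ((1 / sqrt (1 - 2 * b * \<sigma>\<^sup>2)) ^ d)"
proof -
  have "(\<integral>\<^sup>+\<omega>. ennreal (exp (b * (\<Sum>k<d. (\<omega> (a k))\<^sup>2))) \<partial>PiM I M)
     = (\<integral>\<^sup>+\<omega>. (\<Prod>k<d. ennreal (exp (b * (\<omega> (a k))\<^sup>2))) \<partial>PiM I M)"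
    by (rule nn_integral_cong) (simp add: sum_distrib_left exp_sum prod_ennreal)
  also have "\<dots> = (\<Prod>k<d. \<integral>\<^sup>+x. ennreal (exp (b * x\<^sup>2)) \<partial>M (a k))"
    using a by (intro nn_integral_prod_coords[where f = "\<lambda>k x. ennreal (exp (b * x\<^sup>2))"])
      (auto simp: gaussian_coords_def)
  also have "\<dots> = (\<Prod>k<d. ennreal (1 / sqrt (1 - 2 * b * \<sigma>\<^sup>2)))"
    using a b by (intro prod.cong) (auto simp: gaussian_coords_def nn_integral_exp_sq_normal)
  also have "\<dots> = ennreal ((1 / sqrt (1 - 2 * b * \<sigma>\<^sup>2)) ^ d)"
    using b by (simp add: ennreal_power)
  finally show ?thesis .
qed

text \<open>With the \<open>a\<close> block frozen at x, integrating out the \<open>b\<close> block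
  is a linear moment and leaves exp(c^2 \<tau>^2 |x|^2 / 2), to which the quadratic moment
  applies.\<close>

lemma mgf_bilinear:
  assumes a: "gaussian_coords a d \<sigma>" and b: "gaussian_coords b d \<tau>" and disj: "a ` {..<d} \<inter> b ` {..<d} = {}"
    and c: "c\<^sup>2 * \<sigma>\<^sup>2 * \<tau>\<^sup>2 < 1"
  shows "(\<integral>\<^sup>+\<omega>. ennreal (exp (c * vinner d (\<lambda>k. \<omega> (a k)) (\<lambda>k. \<omega> (b k)))) \<partial>PiM I M)
     = ennreal ((1 / sqrt (1 - c\<^sup>2 * \<sigma>\<^sup>2 * \<tau>\<^sup>2)) ^ d)"
proof -
  let ?J = "b ` {..<d}" and ?K = "I - b ` {..<d}"
  have JI: "?K \<union> ?J = I" "?K \<inter> ?J = {}" "finite ?K" "finite ?J"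
    using b finite_I by (auto simp: gaussian_coords_def)
  interpret J: real_product_prob M ?J
    by unfold_locales auto
  interpret K: real_product_prob M ?K
    by unfold_locales (use finite_I in auto)
  have bJ: "J.gaussian_coords b d \<tau>" using b by (auto simp: J.gaussian_coords_def gaussian_coords_def)
  have aK: "K.gaussian_coords a d \<sigma>" using a disj by (auto simp: K.gaussian_coords_def gaussian_coords_def)
  have m: "(\<lambda>\<omega>. ennreal (exp (c * vinner d (\<lambda>k. \<omega> (a k)) (\<lambda>k. \<omega> (b k))))) \<in> borel_measurable (PiM (?K \<union> ?J) M)"
    unfolding JI(1) vinner_def
    by (intro measurable_compose[OF _ measurable_ennreal] measurable_compose[OF _ borel_measurable_exp] borel_measurable_times
        borel_measurable_const borel_measurable_sum measurable_coord[OF a] measurable_coord[OF b]) auto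
  have "(\<integral>\<^sup>+\<omega>. ennreal (exp (c * vinner d (\<lambda>k. \<omega> (a k)) (\<lambda>k. \<omega> (b k)))) \<partial>PiM I M)
    = (\<integral>\<^sup>+x. \<integral>\<^sup>+y. ennreal (exp (c * vinner d (\<lambda>k. merge ?K ?J (x, y) (a k)) (\<lambda>k. merge ?K ?J (x, y) (b k)))) \<partial>PiM ?J M \<partial>PiM ?K M)"
    using product_nn_integral_fold[OF JI(2-4) m] unfolding JI(1) .
  also have "\<dots> = (\<integral>\<^sup>+x. \<integral>\<^sup>+y. ennreal (exp (vinner d (\<lambda>k. c * x (a k)) (\<lambda>k. y (b k)))) \<partial>PiM ?J M \<partial>PiM ?K M)"
  proof (rule nn_integral_cong, rule nn_integral_cong)
    fix x y :: "'i \<Rightarrow> real"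
    have "merge ?K ?J (x, y) (a k) = x (a k)" "merge ?K ?J (x, y) (b k) = y (b k)" if "k < d" for k
      using that a disj by (auto simp: merge_def gaussian_coords_def)
    then have "c * vinner d (\<lambda>k. merge ?K ?J (x, y) (a k)) (\<lambda>k. merge ?K ?J (x, y) (b k))
       = vinner d (\<lambda>k. c * x (a k)) (\<lambda>k. y (b k))"
      by (simp add: vinner_def sum_distrib_left mult.assoc)
    then show "ennreal (exp (c * vinner d (\<lambda>k. merge ?K ?J (x, y) (a k)) (\<lambda>k. merge ?K ?J (x, y) (b k))))
       = ennreal (exp (vinner d (\<lambda>k. c * x (a k)) (\<lambda>k. y (b k))))" by simp
  qed
  also have "\<dots> = (\<integral>\<^sup>+x. ennreal (exp (\<tau>\<^sup>2 * c\<^sup>2 / 2 * (\<Sum>k<d. (x (a k))\<^sup>2))) \<partial>PiM ?K M)"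
    unfolding J.mgf_linear[OF bJ]
    by (rule nn_integral_cong)
       (unfold vnorm_sq, simp add: vinner_def sum_distrib_left power2_eq_square ac_simps)
  also have "\<dots> = ennreal ((1 / sqrt (1 - 2 * (\<tau>\<^sup>2 * c\<^sup>2 / 2) * \<sigma>\<^sup>2)) ^ d)"
    by (rule K.mgf_square[OF aK]) (use c in \<open>simp add: ac_simps\<close>)
  also have "2 * (\<tau>\<^sup>2 * c\<^sup>2 / 2) * \<sigma>\<^sup>2 = c\<^sup>2 * \<sigma>\<^sup>2 * \<tau>\<^sup>2" by simp
  finally show ?thesis .
qed

text \<open>Chernoff bound with the linear form normalised to unit variance: the moment is exp(1/2)
  \<le> 2, once per sign. The tail exp(-s) is weaker than Gaussian but suffices, as s will be a
  multiple of 1 + ln d.\<close>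

lemma whp_linear_le:
  assumes a: "gaussian_coords a d \<sigma>" and s: "s \<ge> 0"
  shows "whp (PiM I M) (4 * exp (- s)) (\<lambda>\<omega>. \<bar>vinner d u (\<lambda>k. \<omega> (a k))\<bar> \<le> \<sigma> * vnorm d u * s)"
proof (cases "vnorm d u = 0")
  case True
  then have "(\<Sum>k<d. (u k)\<^sup>2) = 0"
    using vnorm_sq[of d u] by (simp add: vinner_def power2_eq_square)
  then have "u k = 0" if "k < d" for k using that by (simp add: sum_nonneg_eq_0_iff)
  then have "vinner d u v = 0" for v by (simp add: vinner_def)
  then show ?thesis
    unfolding whp_def True by (intro bexI[of _ "space (PiM I M)"]) (auto simp: P.prob_space)
next
  case False
  have \<sigma>: "\<sigma> > 0" using a by (simp add: gaussian_coords_def)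
  define \<tau> where "\<tau> = \<sigma> * vnorm d u"
  have \<tau>: "\<tau> > 0" using False vnorm_nonneg[of d u] \<sigma> by (simp add: \<tau>_def)
  have scale: "vinner d (\<lambda>k. c * u k) v = c * vinner d u v" for c v
    by (simp add: vinner_def sum_distrib_left mult.assoc)
  have one: "whp (PiM I M) (2 * exp (- s)) (\<lambda>\<omega>. vinner d (\<lambda>k. c * u k) (\<lambda>k. \<omega> (a k)) < s)"
    if c: "c\<^sup>2 * \<tau>\<^sup>2 = 1" for c
  proof (rule P.whp_exp_tail[OF measurable_vinner[OF a]])
    have "\<sigma>\<^sup>2 * (vnorm d (\<lambda>k. c * u k))\<^sup>2 = c\<^sup>2 * \<tau>\<^sup>2"
      unfolding vnorm_sq \<tau>_def power_mult_distrib
      by (simp add: vinner_def sum_distrib_left power2_eq_square ac_simps)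
    then have eq: "(\<integral>\<^sup>+\<omega>. ennreal (exp (vinner d (\<lambda>k. c * u k) (\<lambda>k. \<omega> (a k)))) \<partial>PiM I M) = ennreal (exp (1/2))"
      unfolding mgf_linear[OF a] using c by simp
    have "exp (1/2 :: real) \<le> 2"
      by (rule power2_le_imp_le) (use exp_le in \<open>auto simp: power2_eq_square simp flip: exp_add\<close>)
    then show "(\<integral>\<^sup>+\<omega>. ennreal (exp (vinner d (\<lambda>k. c * u k) (\<lambda>k. \<omega> (a k)))) \<partial>PiM I M) \<le> ennreal 2"
      unfolding eq by (rule ennreal_leI)
  qed simp
  have "whp (PiM I M) (2 * exp (- s) + 2 * exp (- s))
    (\<lambda>\<omega>. vinner d (\<lambda>k. (1 / \<tau>) * u k) (\<lambda>k. \<omega> (a k)) < s \<and> vinner d (\<lambda>k. (- 1 / \<tau>) * u k) (\<lambda>k. \<omega> (a k)) < s)"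
    by (intro P.whp_conj one) (use \<tau> in \<open>auto simp: power2_eq_square\<close>)
  then show ?thesis
  proof (rule whp_mono)
    fix \<omega> assume "vinner d (\<lambda>k. (1 / \<tau>) * u k) (\<lambda>k. \<omega> (a k)) < s \<and> vinner d (\<lambda>k. (- 1 / \<tau>) * u k) (\<lambda>k. \<omega> (a k)) < s"
    then show "\<bar>vinner d u (\<lambda>k. \<omega> (a k))\<bar> \<le> \<sigma> * vnorm d u * s"
      unfolding scale \<tau>_def[symmetric] using \<tau> by (auto simp: field_simps abs_le_iff)
  qed simp
qed

lemma whp_square_le:
  assumes a: "gaussian_coords a d \<sigma>"
  shows "whp (PiM I M) (exp (- real d / 2)) (\<lambda>\<omega>. (\<Sum>k<d. (\<omega> (a k))\<^sup>2) \<le> 4 * \<sigma>\<^sup>2 * d)"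
proof -
  have \<sigma>: "\<sigma> > 0" using a by (simp add: gaussian_coords_def)
  \<comment> \<open>The rate 1/(4 \<sigma>^2) makes the moment (sqrt 2)^d, and sqrt 2 \<le> exp(1/2)
    then consumes only half of the exponent in exp(-d).\<close>
  have e: "2 * (1 / (4 * \<sigma>\<^sup>2)) * \<sigma>\<^sup>2 = 1 / 2" using \<sigma> by simp
  have m: "(\<lambda>\<omega>. 1 / (4 * \<sigma>\<^sup>2) * (\<Sum>k<d. (\<omega> (a k))\<^sup>2)) \<in> borel_measurable (PiM I M)"
    by (intro borel_measurable_times borel_measurable_const borel_measurable_sum borel_measurable_power measurable_coord[OF a]) auto
  have "whp (PiM I M) ((1 / sqrt (1 - 2 * (1 / (4 * \<sigma>\<^sup>2)) * \<sigma>\<^sup>2)) ^ d * exp (- real d))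
     (\<lambda>\<omega>. 1 / (4 * \<sigma>\<^sup>2) * (\<Sum>k<d. (\<omega> (a k))\<^sup>2) < real d)"
  proof (rule P.whp_exp_tail[OF m])
    show "(\<integral>\<^sup>+\<omega>. ennreal (exp (1 / (4 * \<sigma>\<^sup>2) * (\<Sum>k<d. (\<omega> (a k))\<^sup>2))) \<partial>PiM I M)
       \<le> ennreal ((1 / sqrt (1 - 2 * (1 / (4 * \<sigma>\<^sup>2)) * \<sigma>\<^sup>2)) ^ d)"
      by (subst mgf_square[OF a]) (simp_all add: e del: times_divide_eq_right)
  qed (simp add: e del: times_divide_eq_right)
  then show ?thesis
  proof (rule whp_mono)
    have "sqrt 2 \<le> sqrt (exp 1)" using exp_ge_add_one_self[of "1::real"] by simp
    also have "\<dots> = exp (1/2 :: real)" by (rule real_sqrt_unique) (simp_all add: power2_eq_square flip: exp_add)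
    finally have "(sqrt 2) ^ d \<le> exp (1/2) ^ d" by (rule power_mono) simp
    also have "\<dots> = exp (real d / 2)" by (simp flip: exp_of_nat_mult)
    finally have "sqrt 2 ^ d * exp (- real d) \<le> exp (real d / 2) * exp (- real d)" by simp
    also have "\<dots> = exp (- real d / 2)" by (simp flip: exp_add)
    finally show "(1 / sqrt (1 - 2 * (1 / (4 * \<sigma>\<^sup>2)) * \<sigma>\<^sup>2)) ^ d * exp (- real d) \<le> exp (- real d / 2)"
      unfolding e by (simp add: real_sqrt_divide)
    fix \<omega> assume "1 / (4 * \<sigma>\<^sup>2) * (\<Sum>k<d. (\<omega> (a k))\<^sup>2) < real d"
    then show "(\<Sum>k<d. (\<omega> (a k))\<^sup>2) \<le> 4 * \<sigma>\<^sup>2 * d" using \<sigma> by (simp add: field_simps)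
  qed
qed

lemma whp_square_ge:
  assumes a: "gaussian_coords a d \<sigma>"
  shows "whp (PiM I M) (exp (- real d / 2)) (\<lambda>\<omega>. (\<Sum>k<d. (\<omega> (a k))\<^sup>2) \<ge> \<sigma>\<^sup>2 * d / 8)"
proof -
  have \<sigma>: "\<sigma> > 0" using a by (simp add: gaussian_coords_def)
  \<comment> \<open>The rate -4/\<sigma>^2 puts sqrt 9 = 3 into the denominator; as 3 exceeds e, the
    product of 3^(-d) and exp(d/2) is at most exp(-d/2).\<close>
  have e: "2 * (- 4 / \<sigma>\<^sup>2) * \<sigma>\<^sup>2 = - 8" using \<sigma> by simp
  have m: "(\<lambda>\<omega>. - 4 / \<sigma>\<^sup>2 * (\<Sum>k<d. (\<omega> (a k))\<^sup>2)) \<in> borel_measurable (PiM I M)"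
    by (intro borel_measurable_times borel_measurable_const borel_measurable_sum borel_measurable_power measurable_coord[OF a]) auto
  have "sqrt 9 = (3::real)" by (rule real_sqrt_unique) auto
  then have B: "(1 / sqrt (1 - 2 * (- 4 / \<sigma>\<^sup>2) * \<sigma>\<^sup>2)) = 1 / 3" unfolding e by simp
  have "whp (PiM I M) ((1/3) ^ d * exp (- (- real d / 2)))
     (\<lambda>\<omega>. - 4 / \<sigma>\<^sup>2 * (\<Sum>k<d. (\<omega> (a k))\<^sup>2) < - real d / 2)"
  proof (rule P.whp_exp_tail[OF m])
    show "(\<integral>\<^sup>+\<omega>. ennreal (exp (- 4 / \<sigma>\<^sup>2 * (\<Sum>k<d. (\<omega> (a k))\<^sup>2))) \<partial>PiM I M) \<le> ennreal ((1/3) ^ d)"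
      unfolding B[symmetric] by (subst mgf_square[OF a]) (use e in simp_all)
  qed simp
  then show ?thesis
  proof (rule whp_mono)
    have "(1/3::real) ^ d \<le> exp (- 1) ^ d"
      using exp_le by (intro power_mono) (auto simp: exp_minus field_simps)
    also have "\<dots> = exp (- real d)" by (simp flip: exp_of_nat_mult)
    finally have "(1/3::real) ^ d * exp (- (- real d / 2)) \<le> exp (- real d) * exp (- (- real d / 2))" by simp
    also have "\<dots> = exp (- real d / 2)" by (simp flip: exp_add)
    finally show "(1/3::real) ^ d * exp (- (- real d / 2)) \<le> exp (- real d / 2)" .
    fix \<omega> assume "- 4 / \<sigma>\<^sup>2 * (\<Sum>k<d. (\<omega> (a k))\<^sup>2) < - real d / 2"
    then show "(\<Sum>k<d. (\<omega> (a k))\<^sup>2) \<ge> \<sigma>\<^sup>2 * d / 8" using \<sigma> by (simp add: field_simps)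
  qed
qed

lemma whp_bilinear_le:
  assumes a: "gaussian_coords a d \<sigma>" and b: "gaussian_coords b d \<tau>" and disj: "a ` {..<d} \<inter> b ` {..<d} = {}"
    and d: "d \<ge> 1"
  shows "whp (PiM I M) (4 * exp (- s / 2))
     (\<lambda>\<omega>. \<bar>vinner d (\<lambda>k. \<omega> (a k)) (\<lambda>k. \<omega> (b k))\<bar> \<le> \<sigma> * \<tau> * sqrt d * s)"
proof -
  have \<sigma>: "\<sigma> > 0" "\<tau> > 0" using a b by (auto simp: gaussian_coords_def)
  \<comment> \<open>At this scale c^2 \<sigma>^2 \<tau>^2 = 1/(4d), and Bernoulli's inequality keeps
    the d-th power of 1 - 1/(4d) above 3/4, so the moment is at most 2.\<close>
  define \<kappa> where "\<kappa> = 2 * \<sigma> * \<tau> * sqrt d"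
  have \<kappa>: "\<kappa> > 0" using \<sigma> d by (simp add: \<kappa>_def)
  have \<kappa>2: "\<kappa>\<^sup>2 = 4 * real d * \<sigma>\<^sup>2 * \<tau>\<^sup>2" by (simp add: \<kappa>_def power_mult_distrib)
  have one: "whp (PiM I M) (2 * exp (- (s / 2))) (\<lambda>\<omega>. c * vinner d (\<lambda>k. \<omega> (a k)) (\<lambda>k. \<omega> (b k)) < s / 2)"
    if c: "c\<^sup>2 * \<kappa>\<^sup>2 = 1" for c
  proof (rule P.whp_exp_tail)
    have "4 * real d * (c\<^sup>2 * \<sigma>\<^sup>2 * \<tau>\<^sup>2) = 1" using c unfolding \<kappa>2 by (simp add: ac_simps)
    then have cc: "c\<^sup>2 * \<sigma>\<^sup>2 * \<tau>\<^sup>2 = 1 / (4 * real d)" using d by (simp add: field_simps)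
    have lt: "1 / (4 * real d) < 1" using d by (simp add: field_simps)
    have "1 + real d * (- (1 / (4 * real d))) \<le> (1 + (- (1 / (4 * real d)))) ^ d"
      by (rule Bernoulli_inequality) (use lt in simp)
    then have "3 / 4 \<le> (1 - 1 / (4 * real d)) ^ d" using d by simp
    then have "1 / 2 \<le> sqrt ((1 - 1 / (4 * real d)) ^ d)"
      by (intro real_le_rsqrt) (simp add: power2_eq_square)
    then have B: "(1 / sqrt (1 - 1 / (4 * real d))) ^ d \<le> 2"
      by (simp add: power_divide real_sqrt_power divide_le_eq)
    have "(\<integral>\<^sup>+\<omega>. ennreal (exp (c * vinner d (\<lambda>k. \<omega> (a k)) (\<lambda>k. \<omega> (b k)))) \<partial>PiM I M)
       = ennreal ((1 / sqrt (1 - 1 / (4 * real d))) ^ d)"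
      using mgf_bilinear[OF a b disj, of c] lt unfolding cc by simp
    also have "\<dots> \<le> ennreal 2" by (rule ennreal_leI[OF B])
    finally show "(\<integral>\<^sup>+\<omega>. ennreal (exp (c * vinner d (\<lambda>k. \<omega> (a k)) (\<lambda>k. \<omega> (b k)))) \<partial>PiM I M) \<le> ennreal 2" .
    show "(\<lambda>\<omega>. c * vinner d (\<lambda>k. \<omega> (a k)) (\<lambda>k. \<omega> (b k))) \<in> borel_measurable (PiM I M)"
      unfolding vinner_def
      by (intro borel_measurable_times borel_measurable_const borel_measurable_sum
          measurable_coord[OF a] measurable_coord[OF b]) auto
  qed simp
  have "whp (PiM I M) (2 * exp (- (s / 2)) + 2 * exp (- (s / 2)))
    (\<lambda>\<omega>. (1 / \<kappa>) * vinner d (\<lambda>k. \<omega> (a k)) (\<lambda>k. \<omega> (b k)) < s / 2 \<and>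
         (- 1 / \<kappa>) * vinner d (\<lambda>k. \<omega> (a k)) (\<lambda>k. \<omega> (b k)) < s / 2)"
    by (intro P.whp_conj one) (use \<kappa> in \<open>auto simp: power2_eq_square\<close>)
  then show ?thesis
  proof (rule whp_mono)
    fix \<omega> :: "'i \<Rightarrow> real"
    let ?v = "vinner d (\<lambda>k. \<omega> (a k)) (\<lambda>k. \<omega> (b k))"
    assume "(1 / \<kappa>) * ?v < s / 2 \<and> (- 1 / \<kappa>) * ?v < s / 2"
    then have "\<bar>?v\<bar> \<le> \<kappa> * s / 2" using \<kappa> by (auto simp: field_simps abs_le_iff)
    then show "\<bar>?v\<bar> \<le> \<sigma> * \<tau> * sqrt d * s" by (simp add: \<kappa>_def)
  qed simp
qed

text \<open>Anti-concentration: \<open>(exp z - 10)^2 / 8.9^2\<close> dominates the indicator of \<open>z < 1/11\<close>, and its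
  Gaussian expectation is at most \<open>0.95\<close>.\<close>
lemma whp_some_large:
  assumes a: "\<And>r. r < m \<Longrightarrow> gaussian_coords (a r) d \<sigma>" and u: "\<sigma> * vnorm d u = 1"
    and disj: "disjoint_family_on (\<lambda>r. a r ` {..<d}) {..<m}"
  shows "whp (PiM I M) (exp (- real m / 20)) (\<lambda>\<omega>. \<exists>r<m. vinner d u (\<lambda>k. \<omega> (a r k)) \<ge> 1 / 11)"
proof -
  define Z where "Z r \<omega> = vinner d u (\<lambda>k. \<omega> (a r k))" for r and \<omega> :: "'i \<Rightarrow> real"
  define h where "h r \<omega> = ennreal ((exp (Z r \<omega>) - 10)\<^sup>2 / 79.21)" for r \<omega>
  have Zm: "Z r \<in> borel_measurable (PiM I M)" if "r < m" for r
    unfolding Z_def[abs_def] by (rule measurable_vinner[OF a[OF that]])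
  have hm: "h r \<in> borel_measurable (PiM I M)" if "r < m" for r
  proof -
    note [measurable] = Zm[OF that]
    show ?thesis unfolding h_def[abs_def] by measurable
  qed
  have exph: "(\<integral>\<^sup>+\<omega>. h r \<omega> \<partial>PiM I M) \<le> ennreal (95 / 100)" if r: "r < m" for r
  proof -
    note [measurable] = Zm[OF r]
    have u2: "\<sigma>\<^sup>2 * (vnorm d u)\<^sup>2 = 1" using u by (metis power_mult_distrib power_one)
    have E1: "(\<integral>\<^sup>+\<omega>. ennreal (exp (Z r \<omega>)) \<partial>PiM I M) = ennreal (exp (1/2))"
      unfolding Z_def mgf_linear[OF a[OF r]] u2 by simp
    have "\<sigma>\<^sup>2 * (vnorm d (\<lambda>k. 2 * u k))\<^sup>2 = 4 * (\<sigma>\<^sup>2 * (vnorm d u)\<^sup>2)"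
      unfolding vnorm_sq by (simp add: vinner_def sum_distrib_left ac_simps)
    then have "(\<integral>\<^sup>+\<omega>. ennreal (exp (vinner d (\<lambda>k. 2 * u k) (\<lambda>k. \<omega> (a r k)))) \<partial>PiM I M) = ennreal (exp 2)"
      unfolding mgf_linear[OF a[OF r]] u2 by simp
    moreover have "vinner d (\<lambda>k. 2 * u k) v = 2 * vinner d u v" for v
      by (simp add: vinner_def sum_distrib_left mult.assoc)
    ultimately have E2: "(\<integral>\<^sup>+\<omega>. ennreal (exp (2 * Z r \<omega>)) \<partial>PiM I M) = ennreal (exp 2)"
      by (simp add: Z_def)
    \<comment> \<open>The negative cross term of the square is moved to the left, since subtraction
      in \<open>ennreal\<close> truncates. The claim becomes e^2 + 100 - 20 sqrt e \<le> 0.95 times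
      79.21.\<close>
    have "(\<integral>\<^sup>+\<omega>. h r \<omega> \<partial>PiM I M) + ennreal (20 / 79.21) * ennreal (exp (1/2))
       = (\<integral>\<^sup>+\<omega>. h r \<omega> + ennreal (20 / 79.21) * ennreal (exp (Z r \<omega>)) \<partial>PiM I M)"
      unfolding E1[symmetric] using hm[OF r]
      by (subst nn_integral_add) (auto simp: nn_integral_cmult)
    also have "\<dots> = (\<integral>\<^sup>+\<omega>. ennreal (1 / 79.21) * ennreal (exp (2 * Z r \<omega>)) + ennreal (100 / 79.21) \<partial>PiM I M)"
    proof (rule nn_integral_cong)
      fix \<omega>
      have "(exp (Z r \<omega>) - 10)\<^sup>2 / 79.21 + 20 / 79.21 * exp (Z r \<omega>) = 1 / 79.21 * exp (2 * Z r \<omega>) + 100 / 79.21"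
        by (simp add: power2_eq_square exp_double algebra_simps add_divide_distrib diff_divide_distrib)
      then show "h r \<omega> + ennreal (20 / 79.21) * ennreal (exp (Z r \<omega>))
        = ennreal (1 / 79.21) * ennreal (exp (2 * Z r \<omega>)) + ennreal (100 / 79.21)"
        unfolding h_def by (simp flip: ennreal_mult ennreal_plus)
    qed
    also have "\<dots> = ennreal (1 / 79.21) * ennreal (exp 2) + ennreal (100 / 79.21)"
      unfolding E2[symmetric]
      by (subst nn_integral_add) (auto simp: nn_integral_cmult P.emeasure_space_1)
    also have "\<dots> = ennreal (exp 2 / 79.21 + 100 / 79.21)"
      by (simp flip: ennreal_mult ennreal_plus)
    finally have eq: "(\<integral>\<^sup>+\<omega>. h r \<omega> \<partial>PiM I M) + ennreal (20 / 79.21 * exp (1/2)) = ennreal (exp 2 / 79.21 + 100 / 79.21)"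
      by (simp flip: ennreal_mult)
    have "exp 2 / 79.21 + 100 / 79.21 \<le> 95 / 100 + 20 / 79.21 * exp (1/2 :: real)"
    proof -
      have l: "exp (1/2 :: real) \<ge> 1.625"
        using exp_lower_Taylor_quadratic[of "1/2 :: real"] by (simp add: power2_eq_square)
      have "(exp 1 :: real) < 272 / 100" using e_less_272 by simp
      then have "exp 1 * exp (1 :: real) \<le> 272 / 100 * (272 / 100)" by (intro mult_mono) auto
      then have "exp (2 :: real) \<le> 7.3984" by (simp flip: exp_add)
      with l show ?thesis by simp
    qed
    then have "ennreal (exp 2 / 79.21 + 100 / 79.21) \<le> ennreal (95 / 100 + 20 / 79.21 * exp (1/2 :: real))"
      by (rule ennreal_leI)
    also have "\<dots> = ennreal (95 / 100) + ennreal (20 / 79.21 * exp (1/2))" by (rule ennreal_plus) auto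
    finally have "(\<integral>\<^sup>+\<omega>. h r \<omega> \<partial>PiM I M) + ennreal (20 / 79.21 * exp (1/2)) \<le> ennreal (95 / 100) + ennreal (20 / 79.21 * exp (1/2))"
      unfolding eq .
    then show ?thesis by (simp add: ennreal_add_left_cancel_le add.commute)
  qed
  \<comment> \<open>Independence of the blocks bounds the mean of the product by 0.95^m; a product
    below 1 has a factor below 1, which excludes that all inner products are small.\<close>
  have "(\<integral>\<^sup>+\<omega>. (\<Prod>r<m. h r \<omega>) \<partial>PiM I M) = (\<Prod>r<m. \<integral>\<^sup>+\<omega>. h r \<omega> \<partial>PiM I M)"
  proof (rule nn_integral_prod_blocks[OF _ _ disj])
    show "\<forall>r\<in>{..<m}. \<forall>\<omega> \<omega>'. (\<forall>i\<in>a r ` {..<d}. \<omega> i = \<omega>' i) \<longrightarrow> h r \<omega> = h r \<omega>'"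
      by (auto simp: h_def Z_def vinner_def)
  qed (use a hm in \<open>auto simp: gaussian_coords_def\<close>)
  also have "\<dots> \<le> (\<Prod>r<m. ennreal (95 / 100))" by (intro prod_mono_ennreal) (use exph in auto)
  also have "\<dots> = ennreal ((95 / 100) ^ m)" by (simp add: ennreal_power)
  also have "\<dots> \<le> ennreal (exp (- real m / 20))"
  proof (rule ennreal_leI)
    have "(95 / 100 :: real) ^ m \<le> exp (- 1 / 20) ^ m"
      using exp_ge_add_one_self[of "- 1 / 20 :: real"] by (intro power_mono) auto
    then show "(95 / 100 :: real) ^ m \<le> exp (- real m / 20)" by (simp flip: exp_of_nat_mult)
  qed
  finally have "whp (PiM I M) (exp (- real m / 20)) (\<lambda>\<omega>. (\<Prod>r<m. h r \<omega>) < 1)"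
    using hm by (intro P.whp_Markov borel_measurable_prod_ennreal) auto
  then show ?thesis
  proof (rule whp_mono)
    fix \<omega> assume prod: "(\<Prod>r<m. h r \<omega>) < 1"
    show "\<exists>r<m. vinner d u (\<lambda>k. \<omega> (a r k)) \<ge> 1 / 11"
    proof (rule ccontr)
      assume "\<not> ?thesis"
      then have small: "Z r \<omega> < 1 / 11" if "r < m" for r using that by (auto simp: Z_def not_le)
      have "1 \<le> h r \<omega>" if "r < m" for r
      proof -
        have "1 - 1 / 11 \<le> exp (- (1 / 11 :: real))" using exp_ge_add_one_self[of "- (1 / 11) :: real"] by simp
        then have "exp (1 / 11 :: real) \<le> 11 / 10" by (simp add: exp_minus field_simps)
        moreover have "exp (Z r \<omega>) < exp (1 / 11)" using small[OF that] by simp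
        ultimately have "10 - exp (Z r \<omega>) \<ge> 89 / 10" by linarith
        then have "89 / 10 * (89 / 10) \<le> (10 - exp (Z r \<omega>)) * (10 - exp (Z r \<omega>))" by (intro mult_mono) auto
        then have "1 \<le> (exp (Z r \<omega>) - 10)\<^sup>2 / 79.21" by (simp add: power2_eq_square algebra_simps)
        then show ?thesis unfolding h_def by (simp add: ennreal_1[symmetric] del: ennreal_1)
      qed
      then have "(\<Prod>r<m. 1) \<le> (\<Prod>r<m. h r \<omega>)" by (intro prod_mono_ennreal) auto
      with prod show False by simp
    qed
  qed simp
qed

end

section \<open>The good sample event and the test loss\<close>

lemma (in prob_space) whp_AE:
  assumes "AE \<omega> in M. Q \<omega>"
  shows "whp M 0 Q"
proof -
  obtain N where N: "\<And>\<omega>. \<omega> \<in> space M - N \<Longrightarrow> Q \<omega>" "N \<in> null_sets M"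
    using AE_E3[OF assms] by blast
  have "prob (space M - N) = 1"
    using N(2) by (subst prob_compl) (auto simp: null_sets_def measure_def)
  then show ?thesis
    unfolding whp_def using N by (intro bexI[of _ "space M - N"]) auto
qed

lemma (in prob_space) whp_True: "Q \<Longrightarrow> \<delta> \<ge> 0 \<Longrightarrow> whp M \<delta> (\<lambda>_. Q)"
  unfolding whp_def by (intro bexI[of _ "space M"]) (auto simp: prob_space)

lemma prob_space_comp_dist: "\<sigma>\<^sub>0 > 0 \<Longrightarrow> prob_space (comp_dist \<sigma>\<^sub>0 i)"
  by (cases i) (auto simp: comp_dist_def rademacher_def coin_def measure_pmf.prob_space_axioms
      intro!: prob_space_normal_density)

lemma finite_idx_set: "finite (idx_set n m d)"
proof -
  have "idx_set n m d = Lab ` {..<n} \<union> Pos ` {..<n} \<union> (\<lambda>(i, k). Noise i k) ` ({..<n} \<times> {..<d})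
    \<union> (\<lambda>(j, r, k). Init j r k) ` ({-1, 1} \<times> {..<m} \<times> {..<d})"
    unfolding idx_set_def by (auto simp: image_iff)
  then show ?thesis by simp
qed

lemma real_product_prob_comp_dist:
  assumes "\<sigma>\<^sub>0 > 0"
  shows "real_product_prob (comp_dist \<sigma>\<^sub>0) (idx_set n m d)"
proof -
  interpret prob_space "comp_dist \<sigma>\<^sub>0 i" for i by (rule prob_space_comp_dist[OF assms])
  show ?thesis by unfold_locales (rule finite_idx_set)
qed

lemma AE_label:
  assumes "\<sigma>\<^sub>0 > 0" "i < n"
  shows "AE \<omega> in PiM (idx_set n m d) (comp_dist \<sigma>\<^sub>0). \<omega> (Lab i) \<in> {-1, 1}"
proof (rule AE_PiM_component)
  show "Lab i \<in> idx_set n m d" using assms by (auto simp: idx_set_def)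
  show "AE x in comp_dist \<sigma>\<^sub>0 (Lab i). x \<in> {-1, 1}"
  proof -
    have "comp_dist \<sigma>\<^sub>0 (Lab i) = measure_pmf (pmf_of_set {-1, 1})"
      by (simp add: comp_dist_def rademacher_def)
    then show ?thesis by (simp only:) (simp add: AE_measure_pmf_iff)
  qed
qed (rule prob_space_comp_dist[OF assms(1)])

text \<open>The factors \<open>1\<close> are the standard deviations of the coordinates \<open>Noise i k\<close>.\<close>
definition good_sample :: "nat \<Rightarrow> nat \<Rightarrow> nat \<Rightarrow> (nat \<Rightarrow> real) \<Rightarrow> real \<Rightarrow> real \<Rightarrow> (idx \<Rightarrow> real) \<Rightarrow> bool" where
  "good_sample n m d \<mu> \<sigma>\<^sub>0 s \<omega> \<longleftrightarrow>
     (\<forall>i\<in>{..<n}. \<omega> (Lab i) \<in> {-1, 1})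
   \<and> (\<forall>j\<in>{-1, 1::int}. real n / 8 \<le> real (card {i. i < n \<and> \<omega> (Lab i) = of_int j}))
   \<and> (\<forall>i\<in>{..<n}. (\<Sum>k<d. (\<omega> (Noise i k))\<^sup>2) \<le> 4 * 1\<^sup>2 * real d)
   \<and> (\<forall>i\<in>{..<n}. (\<Sum>k<d. (\<omega> (Noise i k))\<^sup>2) \<ge> 1\<^sup>2 * real d / 8)
   \<and> (\<forall>i\<in>{..<n}. \<bar>vinner d \<mu> (\<lambda>k. \<omega> (Noise i k))\<bar> \<le> 1 * vnorm d \<mu> * s)
   \<and> (\<forall>(i, l)\<in>{..<n} \<times> {..<n}. i \<noteq> l \<longrightarrow>
        \<bar>vinner d (\<lambda>k. \<omega> (Noise i k)) (\<lambda>k. \<omega> (Noise l k))\<bar> \<le> 1 * 1 * sqrt d * s)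
   \<and> (\<forall>(j, r, i)\<in>{-1, 1} \<times> {..<m} \<times> {..<n}.
        \<bar>vinner d (\<lambda>k. \<omega> (Init j r k)) (\<lambda>k. \<omega> (Noise i k))\<bar> \<le> \<sigma>\<^sub>0 * 1 * sqrt d * s)
   \<and> (\<forall>(j, r)\<in>{-1, 1} \<times> {..<m}. \<bar>vinner d \<mu> (\<lambda>k. \<omega> (Init j r k))\<bar> \<le> \<sigma>\<^sub>0 * vnorm d \<mu> * s)
   \<and> (\<forall>(j, r)\<in>{-1, 1} \<times> {..<m}. (\<Sum>k<d. (\<omega> (Init j r k))\<^sup>2) \<le> 4 * \<sigma>\<^sub>0\<^sup>2 * real d)
   \<and> (\<forall>j\<in>{-1, 1}. \<exists>r<m. vinner d (\<lambda>k. of_int j / (\<sigma>\<^sub>0 * vnorm d \<mu>) * \<mu> k) (\<lambda>k. \<omega> (Init j r k)) \<ge> 1 / 11)"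

text \<open>Chernoff bound for the lower tail: one label contributes (1 + 1/e)/2 \<le> 3/4 \<le>
  exp(-1/4), and the low threshold n/8 gives back only exp(n/8).\<close>

lemma whp_label_count:
  assumes \<sigma>0: "\<sigma>\<^sub>0 > 0" and j: "j \<in> {-1, 1::real}"
  shows "whp (PiM (idx_set n m d) (comp_dist \<sigma>\<^sub>0)) (exp (- real n / 8))
     (\<lambda>\<omega>. real n / 8 \<le> real (card {i. i < n \<and> \<omega> (Lab i) = j}))"
proof -
  interpret real_product_prob "comp_dist \<sigma>\<^sub>0" "idx_set n m d" by (rule real_product_prob_comp_dist[OF \<sigma>0])
  let ?M = "PiM (idx_set n m d) (comp_dist \<sigma>\<^sub>0)"
  define b where "b x = (if x = j then 1 else 0 :: real)" for x
  define X where "X \<omega> = - (\<Sum>i<n. b (\<omega> (Lab i)))" for \<omega> :: "idx \<Rightarrow> real"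
  have bm: "(\<lambda>\<omega>. b (\<omega> (Lab i))) \<in> borel_measurable ?M" if "i < n" for i
  proof (rule measurable_compose[OF measurable_component_singleton])
    show "Lab i \<in> idx_set n m d" using that by (auto simp: idx_set_def)
    show "b \<in> borel_measurable (comp_dist \<sigma>\<^sub>0 (Lab i))" by (simp add: comp_dist_def rademacher_def)
  qed
  have Xm: "X \<in> borel_measurable ?M"
    unfolding X_def[abs_def] by (intro borel_measurable_uminus borel_measurable_sum bm) auto
  have e2: "exp (- 1 :: real) \<le> 1 / 2"
    using exp_ge_add_one_self[of "1::real"] by (simp add: exp_minus field_simps)
  have one: "(\<integral>\<^sup>+x. ennreal (exp (- b x)) \<partial>comp_dist \<sigma>\<^sub>0 (Lab i)) \<le> ennreal (3 / 4)" for i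
  proof -
    have "(\<integral>\<^sup>+x. ennreal (exp (- b x)) \<partial>comp_dist \<sigma>\<^sub>0 (Lab i)) = (\<Sum>x\<in>{-1, 1}. ennreal (exp (- b x))) / of_nat (card {-1, 1::real})"
      unfolding comp_dist_def rademacher_def by (simp add: nn_integral_pmf_of_set)
    also have "(\<Sum>x\<in>{-1, 1}. ennreal (exp (- b x))) = ennreal (1 + exp (- 1))"
      using j by (auto simp: b_def ennreal_plus add.commute simp flip: ennreal_1)
    also have "ennreal (1 + exp (- 1)) / of_nat (card {-1, 1::real}) = ennreal ((1 + exp (- 1)) / 2)"
      by (simp add: divide_ennreal[symmetric] ennreal_numeral[symmetric] del: ennreal_numeral)
    also have "\<dots> \<le> ennreal (3 / 4)" using e2 by (intro ennreal_leI) simp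
    finally show ?thesis .
  qed
  have "(\<integral>\<^sup>+\<omega>. ennreal (exp (X \<omega>)) \<partial>?M) = (\<integral>\<^sup>+\<omega>. (\<Prod>i<n. ennreal (exp (- b (\<omega> (Lab i))))) \<partial>?M)"
    by (rule nn_integral_cong) (simp add: X_def exp_sum prod_ennreal flip: sum_negf)
  also have "\<dots> = (\<Prod>i<n. \<integral>\<^sup>+x. ennreal (exp (- b x)) \<partial>comp_dist \<sigma>\<^sub>0 (Lab i))"
    by (rule nn_integral_prod_coords[where f = "\<lambda>i x. ennreal (exp (- b x))"])
       (auto simp: inj_on_def idx_set_def comp_dist_def rademacher_def)
  also have "\<dots> \<le> (\<Prod>i<n. ennreal (3 / 4))" by (intro prod_mono_ennreal one)
  also have "\<dots> = ennreal ((3 / 4) ^ n)" by (simp add: ennreal_power)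
  finally have "whp ?M ((3 / 4) ^ n * exp (- (- real n / 8))) (\<lambda>\<omega>. X \<omega> < - real n / 8)"
    by (intro P.whp_exp_tail Xm) auto
  then show ?thesis
  proof (rule whp_mono)
    have "(3 / 4 :: real) ^ n \<le> exp (- 1 / 4) ^ n"
      using exp_ge_add_one_self[of "- 1 / 4 :: real"] by (intro power_mono) auto
    also have "\<dots> = exp (- real n / 4)" by (simp flip: exp_of_nat_mult)
    finally have "(3 / 4 :: real) ^ n * exp (- (- real n / 8)) \<le> exp (- real n / 4) * exp (- (- real n / 8))" by simp
    also have "\<dots> = exp (- real n / 8)" by (simp flip: exp_add)
    finally show "(3 / 4 :: real) ^ n * exp (- (- real n / 8)) \<le> exp (- real n / 8)" .
    fix \<omega> assume "X \<omega> < - real n / 8"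
    moreover have "(\<Sum>i<n. b (\<omega> (Lab i))) = real (card {i. i < n \<and> \<omega> (Lab i) = j})"
      unfolding b_def by (simp add: sum.If_cases Int_def)
    ultimately show "real n / 8 \<le> real (card {i. i < n \<and> \<omega> (Lab i) = j})" by (simp add: X_def)
  qed
qed

text \<open>Union bound with a common failure probability \<zeta>. The constant 4 counts two label
  counts and two large initial components, 3n the three noise bounds per sample, and 4m the signal
  and norm bounds of the 2m filters.\<close>

lemma whp_good_sample:
  assumes \<sigma>0: "\<sigma>\<^sub>0 > 0" and d: "d \<ge> 1" and \<mu>: "vnorm d \<mu> > 0" and s: "s \<ge> 0"
    and \<zeta>: "exp (- real n / 8) \<le> \<zeta>" "exp (- real d / 2) \<le> \<zeta>" "4 * exp (- s / 2) \<le> \<zeta>" "exp (- real m / 20) \<le> \<zeta>"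
  shows "whp (train_space n m d \<sigma>\<^sub>0) ((4 + 3 * real n + real n * real n + 2 * real m * real n + 4 * real m) * \<zeta>)
     (good_sample n m d \<mu> \<sigma>\<^sub>0 s)"
proof -
  interpret real_product_prob "comp_dist \<sigma>\<^sub>0" "idx_set n m d" by (rule real_product_prob_comp_dist[OF \<sigma>0])
  let ?M = "PiM (idx_set n m d) (comp_dist \<sigma>\<^sub>0)"
  have "4 * exp (- s) \<le> 4 * exp (- s / 2)" using s by simp
  with \<zeta>(3) have \<zeta>5: "4 * exp (- s) \<le> \<zeta>" by linarith
  have \<zeta>0: "\<zeta> \<ge> 0" using \<zeta>(1) by (smt (verit) exp_gt_zero)
  have gN: "gaussian_coords (Noise i) d 1" if "i < n" for i
    unfolding gaussian_coords_def using that by (auto simp: inj_on_def idx_set_def comp_dist_def)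
  have gI: "gaussian_coords (Init j r) d \<sigma>\<^sub>0" if "j \<in> {-1, 1}" "r < m" for j r
    unfolding gaussian_coords_def using that \<sigma>0 by (auto simp: inj_on_def idx_set_def comp_dist_def)
  have 1: "whp ?M (real (card {..<n}) * 0) (\<lambda>\<omega>. \<forall>i\<in>{..<n}. \<omega> (Lab i) \<in> {-1, 1})"
    by (intro P.whp_ball P.whp_AE AE_label[OF \<sigma>0]) auto
  have 2: "whp ?M (real (card {-1, 1::int}) * \<zeta>)
     (\<lambda>\<omega>. \<forall>j\<in>{-1, 1::int}. real n / 8 \<le> real (card {i. i < n \<and> \<omega> (Lab i) = of_int j}))"
    by (intro P.whp_ball whp_mono[OF whp_label_count[OF \<sigma>0] \<zeta>(1)]) auto
  have 3: "whp ?M (real (card {..<n}) * \<zeta>) (\<lambda>\<omega>. \<forall>i\<in>{..<n}. (\<Sum>k<d. (\<omega> (Noise i k))\<^sup>2) \<le> 4 * 1\<^sup>2 * real d)"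
    by (intro P.whp_ball whp_mono[OF whp_square_le[OF gN] \<zeta>(2)]) auto
  have 4: "whp ?M (real (card {..<n}) * \<zeta>) (\<lambda>\<omega>. \<forall>i\<in>{..<n}. (\<Sum>k<d. (\<omega> (Noise i k))\<^sup>2) \<ge> 1\<^sup>2 * real d / 8)"
    by (intro P.whp_ball whp_mono[OF whp_square_ge[OF gN] \<zeta>(2)]) auto
  have 5: "whp ?M (real (card {..<n}) * \<zeta>) (\<lambda>\<omega>. \<forall>i\<in>{..<n}. \<bar>vinner d \<mu> (\<lambda>k. \<omega> (Noise i k))\<bar> \<le> 1 * vnorm d \<mu> * s)"
    by (intro P.whp_ball whp_mono[OF whp_linear_le[OF gN s] \<zeta>5]) auto
  have 6: "whp ?M (real (card ({..<n} \<times> {..<n})) * \<zeta>) (\<lambda>\<omega>. \<forall>x\<in>{..<n} \<times> {..<n}.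
       (case x of (i, l) \<Rightarrow> i \<noteq> l \<longrightarrow>
        \<bar>vinner d (\<lambda>k. \<omega> (Noise i k)) (\<lambda>k. \<omega> (Noise l k))\<bar> \<le> 1 * 1 * sqrt d * s))"
  proof (rule P.whp_ball)
    fix x assume "x \<in> {..<n} \<times> {..<n}"
    then obtain i l where x: "x = (i, l)" "i < n" "l < n" by auto
    show "whp ?M \<zeta> (\<lambda>\<omega>. case x of (i, l) \<Rightarrow> i \<noteq> l \<longrightarrow>
        \<bar>vinner d (\<lambda>k. \<omega> (Noise i k)) (\<lambda>k. \<omega> (Noise l k))\<bar> \<le> 1 * 1 * sqrt d * s)"
    proof (cases "i = l")
      case True
      then show ?thesis using x \<zeta>0 by (simp add: P.whp_True)
    next
      case False
      then have "whp ?M \<zeta> (\<lambda>\<omega>. \<bar>vinner d (\<lambda>k. \<omega> (Noise i k)) (\<lambda>k. \<omega> (Noise l k))\<bar> \<le> 1 * 1 * sqrt d * s)"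
        by (intro whp_mono[OF whp_bilinear_le[OF gN[OF x(2)] gN[OF x(3)] _ d] \<zeta>(3)]) auto
      then show ?thesis using x False by simp
    qed
  qed simp
  have 7: "whp ?M (real (card ({-1, 1::int} \<times> {..<m} \<times> {..<n})) * \<zeta>) (\<lambda>\<omega>. \<forall>x\<in>{-1, 1} \<times> {..<m} \<times> {..<n}.
       (case x of (j, r, i) \<Rightarrow>
        \<bar>vinner d (\<lambda>k. \<omega> (Init j r k)) (\<lambda>k. \<omega> (Noise i k))\<bar> \<le> \<sigma>\<^sub>0 * 1 * sqrt d * s))"
  proof (rule P.whp_ball)
    fix x :: "int \<times> nat \<times> nat" assume "x \<in> {-1, 1} \<times> {..<m} \<times> {..<n}"
    then obtain j r i where x: "x = (j, r, i)" "j \<in> {-1, 1}" "r < m" "i < n" by auto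
    have "whp ?M \<zeta> (\<lambda>\<omega>. \<bar>vinner d (\<lambda>k. \<omega> (Init j r k)) (\<lambda>k. \<omega> (Noise i k))\<bar> \<le> \<sigma>\<^sub>0 * 1 * sqrt d * s)"
      by (intro whp_mono[OF whp_bilinear_le[OF gI[OF x(2,3)] gN[OF x(4)] _ d] \<zeta>(3)]) auto
    then show "whp ?M \<zeta> (\<lambda>\<omega>. case x of (j, r, i) \<Rightarrow>
        \<bar>vinner d (\<lambda>k. \<omega> (Init j r k)) (\<lambda>k. \<omega> (Noise i k))\<bar> \<le> \<sigma>\<^sub>0 * 1 * sqrt d * s)" using x by simp
  qed simp
  have 8: "whp ?M (real (card ({-1, 1::int} \<times> {..<m})) * \<zeta>) (\<lambda>\<omega>. \<forall>x\<in>{-1, 1} \<times> {..<m}.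
       (case x of (j, r) \<Rightarrow> \<bar>vinner d \<mu> (\<lambda>k. \<omega> (Init j r k))\<bar> \<le> \<sigma>\<^sub>0 * vnorm d \<mu> * s))"
  proof (rule P.whp_ball)
    fix x :: "int \<times> nat" assume "x \<in> {-1, 1} \<times> {..<m}"
    then obtain j r where x: "x = (j, r)" "j \<in> {-1, 1}" "r < m" by auto
    have "whp ?M \<zeta> (\<lambda>\<omega>. \<bar>vinner d \<mu> (\<lambda>k. \<omega> (Init j r k))\<bar> \<le> \<sigma>\<^sub>0 * vnorm d \<mu> * s)"
      by (rule whp_mono[OF whp_linear_le[OF gI[OF x(2,3)] s] \<zeta>5])
    then show "whp ?M \<zeta> (\<lambda>\<omega>. case x of (j, r) \<Rightarrow> \<bar>vinner d \<mu> (\<lambda>k. \<omega> (Init j r k))\<bar> \<le> \<sigma>\<^sub>0 * vnorm d \<mu> * s)"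
      using x by simp
  qed simp
  have 9: "whp ?M (real (card ({-1, 1::int} \<times> {..<m})) * \<zeta>) (\<lambda>\<omega>. \<forall>x\<in>{-1, 1} \<times> {..<m}.
       (case x of (j, r) \<Rightarrow> (\<Sum>k<d. (\<omega> (Init j r k))\<^sup>2) \<le> 4 * \<sigma>\<^sub>0\<^sup>2 * real d))"
  proof (rule P.whp_ball)
    fix x :: "int \<times> nat" assume "x \<in> {-1, 1} \<times> {..<m}"
    then obtain j r where x: "x = (j, r)" "j \<in> {-1, 1}" "r < m" by auto
    have "whp ?M \<zeta> (\<lambda>\<omega>. (\<Sum>k<d. (\<omega> (Init j r k))\<^sup>2) \<le> 4 * \<sigma>\<^sub>0\<^sup>2 * real d)"
      by (rule whp_mono[OF whp_square_le[OF gI[OF x(2,3)]] \<zeta>(2)])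
    then show "whp ?M \<zeta> (\<lambda>\<omega>. case x of (j, r) \<Rightarrow> (\<Sum>k<d. (\<omega> (Init j r k))\<^sup>2) \<le> 4 * \<sigma>\<^sub>0\<^sup>2 * real d)"
      using x by simp
  qed simp
  have 10: "whp ?M (real (card {-1, 1::int}) * \<zeta>) (\<lambda>\<omega>. \<forall>j\<in>{-1, 1}. \<exists>r<m.
      vinner d (\<lambda>k. of_int j / (\<sigma>\<^sub>0 * vnorm d \<mu>) * \<mu> k) (\<lambda>k. \<omega> (Init j r k)) \<ge> 1 / 11)"
  proof (rule P.whp_ball)
    fix j :: int assume j: "j \<in> {-1, 1}"
    \<comment> \<open>Dividing by \<open>\<sigma>\<^sub>0 * vnorm d \<mu>\<close> makes the inner
      product with an initial filter standard normal, as \<open>whp_some_large\<close>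
      requires.\<close>
    have "(vnorm d (\<lambda>k. of_int j / (\<sigma>\<^sub>0 * vnorm d \<mu>) * \<mu> k))\<^sup>2 = (of_int j / (\<sigma>\<^sub>0 * vnorm d \<mu>))\<^sup>2 * (vnorm d \<mu>)\<^sup>2"
      unfolding vnorm_sq[of d "\<lambda>k. _ * \<mu> k"] vnorm_sq[of d \<mu>]
      by (simp add: vinner_def sum_distrib_left sum_divide_distrib power2_eq_square ac_simps)
    also have "\<dots> = (1 / \<sigma>\<^sub>0)\<^sup>2" using j \<mu> by (auto simp: power2_eq_square)
    finally have "vnorm d (\<lambda>k. of_int j / (\<sigma>\<^sub>0 * vnorm d \<mu>) * \<mu> k) = 1 / \<sigma>\<^sub>0"
      using \<sigma>0 vnorm_nonneg by (metis divide_nonneg_pos power2_eq_imp_eq zero_le_one)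
    then have u: "\<sigma>\<^sub>0 * vnorm d (\<lambda>k. of_int j / (\<sigma>\<^sub>0 * vnorm d \<mu>) * \<mu> k) = 1" using \<sigma>0 by simp
    show "whp ?M \<zeta> (\<lambda>\<omega>. \<exists>r<m. vinner d (\<lambda>k. of_int j / (\<sigma>\<^sub>0 * vnorm d \<mu>) * \<mu> k) (\<lambda>k. \<omega> (Init j r k)) \<ge> 1 / 11)"
      by (rule whp_mono[OF whp_some_large[of m "Init j", OF gI[OF j] u] \<zeta>(4)])
         (auto simp: disjoint_family_on_def)
  qed simp
  note all = P.whp_conj[OF 1 P.whp_conj[OF 2 P.whp_conj[OF 3 P.whp_conj[OF 4 P.whp_conj[OF 5
      P.whp_conj[OF 6 P.whp_conj[OF 7 P.whp_conj[OF 8 P.whp_conj[OF 9 10]]]]]]]]]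
  show ?thesis
    unfolding train_space_def
  proof (rule whp_mono[OF all])
    show "real (card {..<n}) * 0 + (real (card {-1, 1::int}) * \<zeta> + (real (card {..<n}) * \<zeta> +
       (real (card {..<n}) * \<zeta> + (real (card {..<n}) * \<zeta> + (real (card ({..<n} \<times> {..<n})) * \<zeta> +
       (real (card ({-1, 1::int} \<times> {..<m} \<times> {..<n})) * \<zeta> + (real (card ({-1, 1::int} \<times> {..<m})) * \<zeta> +
       (real (card ({-1, 1::int} \<times> {..<m})) * \<zeta> + real (card {-1, 1::int}) * \<zeta>))))))))
      \<le> (4 + 3 * real n + real n * real n + 2 * real m * real n + 4 * real m) * \<zeta>"
      by (simp add: card_cartesian_product algebra_simps)
  qed (unfold good_sample_def, assumption)
qed

section \<open>Expected loss on a fresh sample\<close>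

lemma test_exp_moment:
  shows "(\<integral>\<^sup>+\<omega>. ennreal (exp (L * (vinner d v (noise d \<mu> \<sigma>\<^sub>p \<omega> 0) - 1))) \<partial>data_space d)
    = ennreal (exp (L\<^sup>2 * \<sigma>\<^sub>p\<^sup>2 * vinner d (proj d \<mu> v) (proj d \<mu> v) / 2 - L))"
    and "(\<lambda>\<omega>. exp (L * (vinner d v (noise d \<mu> \<sigma>\<^sub>p \<omega> 0) - 1))) \<in> borel_measurable (data_space d)"
proof -
  interpret real_product_prob "comp_dist 1" "idx_set 1 0 d" by (rule real_product_prob_comp_dist) simp
  have g: "gaussian_coords (Noise 0) d 1"
    unfolding gaussian_coords_def by (auto simp: inj_on_def idx_set_def comp_dist_def)
  have e: "L * (vinner d v (noise d \<mu> \<sigma>\<^sub>p \<omega> 0) - 1) = vinner d (\<lambda>k. L * \<sigma>\<^sub>p * proj d \<mu> v k) (\<lambda>k. \<omega> (Noise 0 k)) - L" for \<omega>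
  proof -
    let ?g = "\<lambda>k. \<omega> (Noise 0 k)"
    have "vinner d v (noise d \<mu> \<sigma>\<^sub>p \<omega> 0) = \<sigma>\<^sub>p * vinner d (proj d \<mu> ?g) v"
      by (simp add: vinner_def noise_eq_proj sum_distrib_left ac_simps)
    \<comment> \<open>The projection is self-adjoint, so it moves from the noise to the weight and
      leaves a linear form in standard Gaussians.\<close>
    also have "vinner d (proj d \<mu> ?g) v = vinner d (proj d \<mu> v) ?g"
      unfolding vinner_proj by (simp add: vinner_commute mult.commute)
    finally show ?thesis by (simp add: vinner_def sum_distrib_left algebra_simps)
  qed
  have m: "(\<lambda>\<omega>. exp (vinner d (\<lambda>k. L * \<sigma>\<^sub>p * proj d \<mu> v k) (\<lambda>k. \<omega> (Noise 0 k)))) \<in> borel_measurable (data_space d)"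
    unfolding data_space_def by (rule measurable_compose[OF measurable_vinner[OF g] borel_measurable_exp])
  have "(\<integral>\<^sup>+\<omega>. ennreal (exp (L * (vinner d v (noise d \<mu> \<sigma>\<^sub>p \<omega> 0) - 1))) \<partial>data_space d)
     = (\<integral>\<^sup>+\<omega>. ennreal (exp (- L)) * ennreal (exp (vinner d (\<lambda>k. L * \<sigma>\<^sub>p * proj d \<mu> v k) (\<lambda>k. \<omega> (Noise 0 k)))) \<partial>data_space d)"
    unfolding e by (intro nn_integral_cong) (simp flip: ennreal_mult exp_add)
  also have "\<dots> = ennreal (exp (- L)) * (\<integral>\<^sup>+\<omega>. ennreal (exp (vinner d (\<lambda>k. L * \<sigma>\<^sub>p * proj d \<mu> v k) (\<lambda>k. \<omega> (Noise 0 k)))) \<partial>data_space d)"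
    by (rule nn_integral_cmult) (use m in measurable)
  also have "\<dots> = ennreal (exp (- L)) * ennreal (exp (1\<^sup>2 * (vnorm d (\<lambda>k. L * \<sigma>\<^sub>p * proj d \<mu> v k))\<^sup>2 / 2))"
    unfolding data_space_def mgf_linear[OF g] ..
  also have "(vnorm d (\<lambda>k. L * \<sigma>\<^sub>p * proj d \<mu> v k))\<^sup>2 = L\<^sup>2 * \<sigma>\<^sub>p\<^sup>2 * vinner d (proj d \<mu> v) (proj d \<mu> v)"
    unfolding vnorm_sq by (simp add: vinner_def sum_distrib_left power2_eq_square ac_simps)
  finally show "(\<integral>\<^sup>+\<omega>. ennreal (exp (L * (vinner d v (noise d \<mu> \<sigma>\<^sub>p \<omega> 0) - 1))) \<partial>data_space d)
    = ennreal (exp (L\<^sup>2 * \<sigma>\<^sub>p\<^sup>2 * vinner d (proj d \<mu> v) (proj d \<mu> v) / 2 - L))"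
    by (simp flip: ennreal_mult exp_add)
  show "(\<lambda>\<omega>. exp (L * (vinner d v (noise d \<mu> \<sigma>\<^sub>p \<omega> 0) - 1))) \<in> borel_measurable (data_space d)"
    unfolding e exp_diff by (intro borel_measurable_divide m borel_measurable_const)
qed

text \<open>Condition \<open>v\<close> makes the variance term in \<open>test_exp_moment\<close> at
  most L/2, so each filter contributes exp(-L/2); averaging over r leaves one such term for each of
  the two signs.\<close>

lemma test_loss_le:
  assumes m: "m \<ge> 1" and e: "e \<ge> 0"
    and le: "\<And>\<omega>. label \<omega> 0 \<in> {-1, 1} \<Longrightarrow> logloss (label \<omega> 0 * fnet d m q W (patches d \<mu> \<sigma>\<^sub>p \<omega> 0)) \<le> e +
      (1 / real m) * (\<Sum>j\<in>{-1,1}. \<Sum>r<m. exp (L * (vinner d (W j r) (noise d \<mu> \<sigma>\<^sub>p \<omega> 0) - 1)))"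
    and v: "\<And>j r. j \<in> {-1, 1} \<Longrightarrow> r < m \<Longrightarrow>
      L\<^sup>2 * \<sigma>\<^sub>p\<^sup>2 * vinner d (proj d \<mu> (W j r)) (proj d \<mu> (W j r)) \<le> L"
  shows "test_loss d m q \<mu> \<sigma>\<^sub>p W \<le> ennreal (e + 2 * exp (- L / 2))"
proof -
  interpret real_product_prob "comp_dist 1" "idx_set 1 0 d" by (rule real_product_prob_comp_dist) simp
  have mean: "ennreal e + ennreal (1 / real m) * (\<Sum>j\<in>{-1,1::int}. \<Sum>r<m. ennreal (f j r))
     = ennreal (e + (1 / real m) * (\<Sum>j\<in>{-1,1}. \<Sum>r<m. f j r))" if "\<And>j r. f j r \<ge> 0" for f
  proof -
    have "(\<Sum>j\<in>{-1,1::int}. \<Sum>r<m. ennreal (f j r)) = (\<Sum>j\<in>{-1,1::int}. ennreal (\<Sum>r<m. f j r))"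
      using that by (intro sum.cong refl sum_ennreal) auto
    also have "\<dots> = ennreal (\<Sum>j\<in>{-1,1::int}. \<Sum>r<m. f j r)"
      using that by (intro sum_ennreal sum_nonneg) auto
    finally have "ennreal (1 / real m) * (\<Sum>j\<in>{-1,1::int}. \<Sum>r<m. ennreal (f j r))
       = ennreal ((1 / real m) * (\<Sum>j\<in>{-1,1::int}. \<Sum>r<m. f j r))"
      using that by (simp only:) (intro ennreal_mult[symmetric] sum_nonneg, auto)
    moreover have "(1 / real m) * (\<Sum>j\<in>{-1,1::int}. \<Sum>r<m. f j r) \<ge> 0"
      using that by (intro mult_nonneg_nonneg sum_nonneg) auto
    ultimately show ?thesis using e by (simp only: ennreal_plus)
  qed
  let ?h = "\<lambda>j r \<omega>. exp (L * (vinner d (W j r) (noise d \<mu> \<sigma>\<^sub>p \<omega> 0) - 1))"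
  have hm: "?h j r \<in> borel_measurable (data_space d)" for j r by (rule test_exp_moment(2))
  have lab: "AE \<omega> in data_space d. \<omega> (Lab 0) \<in> {-1, 1}"
    unfolding data_space_def by (rule AE_label) auto
  have "test_loss d m q \<mu> \<sigma>\<^sub>p W \<le> (\<integral>\<^sup>+\<omega>. ennreal e + ennreal (1 / real m) * (\<Sum>j\<in>{-1,1}. \<Sum>r<m. ennreal (?h j r \<omega>)) \<partial>data_space d)"
    unfolding test_loss_def
  proof (rule nn_integral_mono_AE, use lab in eventually_elim)
    fix \<omega> :: "idx \<Rightarrow> real" assume l: "\<omega> (Lab 0) \<in> {-1, 1}"
    have "ennreal e + ennreal (1 / real m) * (\<Sum>j\<in>{-1,1}. \<Sum>r<m. ennreal (?h j r \<omega>))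
       = ennreal (e + (1 / real m) * (\<Sum>j\<in>{-1,1}. \<Sum>r<m. ?h j r \<omega>))"
      by (rule mean) simp
    then show "ennreal (logloss (label \<omega> 0 * fnet d m q W (patches d \<mu> \<sigma>\<^sub>p \<omega> 0)))
      \<le> ennreal e + ennreal (1 / real m) * (\<Sum>j\<in>{-1,1}. \<Sum>r<m. ennreal (?h j r \<omega>))"
      using le[of \<omega>] l by (simp only: label_def ennreal_leI)
  qed
  also have "\<dots> = ennreal e + ennreal (1 / real m) * (\<Sum>j\<in>{-1,1}. \<Sum>r<m. \<integral>\<^sup>+\<omega>. ennreal (?h j r \<omega>) \<partial>data_space d)"
  proof -
    note [measurable] = hm
    have "emeasure (data_space d) (space (data_space d)) = 1"
      unfolding data_space_def by (rule P.emeasure_space_1)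
    then show ?thesis
      by (simp add: nn_integral_add nn_integral_cmult nn_integral_sum del: ennreal_plus sum_ennreal)
  qed
  also have "\<dots> \<le> ennreal e + ennreal (1 / real m) * (\<Sum>j\<in>{-1,1::int}. \<Sum>r<m. ennreal (exp (- L / 2)))"
  proof (intro add_left_mono mult_left_mono sum_mono)
    fix j :: int and r assume "j \<in> {-1, 1}" "r \<in> {..<m}"
    then have "L\<^sup>2 * \<sigma>\<^sub>p\<^sup>2 * vinner d (proj d \<mu> (W j r)) (proj d \<mu> (W j r)) \<le> L" using v by simp
    then show "(\<integral>\<^sup>+\<omega>. ennreal (?h j r \<omega>) \<partial>data_space d) \<le> ennreal (exp (- L / 2))"
      unfolding test_exp_moment(1) by (intro ennreal_leI) simp
  qed simp
  also have "\<dots> = ennreal (e + (1 / real m) * (\<Sum>j\<in>{-1,1::int}. \<Sum>r<m. exp (- L / 2)))"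
    by (rule mean) simp
  also have "(1 / real m) * (\<Sum>j\<in>{-1,1::int}. \<Sum>r<m. exp (- L / 2)) = 2 * exp (- L / 2)"
    using m by simp
  finally show ?thesis .
qed

section \<open>Proof of the theorem\<close>

text \<open>Meant for b = |\<mu>|: it bounds the correction that projecting away \<mu> subtracts
  from an inner product.\<close>

lemma abs_mult_div_le:
  fixes x y b c s :: real
  assumes "\<bar>x\<bar> \<le> b * s" "\<bar>y\<bar> \<le> c * b * s" "b > 0"
  shows "\<bar>x * y / b\<^sup>2\<bar> \<le> c * s\<^sup>2"
proof -
  have "\<bar>x\<bar> * \<bar>y\<bar> \<le> (b * s) * (c * b * s)"
    using assms order_trans[OF abs_ge_zero assms(1)] by (intro mult_mono) auto
  also have "\<dots> = c * s\<^sup>2 * b\<^sup>2" by (simp add: power2_eq_square)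
  finally show ?thesis using assms(3) by (simp add: abs_mult field_simps)
qed

text \<open>Projecting away \<mu> changes inner products by terms of order s^2, with an extra
  \<open>\<sigma>\<^sub>0\<close> for weights. Since 64 s \<le> sqrt d, these are below d/16 and
  below s sqrt d, so the bounds for the unprojected Gaussians survive up to a factor 2.\<close>

lemma
  assumes good: "good_sample n m d \<mu> \<sigma>\<^sub>0 s \<omega>" and \<mu>: "vnorm d \<mu> > 0" and \<sigma>p: "\<sigma>\<^sub>p > 0" and \<sigma>0: "\<sigma>\<^sub>0 > 0"
    and s: "s \<ge> 1" "64 * real n * s \<le> sqrt d" and n: "n \<ge> 1"
  shows good_noise_sq_ge: "\<And>i. i < n \<Longrightarrow> \<sigma>\<^sub>p\<^sup>2 * d / 16 \<le> (vnorm d (noise d \<mu> \<sigma>\<^sub>p \<omega> i))\<^sup>2"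
    and good_noise_sq_le: "\<And>i. i < n \<Longrightarrow> (vnorm d (noise d \<mu> \<sigma>\<^sub>p \<omega> i))\<^sup>2 \<le> 4 * \<sigma>\<^sub>p\<^sup>2 * d"
    and good_noise_cross: "\<And>i l. i < n \<Longrightarrow> l < n \<Longrightarrow> i \<noteq> l \<Longrightarrow>
        \<bar>vinner d (noise d \<mu> \<sigma>\<^sub>p \<omega> i) (noise d \<mu> \<sigma>\<^sub>p \<omega> l)\<bar> \<le> 2 * \<sigma>\<^sub>p\<^sup>2 * sqrt d * s"
    and good_init_noise: "\<And>j r i. j \<in> {-1, 1} \<Longrightarrow> r < m \<Longrightarrow> i < n \<Longrightarrow>
        \<bar>vinner d (init_weights \<omega> j r) (noise d \<mu> \<sigma>\<^sub>p \<omega> i)\<bar> \<le> 2 * s * \<sigma>\<^sub>0 * \<sigma>\<^sub>p * sqrt d"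
proof -
  define g where "g i = (\<lambda>k. \<omega> (Noise i k))" for i
  have \<xi>: "noise d \<mu> \<sigma>\<^sub>p \<omega> i = (\<lambda>k. \<sigma>\<^sub>p * proj d \<mu> (g i) k)" for i
    by (rule ext) (simp add: noise_eq_proj g_def)
  have sc: "vinner d (\<lambda>k. c * u k) v = c * vinner d u v" for c u v
    by (simp add: vinner_def sum_distrib_left mult.assoc)
  have "64 * (1 * s) \<le> 64 * (real n * s)" using n s by (intro mult_left_mono mult_right_mono) auto
  then have s4: "64 * s \<le> sqrt d" using s(2) by simp
  then have "(64 * s) * s \<le> sqrt d * s" using s by (intro mult_right_mono) auto
  then have ssd: "s\<^sup>2 \<le> s * sqrt d" using s(1) by (simp add: power2_eq_square mult.commute)
  have "(64 * s) * (64 * s) \<le> sqrt d * sqrt d" using s s4 by (intro mult_mono) auto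
  then have s2: "4096 * s\<^sup>2 \<le> d" by (simp add: power2_eq_square)
  have g\<mu>: "\<bar>vinner d (g i) \<mu>\<bar> \<le> vnorm d \<mu> * s" if "i < n" for i
    using good that by (auto simp: good_sample_def g_def vinner_commute[of d _ \<mu>])
  have gg: "vinner d (g i) (g i) = (\<Sum>k<d. (\<omega> (Noise i k))\<^sup>2)" for i
    by (simp add: vinner_def g_def power2_eq_square)
  have sq: "(vnorm d (noise d \<mu> \<sigma>\<^sub>p \<omega> i))\<^sup>2 = \<sigma>\<^sub>p\<^sup>2 * (vinner d (g i) (g i) - vinner d (g i) \<mu> * vinner d (g i) \<mu> / (vnorm d \<mu>)\<^sup>2)" for i
    unfolding vnorm_sq[of d "noise d \<mu> \<sigma>\<^sub>p \<omega> i"]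
    unfolding \<xi> sc vinner_scale_right vinner_proj_proj[OF \<mu>] by (simp add: power2_eq_square)
  {
    fix i assume i: "i < n"
    have lo: "vinner d (g i) (g i) \<ge> real d / 8" and hi: "vinner d (g i) (g i) \<le> 4 * real d"
      unfolding gg using good i by (auto simp: good_sample_def)
    have "\<bar>vinner d (g i) \<mu> * vinner d (g i) \<mu> / (vnorm d \<mu>)\<^sup>2\<bar> \<le> 1 * s\<^sup>2"
      using g\<mu>[OF i] \<mu> by (intro abs_mult_div_le) auto
    moreover have "vinner d (g i) \<mu> * vinner d (g i) \<mu> / (vnorm d \<mu>)\<^sup>2 \<ge> 0" by simp
    ultimately have "real d / 16 \<le> vinner d (g i) (g i) - vinner d (g i) \<mu> * vinner d (g i) \<mu> / (vnorm d \<mu>)\<^sup>2"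
      "vinner d (g i) (g i) - vinner d (g i) \<mu> * vinner d (g i) \<mu> / (vnorm d \<mu>)\<^sup>2 \<le> 4 * real d"
      using lo hi s2 by linarith+
    then have "\<sigma>\<^sub>p\<^sup>2 * (real d / 16) \<le> (vnorm d (noise d \<mu> \<sigma>\<^sub>p \<omega> i))\<^sup>2" "(vnorm d (noise d \<mu> \<sigma>\<^sub>p \<omega> i))\<^sup>2 \<le> \<sigma>\<^sub>p\<^sup>2 * (4 * real d)"
      unfolding sq by (intro mult_left_mono; simp)+
    then show "\<sigma>\<^sub>p\<^sup>2 * d / 16 \<le> (vnorm d (noise d \<mu> \<sigma>\<^sub>p \<omega> i))\<^sup>2" "(vnorm d (noise d \<mu> \<sigma>\<^sub>p \<omega> i))\<^sup>2 \<le> 4 * \<sigma>\<^sub>p\<^sup>2 * d"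
      by (simp_all add: ac_simps)
  }
  {
    fix i l assume il: "i < n" "l < n" "i \<noteq> l"
    have 1: "\<bar>vinner d (g i) (g l)\<bar> \<le> sqrt d * s"
      using good il by (auto simp: good_sample_def g_def)
    have 2: "\<bar>vinner d (g i) \<mu> * vinner d (g l) \<mu> / (vnorm d \<mu>)\<^sup>2\<bar> \<le> 1 * s\<^sup>2"
      using g\<mu>[OF il(1)] g\<mu>[OF il(2)] \<mu> by (intro abs_mult_div_le) auto
    have "\<bar>vinner d (g i) (g l) - vinner d (g i) \<mu> * vinner d (g l) \<mu> / (vnorm d \<mu>)\<^sup>2\<bar> \<le> 2 * sqrt d * s"
    proof -
      have "s\<^sup>2 \<le> sqrt d * s" using ssd by (simp add: mult.commute)
      with 1 2 show ?thesis by linarith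
    qed
    then have "\<sigma>\<^sub>p\<^sup>2 * \<bar>vinner d (g i) (g l) - vinner d (g i) \<mu> * vinner d (g l) \<mu> / (vnorm d \<mu>)\<^sup>2\<bar> \<le> \<sigma>\<^sub>p\<^sup>2 * (2 * sqrt d * s)"
      by (intro mult_left_mono) auto
    moreover have "vinner d (noise d \<mu> \<sigma>\<^sub>p \<omega> i) (noise d \<mu> \<sigma>\<^sub>p \<omega> l)
        = \<sigma>\<^sub>p\<^sup>2 * (vinner d (g i) (g l) - vinner d (g i) \<mu> * vinner d (g l) \<mu> / (vnorm d \<mu>)\<^sup>2)"
      unfolding \<xi> sc vinner_scale_right vinner_proj_proj[OF \<mu>] by (simp add: power2_eq_square)
    ultimately show "\<bar>vinner d (noise d \<mu> \<sigma>\<^sub>p \<omega> i) (noise d \<mu> \<sigma>\<^sub>p \<omega> l)\<bar> \<le> 2 * \<sigma>\<^sub>p\<^sup>2 * sqrt d * s"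
      by (simp add: abs_mult ac_simps)
  }
  {
    fix j :: int and r i assume j: "j \<in> {-1, 1}" and r: "r < m" and i: "i < n"
    let ?w = "init_weights \<omega> j r"
    have 1: "\<bar>vinner d ?w (g i)\<bar> \<le> \<sigma>\<^sub>0 * (s * sqrt d)"
      using good j r i by (auto simp: good_sample_def g_def init_weights_def mult.commute mult.left_commute)
    have w: "\<bar>vinner d ?w \<mu>\<bar> \<le> \<sigma>\<^sub>0 * vnorm d \<mu> * s"
      using good j r by (auto simp: good_sample_def init_weights_def vinner_commute[of d _ \<mu>])
    have 2: "\<bar>vinner d (g i) \<mu> * vinner d ?w \<mu> / (vnorm d \<mu>)\<^sup>2\<bar> \<le> \<sigma>\<^sub>0 * s\<^sup>2"
      using g\<mu>[OF i] w \<mu> by (intro abs_mult_div_le) auto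
    have 3: "\<sigma>\<^sub>0 * s\<^sup>2 \<le> \<sigma>\<^sub>0 * (s * sqrt d)" using ssd \<sigma>0 by (intro mult_left_mono) auto
    have "\<bar>vinner d ?w (g i) - vinner d (g i) \<mu> * vinner d ?w \<mu> / (vnorm d \<mu>)\<^sup>2\<bar> \<le> 2 * (\<sigma>\<^sub>0 * (s * sqrt d))"
      using 1 2 3 by linarith
    then have "\<sigma>\<^sub>p * \<bar>vinner d ?w (g i) - vinner d (g i) \<mu> * vinner d ?w \<mu> / (vnorm d \<mu>)\<^sup>2\<bar> \<le> \<sigma>\<^sub>p * (2 * (\<sigma>\<^sub>0 * (s * sqrt d)))"
      using \<sigma>p by (intro mult_left_mono) auto
    moreover have "vinner d ?w (noise d \<mu> \<sigma>\<^sub>p \<omega> i) = \<sigma>\<^sub>p * (vinner d ?w (g i) - vinner d (g i) \<mu> * vinner d ?w \<mu> / (vnorm d \<mu>)\<^sup>2)"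
      unfolding \<xi> vinner_scale_right vinner_commute[of d ?w "proj d \<mu> (g i)"] vinner_proj
      by (simp add: vinner_commute[of d "g i" ?w])
    ultimately show "\<bar>vinner d ?w (noise d \<mu> \<sigma>\<^sub>p \<omega> i)\<bar> \<le> 2 * s * \<sigma>\<^sub>0 * \<sigma>\<^sub>p * sqrt d"
      using \<sigma>p by (simp add: abs_mult ac_simps)
  }
qed

text \<open>The choices are \<beta> = 2 s \<open>\<sigma>\<^sub>0 \<sigma>\<^sub>p\<close> sqrt d
  and \<alpha> = \<open>\<sigma>\<^sub>0\<close> |\<mu>| / 11, whose ratio is 22 s / SNR. This ratio
  is the origin of the factor \<open>(22 * s) powr (q - 2)\<close> in \<open>snr\<close>.\<close>

lemma good_sample_cnn_training:
  assumes good: "good_sample n m d \<mu> \<sigma>\<^sub>0 s \<omega>" and \<mu>: "vnorm d \<mu> > 0" and \<sigma>p: "\<sigma>\<^sub>p > 0" and \<sigma>0: "\<sigma>\<^sub>0 > 0"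
    and s: "s \<ge> 1" "64 * real n * s \<le> sqrt d" and n: "n \<ge> 1" and m: "m \<ge> 1" and q: "q > 2" and \<eta>: "\<eta> > 0"
    and small1: "\<sigma>\<^sub>0 * vnorm d \<mu> * s \<le> 1/2" and small2: "6 * s * \<sigma>\<^sub>0 * \<sigma>\<^sub>p * sqrt d \<le> 1"
    and \<eta>2: "exp 2 * q * \<eta> * (vnorm d \<mu>)\<^sup>2 \<le> 1"
    and snr: "32 * exp 3 * track_const q * 3 powr (q - 1) * (22 * s) powr (q - 2)
        \<le> real n * (vnorm d \<mu> / (\<sigma>\<^sub>p * sqrt d)) powr q"
  shows "cnn_training d n m q \<sigma>\<^sub>p \<eta> (2 * s * \<sigma>\<^sub>0 * \<sigma>\<^sub>p * sqrt d) (\<sigma>\<^sub>0 * vnorm d \<mu> / 11) \<mu> \<omega>"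
proof
  note G = good \<mu> \<sigma>p \<sigma>0 s n
  have "sqrt d > 0" using s n by (smt (verit) mult_pos_pos of_nat_0_less_iff less_le_trans zero_less_one)
  then have d: "d > 0" by simp
  have D: "\<sigma>\<^sub>p\<^sup>2 * d / 16 > 0" using \<sigma>p d by simp
  let ?\<xi> = "noise d \<mu> \<sigma>\<^sub>p \<omega>"
  show "label \<omega> i \<in> {-1, 1}" if "i < n" for i
    using good that by (auto simp: good_sample_def label_def)
  show "real (card {i. i < n \<and> label \<omega> i = of_int j}) \<ge> real n / 8" if "j \<in> {-1, 1}" for j :: int
    using good that by (auto simp: good_sample_def label_def)
  show "vinner d (?\<xi> i) \<mu> = 0" if "i < n" for i
  proof -
    have "vinner d (?\<xi> i) \<mu> = \<sigma>\<^sub>p * vinner d (proj d \<mu> (\<lambda>k. \<omega> (Noise i k))) \<mu>"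
      by (simp add: vinner_def noise_eq_proj sum_distrib_left mult.assoc)
    then show ?thesis using vinner_proj_\<mu>[OF \<mu>] by simp
  qed
  show "vnorm d (?\<xi> i) > 0" if "i < n" for i
    using good_noise_sq_ge[OF G that] D vnorm_nonneg[of d "?\<xi> i"]
    by (smt (verit) zero_eq_power2 zero_less_power2)
  show "(vnorm d (?\<xi> i))\<^sup>2 \<le> 4 * \<sigma>\<^sub>p\<^sup>2 * d" if "i < n" for i by (rule good_noise_sq_le[OF G that])
  show "(\<Sum>i\<in>{..<n}-{l}. \<bar>vinner d (?\<xi> i) (?\<xi> l)\<bar> / (vnorm d (?\<xi> i))\<^sup>2) \<le> 1/2" if l: "l < n" for l
  proof -
    have "(\<Sum>i\<in>{..<n}-{l}. \<bar>vinner d (?\<xi> i) (?\<xi> l)\<bar> / (vnorm d (?\<xi> i))\<^sup>2)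
       \<le> (\<Sum>i\<in>{..<n}-{l}. (2 * \<sigma>\<^sub>p\<^sup>2 * sqrt d * s) / (\<sigma>\<^sub>p\<^sup>2 * d / 16))"
      using good_noise_cross[OF G _ l] good_noise_sq_ge[OF G] D \<sigma>p s
      by (intro sum_mono frac_le) auto
    also have "\<dots> = real (card ({..<n}-{l})) * (32 * s / sqrt d)"
      using \<sigma>p d by (simp add: field_simps)
    also have "\<dots> \<le> real n * (32 * s / sqrt d)"
      using card_mono[of "{..<n}" "{..<n}-{l}"] s by (intro mult_right_mono) auto
    \<comment> \<open>Each of the fewer than n summands was bounded by 32 s / sqrt d; the factor 64
      in the hypothesis on s is spent here.\<close>
    also have "\<dots> \<le> 1/2" using s(2) d by (simp add: field_simps)
    finally show ?thesis .
  qed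
  show "\<bar>vinner d (init_weights \<omega> j r) (?\<xi> i)\<bar> \<le> 2 * s * \<sigma>\<^sub>0 * \<sigma>\<^sub>p * sqrt d"
    if "j \<in> {-1, 1}" "r < m" "i < n" for j r i by (rule good_init_noise[OF G that])
  show "\<bar>vinner d (init_weights \<omega> j r) \<mu>\<bar> \<le> 1/2" if "j \<in> {-1, 1}" "r < m" for j r
  proof -
    have "\<bar>vinner d (init_weights \<omega> j r) \<mu>\<bar> \<le> \<sigma>\<^sub>0 * vnorm d \<mu> * s"
      using good that by (auto simp: good_sample_def init_weights_def vinner_commute[of d _ \<mu>])
    then show ?thesis using small1 by simp
  qed
  show "\<exists>r<m. of_int j * vinner d (init_weights \<omega> j r) \<mu> \<ge> \<sigma>\<^sub>0 * vnorm d \<mu> / 11" if j: "j \<in> {-1, 1}" for j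
  proof -
    obtain r where r: "r < m" "vinner d (\<lambda>k. of_int j / (\<sigma>\<^sub>0 * vnorm d \<mu>) * \<mu> k) (\<lambda>k. \<omega> (Init j r k)) \<ge> 1 / 11"
    proof -
      have "\<forall>j\<in>{-1, 1::int}. \<exists>r<m. vinner d (\<lambda>k. of_int j / (\<sigma>\<^sub>0 * vnorm d \<mu>) * \<mu> k) (\<lambda>k. \<omega> (Init j r k)) \<ge> 1 / 11"
        using good unfolding good_sample_def by (elim conjE)
      from bspec[OF this j] show ?thesis using that by blast
    qed
    have e: "vinner d (\<lambda>k. of_int j / (\<sigma>\<^sub>0 * vnorm d \<mu>) * \<mu> k) (\<lambda>k. \<omega> (Init j r k))
       = of_int j * vinner d (init_weights \<omega> j r) \<mu> / (\<sigma>\<^sub>0 * vnorm d \<mu>)"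
      by (simp add: vinner_def init_weights_def sum_distrib_left sum_divide_distrib ac_simps)
    from r(2) have "of_int j * vinner d (init_weights \<omega> j r) \<mu> \<ge> \<sigma>\<^sub>0 * vnorm d \<mu> / 11"
      unfolding e using \<sigma>0 \<mu> by (simp add: field_simps)
    then show ?thesis using r(1) by blast
  qed
  show "\<sigma>\<^sub>0 * vnorm d \<mu> / 11 > 0" using \<sigma>0 \<mu> by simp
  show "3 * (2 * s * \<sigma>\<^sub>0 * \<sigma>\<^sub>p * sqrt d) \<le> 1" using small2 by simp
  show "4 * \<sigma>\<^sub>p\<^sup>2 * d / (real n * (vnorm d \<mu>)\<^sup>2) * (3 * (2 * s * \<sigma>\<^sub>0 * \<sigma>\<^sub>p * sqrt d)) powr (q - 1) * (8 * exp 3) *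
      (track_const q * (\<sigma>\<^sub>0 * vnorm d \<mu> / 11) powr (-(q - 2))) \<le> 2 * s * \<sigma>\<^sub>0 * \<sigma>\<^sub>p * sqrt d"
  proof -
    define \<beta> where "\<beta> = 2 * s * \<sigma>\<^sub>0 * \<sigma>\<^sub>p * sqrt d"
    define \<alpha> where "\<alpha> = \<sigma>\<^sub>0 * vnorm d \<mu> / 11"
    \<comment> \<open>The inverse of SNR. Splitting off one factor \<beta> leaves the power q-2 of
      \<beta>/\<alpha>, and the prefactor supplies the x^2 that completes x^q.\<close>
    define x where "x = \<sigma>\<^sub>p * sqrt d / vnorm d \<mu>"
    have pos: "\<beta> > 0" "\<alpha> > 0" "x > 0" using s \<sigma>0 \<sigma>p d \<mu> by (auto simp: \<beta>_def \<alpha>_def x_def)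
    have ba: "\<beta> / \<alpha> = 22 * s * x" using \<sigma>0 \<mu> by (simp add: \<beta>_def \<alpha>_def x_def field_simps)
    have "vnorm d \<mu> / (\<sigma>\<^sub>p * sqrt d) = 1 / x" by (simp add: x_def)
    then have "real n * (vnorm d \<mu> / (\<sigma>\<^sub>p * sqrt d)) powr q = real n / x powr q"
      using pos(3) by (simp add: powr_divide)
    with snr have "32 * exp 3 * track_const q * 3 powr (q - 1) * (22 * s) powr (q - 2) \<le> real n / x powr q"
      by (simp only:)
    then have snr': "32 * exp 3 * track_const q * 3 powr (q - 1) * (22 * s) powr (q - 2) * x powr q \<le> real n"
      using pos(3) by (subst (asm) pos_le_divide_eq) auto
    have "\<beta> powr (q - 1) = \<beta> * \<beta> powr (q - 2)"
      using powr_add[of \<beta> 1 "q - 2"] pos by simp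
    moreover have "\<beta> powr (q - 2) * \<alpha> powr (-(q - 2)) = (22 * s) powr (q - 2) * x powr (q - 2)"
    proof -
      have "\<beta> powr (q - 2) * \<alpha> powr (-(q - 2)) = (\<beta> / \<alpha>) powr (q - 2)"
        unfolding powr_minus_divide using pos by (simp add: powr_divide)
      also have "\<dots> = (22 * s) powr (q - 2) * x powr (q - 2)"
        unfolding ba by (rule powr_mult)
      finally show ?thesis .
    qed
    ultimately have b: "\<beta> powr (q - 1) * \<alpha> powr (-(q - 2)) = \<beta> * ((22 * s) powr (q - 2) * x powr (q - 2))"
      by (simp add: mult.assoc)
    have xx: "x powr q = x\<^sup>2 * x powr (q - 2)"
      using powr_add[of x 2 "q - 2"] pos by simp
    have x2: "\<sigma>\<^sub>p\<^sup>2 * d / (vnorm d \<mu>)\<^sup>2 = x\<^sup>2" by (simp add: x_def power_divide power_mult_distrib)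
    have "4 * \<sigma>\<^sub>p\<^sup>2 * d / (real n * (vnorm d \<mu>)\<^sup>2) * (3 * \<beta>) powr (q - 1) * (8 * exp 3) * (track_const q * \<alpha> powr (-(q - 2)))
       = 32 * exp 3 * track_const q * 3 powr (q - 1) * (\<sigma>\<^sub>p\<^sup>2 * d / (vnorm d \<mu>)\<^sup>2) * (\<beta> powr (q - 1) * \<alpha> powr (-(q - 2))) / real n"
      using pos by (simp add: powr_mult ac_simps)
    also have "\<dots> = \<beta> * (32 * exp 3 * track_const q * 3 powr (q - 1) * (22 * s) powr (q - 2) * x powr q) / real n"
      unfolding b x2 xx by (simp add: ac_simps)
    also have "\<dots> \<le> \<beta> * real n / real n"
      using snr' pos by (intro divide_right_mono mult_left_mono) auto
    also have "\<dots> = \<beta>" using n by simp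
    finally show ?thesis unfolding \<beta>_def \<alpha>_def .
  qed
qed (use assms in auto)

text \<open>The test loss takes the rate L = 4 n^2, which must be at least q (\<open>nq\<close>) and
  needs a variance of at most 1/L. The latter comes from \<open>small3\<close>, whose square bounds
  36 n^2 \<open>\<sigma>\<^sub>0\<^sup>2 * \<sigma>\<^sub>p\<^sup>2 * d\<close> by 1.\<close>

lemma good_sample_conclusion:
  assumes good: "good_sample n m d \<mu> \<sigma>\<^sub>0 s \<omega>" and \<mu>: "vnorm d \<mu> > 0" and \<sigma>p: "\<sigma>\<^sub>p > 0" and \<sigma>0: "\<sigma>\<^sub>0 > 0"
    and s: "s \<ge> 1" "64 * real n * s \<le> sqrt d" and n: "n \<ge> 1" and m: "m \<ge> 1" and q: "q > 2" and \<eta>: "\<eta> > 0"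
    and small1: "\<sigma>\<^sub>0 * vnorm d \<mu> * s \<le> 1/2" and small2: "6 * s * \<sigma>\<^sub>0 * \<sigma>\<^sub>p * sqrt d \<le> 1"
    and \<eta>2: "exp 2 * q * \<eta> * (vnorm d \<mu>)\<^sup>2 \<le> 1"
    and snr: "32 * exp 3 * track_const q * 3 powr (q - 1) * (22 * s) powr (q - 2)
        \<le> real n * (vnorm d \<mu> / (\<sigma>\<^sub>p * sqrt d)) powr q"
    and small3: "6 * real n * (\<sigma>\<^sub>0 * \<sigma>\<^sub>p * sqrt d) \<le> 1" and nq: "4 * (real n)\<^sup>2 \<ge> q"
    and T: "T = T1 + T2" and e: "0 < e" "e \<le> 1"
    and T1: "real T1 * (\<eta> * q * (vnorm d \<mu>)\<^sup>2 / real m)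
       > 16 * exp 2 * (track_const q * (\<sigma>\<^sub>0 * vnorm d \<mu> / 11) powr (-(q - 2)))"
    and T2: "real T2 * (\<eta> * q * (vnorm d \<mu>)\<^sup>2 / real m) * e > 16 * exp 3 * track_const q"
  defines "W \<equiv> gd_iter d m q n \<mu> \<sigma>\<^sub>p \<eta> \<omega> T"
  shows "\<And>j. j \<in> {-1, 1} \<Longrightarrow> Max ((\<lambda>r. gamma_coeff d n \<mu> \<sigma>\<^sub>p \<omega> W j r) ` {..<m}) \<ge> 1 / 2"
    and "\<And>j r i. j \<in> {-1, 1} \<Longrightarrow> r < m \<Longrightarrow> i < n \<Longrightarrow>
       \<bar>rho_coeff d n \<mu> \<sigma>\<^sub>p \<omega> W j r i\<bar> \<le> 2 * s * \<sigma>\<^sub>0 * \<sigma>\<^sub>p * sqrt d"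
    and "train_loss d m q n \<mu> \<sigma>\<^sub>p \<omega> W \<le> e"
    and "test_loss d m q \<mu> \<sigma>\<^sub>p W \<le> ennreal (e + exp (- (real n)\<^sup>2))"
proof -
  define \<beta> where "\<beta> = 2 * s * \<sigma>\<^sub>0 * \<sigma>\<^sub>p * sqrt d"
  interpret cnn_training d n m q \<sigma>\<^sub>p \<eta> \<beta> "\<sigma>\<^sub>0 * vnorm d \<mu> / 11" \<mu> \<omega>
    unfolding \<beta>_def
    by (rule good_sample_cnn_training[OF good \<mu> \<sigma>p \<sigma>0 s n m q \<eta> small1 small2 \<eta>2 snr])
  note res = training_result[OF T1[folded a_def] e T2[folded a_def] T]
  show "\<And>j. j \<in> {-1, 1} \<Longrightarrow> Max ((\<lambda>r. gamma_coeff d n \<mu> \<sigma>\<^sub>p \<omega> W j r) ` {..<m}) \<ge> 1 / 2"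
    "\<And>j r i. j \<in> {-1, 1} \<Longrightarrow> r < m \<Longrightarrow> i < n \<Longrightarrow>
       \<bar>rho_coeff d n \<mu> \<sigma>\<^sub>p \<omega> W j r i\<bar> \<le> 2 * s * \<sigma>\<^sub>0 * \<sigma>\<^sub>p * sqrt d"
    "train_loss d m q n \<mu> \<sigma>\<^sub>p \<omega> W \<le> e"
    unfolding W_def using res by (auto simp: \<beta>_def)
  have n1: "real n \<ge> 1" using n by simp
  have "sqrt d > 0" using s n1 by (smt (verit) mult_pos_pos)
  then have d: "d > 0" by simp
  define \<psi> where "\<psi> = \<sigma>\<^sub>0\<^sup>2 * \<sigma>\<^sub>p\<^sup>2 * real d"
  have "(6 * real n * (\<sigma>\<^sub>0 * \<sigma>\<^sub>p * sqrt d))\<^sup>2 \<le> 1"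
    using small3 \<sigma>0 \<sigma>p by (intro power_le_one) auto
  then have \<psi>: "36 * (real n)\<^sup>2 * \<psi> \<le> 1" by (simp add: \<psi>_def power_mult_distrib ac_simps)
  have "(64 * real n * s) * (64 * real n * s) \<le> sqrt d * sqrt d" using s by (intro mult_mono) auto
  then have "4096 * (real n * (real n * s\<^sup>2)) \<le> d" by (simp add: power2_eq_square ac_simps)
  moreover have "1 * (real n * s\<^sup>2) \<le> real n * (real n * s\<^sup>2)" using n1 by (intro mult_right_mono) auto
  \<comment> \<open>This keeps the trained part of a projected weight below
    \<open>\<sigma>\<^sub>0\<^sup>2 * d\<close>; with 8 times that for the initial part, the square
    norm is at most 9 times it.\<close>
  ultimately have ns: "192 * real n * s\<^sup>2 \<le> d" by simp
  have v: "(4 * (real n)\<^sup>2)\<^sup>2 * \<sigma>\<^sub>p\<^sup>2 * vinner d (proj d \<mu> (W j r)) (proj d \<mu> (W j r)) \<le> 4 * (real n)\<^sup>2"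
    if j: "j \<in> {-1, 1}" and r: "r < m" for j r
  proof -
    let ?p = "vinner d (proj d \<mu> (W j r)) (proj d \<mu> (W j r))"
    have "(vnorm d (init_weights \<omega> j r))\<^sup>2 = (\<Sum>k<d. (\<omega> (Init j r k))\<^sup>2)"
      unfolding vnorm_sq by (simp add: vinner_def init_weights_def power2_eq_square)
    also have "\<dots> \<le> 4 * \<sigma>\<^sub>0\<^sup>2 * d" using good j r by (auto simp: good_sample_def)
    finally have w: "(vnorm d (init_weights \<omega> j r))\<^sup>2 \<le> 4 * \<sigma>\<^sub>0\<^sup>2 * d" .
    have "?p \<le> 2 * (vnorm d (init_weights \<omega> j r))\<^sup>2 + 3 * real n * \<beta>\<^sup>2 / (\<sigma>\<^sub>p\<^sup>2 * d / 16)"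
      unfolding W_def using \<sigma>p d good_noise_sq_ge[OF good \<mu> \<sigma>p \<sigma>0 s n] by (intro proj_W_sq_le j r) auto
    also have "\<dots> \<le> 2 * (4 * \<sigma>\<^sub>0\<^sup>2 * d) + 3 * real n * \<beta>\<^sup>2 / (\<sigma>\<^sub>p\<^sup>2 * d / 16)"
      by (intro add_right_mono mult_left_mono w) simp
    also have "3 * real n * \<beta>\<^sup>2 / (\<sigma>\<^sub>p\<^sup>2 * d / 16) = \<sigma>\<^sub>0\<^sup>2 * (192 * real n * s\<^sup>2)"
      using \<sigma>p d by (simp add: \<beta>_def power_mult_distrib field_simps)
    also have "\<dots> \<le> \<sigma>\<^sub>0\<^sup>2 * d" by (intro mult_left_mono ns) simp
    finally have "?p \<le> 9 * \<sigma>\<^sub>0\<^sup>2 * d" by (simp add: mult.commute)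
    then have "(4 * (real n)\<^sup>2)\<^sup>2 * \<sigma>\<^sub>p\<^sup>2 * ?p \<le> (4 * (real n)\<^sup>2)\<^sup>2 * \<sigma>\<^sub>p\<^sup>2 * (9 * \<sigma>\<^sub>0\<^sup>2 * d)"
      by (intro mult_left_mono) auto
    also have "\<dots> = (4 * (real n)\<^sup>2) * (36 * (real n)\<^sup>2 * \<psi>)" by (simp add: \<psi>_def power2_eq_square)
    also have "\<dots> \<le> (4 * (real n)\<^sup>2) * 1" by (intro mult_left_mono \<psi>) simp
    finally show ?thesis by simp
  qed
  have "test_loss d m q \<mu> \<sigma>\<^sub>p W \<le> ennreal (e + 2 * exp (- (4 * (real n)\<^sup>2) / 2))"
  proof (rule test_loss_le[OF m _ _ v])
    show "logloss (label \<omega>' 0 * fnet d m q W (patches d \<mu> \<sigma>\<^sub>p \<omega>' 0)) \<le> e +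
      (1 / real m) * (\<Sum>j\<in>{-1,1}. \<Sum>r<m. exp (4 * (real n)\<^sup>2 * (vinner d (W j r) (noise d \<mu> \<sigma>\<^sub>p \<omega>' 0) - 1)))"
      if "label \<omega>' 0 \<in> {-1, 1}" for \<omega>'
      unfolding W_def by (rule test_logloss_le[OF T1[folded a_def] e T2[folded a_def] T that nq])
  qed (use e in auto)
  also have "\<dots> \<le> ennreal (e + exp (- (real n)\<^sup>2))"
  proof (rule ennreal_leI)
    \<comment> \<open>The rate leaves 2 exp(-2 n^2), and one factor exp(-n^2) absorbs the 2.\<close>
    have "1 \<le> (real n)\<^sup>2" using n1 by simp
    then have "2 \<le> exp ((real n)\<^sup>2)" using exp_ge_add_one_self[of "(real n)\<^sup>2"] by linarith
    then have "2 * exp (- (2 * (real n)\<^sup>2)) \<le> exp ((real n)\<^sup>2) * exp (- (2 * (real n)\<^sup>2))" by (intro mult_right_mono) auto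
    also have "\<dots> = exp (- (real n)\<^sup>2)" by (simp flip: exp_add)
    finally show "e + 2 * exp (- (4 * (real n)\<^sup>2) / 2) \<le> e + exp (- (real n)\<^sup>2)" by simp
  qed
  finally show "test_loss d m q \<mu> \<sigma>\<^sub>p W \<le> ennreal (e + exp (- (real n)\<^sup>2))" .
qed

text \<open>With s = 20 L each bad event has probability at most 4 exp(-10 L), and exp L = e d makes
  this at most 4/(1024 d^10) against at most 14 d^2 events. The thresholds 80 and 200 bring
  exp(-n/8) and exp(-m/20) to the same level.\<close>

lemma good_sample_prob:
  assumes d: "d \<ge> 1" and \<sigma>0: "\<sigma>\<^sub>0 > 0" and \<mu>: "vnorm d \<mu> > 0" and L: "L = 1 + ln (real d)"
    and n: "real n \<ge> 80 * L" "n \<le> d" and m: "real m \<ge> 200 * L" "m \<le> d"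
  shows "whp (train_space n m d \<sigma>\<^sub>0) (1 / real d) (good_sample n m d \<mu> \<sigma>\<^sub>0 (20 * L))"
proof -
  have L1: "L \<ge> 1" using d L by simp
  have "1 * exp (- (10 * L)) \<le> 4 * exp (- (10 * L))" by (intro mult_right_mono) auto
  then have z: "exp x \<le> 4 * exp (- (10 * L))" if "x \<le> - (10 * L)" for x
    using that by (smt (verit) exp_le_cancel_iff)
  have "whp (train_space n m d \<sigma>\<^sub>0) ((4 + 3 * real n + real n * real n + 2 * real m * real n + 4 * real m) * (4 * exp (- (10 * L))))
     (good_sample n m d \<mu> \<sigma>\<^sub>0 (20 * L))"
    by (rule whp_good_sample[OF \<sigma>0 d \<mu>]) (use L1 n m in \<open>auto intro!: z\<close>)
  then show ?thesis
  proof (rule whp_mono)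
    have nd: "real n \<le> d" "real m \<le> d" "1 \<le> real d" using n m d by auto
    have "exp 1 \<ge> (2::real)" using exp_ge_add_one_self[of "1::real"] by simp
    then have "2 * real d \<le> exp 1 * real d" by (intro mult_right_mono) auto
    also have "\<dots> = exp L" using d by (simp add: L exp_add)
    finally have "(2 * real d) ^ 10 \<le> exp L ^ 10" by (intro power_mono) auto
    also have "\<dots> = exp (10 * L)" by (simp flip: exp_of_nat_mult)
    finally have e: "1024 * real d ^ 10 \<le> exp (10 * L)" by (simp add: power_mult_distrib)
    have nn: "real n * real n \<le> real d * real d" "real m * real n \<le> real d * real d"
      using nd by (intro mult_mono; simp)+
    have dd: "real d * 1 \<le> real d * real d" using nd by (intro mult_left_mono) auto
    have "4 + 3 * real n + real n * real n + 2 * real m * real n + 4 * real m \<le> 14 * (real d * real d)"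
      using nn nd dd by linarith
    then have "(4 + 3 * real n + real n * real n + 2 * real m * real n + 4 * real m) * (4 * exp (- (10 * L)))
      \<le> 14 * (real d * real d) * (4 * exp (- (10 * L)))" by (intro mult_right_mono) auto
    also have "\<dots> = 56 * (real d * real d) / exp (10 * L)" by (simp add: exp_minus field_simps)
    also have "\<dots> \<le> 56 * (real d * real d) / (1024 * real d ^ 10)"
      using e d by (intro divide_left_mono) auto
    also have "\<dots> \<le> 1 / real d"
    proof -
      have "real d ^ 3 \<le> real d ^ 10" using nd by (intro power_increasing) auto
      moreover have "56 * (real d * real d) * real d = 56 * real d ^ 3" by (simp add: power3_eq_cube)
      ultimately have "56 * (real d * real d) * real d \<le> 1024 * real d ^ 10"
        using zero_le_power[of "real d" 10] by linarith
      then show ?thesis using d by (simp add: field_simps)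
    qed
    finally show "(4 + 3 * real n + real n * real n + 2 * real m * real n + 4 * real m) * (4 * exp (- (10 * L))) \<le> 1 / real d" .
  qed
qed

lemma powr_le_plog:
  assumes d: "d \<ge> 1" and p: "p \<le> real k"
  shows "(1 + ln (real d)) powr p \<le> plog k d"
proof -
  have "1 + ln (real d) \<ge> 1" using d by simp
  then have "(1 + ln (real d)) powr p \<le> (1 + ln (real d)) powr (real k)"
    using p by (intro powr_mono) auto
  also have "\<dots> = plog k d" using d by (simp add: plog_def powr_realpow add_pos_nonneg)
  finally show ?thesis .
qed

theorem theorem4p3:
  fixes q :: real
  assumes hq: "q > 2"
  shows "\<exists>C > 0. \<exists>k::nat.
   \<forall>(d::nat) (n::nat) (m::nat) (\<mu>::nat \<Rightarrow> real) (\<sigma>\<^sub>p::real) (\<sigma>\<^sub>0::real) (\<eta>::real) (\<epsilon>::real).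
     ( d \<ge> 1 \<and> n \<ge> 1 \<and> m \<ge> 1 \<and> vnorm d \<mu> > 0 \<and> \<sigma>\<^sub>p > 0 \<and> \<sigma>\<^sub>0 > 0 \<and> \<eta> > 0 \<and> \<epsilon> > 0
     \<comment> \<open>(1)\<close>
     \<and> real d \<ge> C * plog k d * real m powr (max 2 (4 / (q - 2)))
                              * real n powr (max 4 ((2 * q - 2) / (q - 2)))
     \<comment> \<open>(2)\<close>
     \<and> real n \<ge> C * plog k d \<and> real m \<ge> C * plog k d
     \<comment> \<open>(3)\<close>
     \<and> \<eta> \<le> min (1 / (vnorm d \<mu>)\<^sup>2) (1 / (\<sigma>\<^sub>p\<^sup>2 * real d)) / (C * plog k d)
     \<comment> \<open>(4)\<close>
     \<and> C * plog k d * real n / sqrt (real d)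
         * min (1 / (\<sigma>\<^sub>p * sqrt (real d))) (1 / vnorm d \<mu>) \<le> \<sigma>\<^sub>0
     \<and> \<sigma>\<^sub>0 \<le> real m powr (- 2 / (q - 2)) * real n powr (- max (1 / (q - 2)) 1)
         * min (1 / (\<sigma>\<^sub>p * sqrt (real d))) (1 / vnorm d \<mu>) / (C * plog k d)
     \<comment> \<open>n * SNR^q = Omega~(1), hiding polylog(d) and polylog(1/eps)\<close>
     \<and> real n * (vnorm d \<mu> / (\<sigma>\<^sub>p * sqrt (real d))) powr q
         \<ge> C * plog k d * (1 + \<bar>ln \<epsilon>\<bar>) ^ k )
     \<longrightarrow>
     (\<exists>T::nat.
        real T \<ge> (real m * \<sigma>\<^sub>0 powr (- (q - 2)) * vnorm d \<mu> powr (- q) / \<eta>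
                   + real m ^ 3 / (\<eta> * \<epsilon> * (vnorm d \<mu>)\<^sup>2)) / (C * plog k d)
      \<and> real T \<le> C * plog k d * (real m * \<sigma>\<^sub>0 powr (- (q - 2)) * vnorm d \<mu> powr (- q) / \<eta>
                   + real m ^ 3 / (\<eta> * \<epsilon> * (vnorm d \<mu>)\<^sup>2))
      \<and> (\<exists>A \<in> sets (train_space n m d \<sigma>\<^sub>0).
           measure (train_space n m d \<sigma>\<^sub>0) A \<ge> 1 - 1 / real d
         \<and> (\<forall>\<omega>\<in>A. \<exists>t\<le>T.
              (\<forall>j\<in>{-1, 1::int}.
                 Max ((\<lambda>r. gamma_coeff d n \<mu> \<sigma>\<^sub>p \<omega> (gd_iter d m q n \<mu> \<sigma>\<^sub>p \<eta> \<omega> t) j r) ` {..<m})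
                   \<ge> 1 / C)
            \<and> (\<forall>j\<in>{-1, 1::int}. \<forall>r<m. \<forall>i<n.
                 \<bar>rho_coeff d n \<mu> \<sigma>\<^sub>p \<omega> (gd_iter d m q n \<mu> \<sigma>\<^sub>p \<eta> \<omega> T) j r i\<bar>
                   \<le> C * plog k d * \<sigma>\<^sub>0 * \<sigma>\<^sub>p * sqrt (real d))
            \<and> train_loss d m q n \<mu> \<sigma>\<^sub>p \<omega> (gd_iter d m q n \<mu> \<sigma>\<^sub>p \<eta> \<omega> t) \<le> \<epsilon>
            \<and> test_loss d m q \<mu> \<sigma>\<^sub>p (gd_iter d m q n \<mu> \<sigma>\<^sub>p \<eta> \<omega> t)
                \<le> ennreal (6 * \<epsilon> + exp (- (real n)\<^sup>2)))))"
proof -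
  \<comment> \<open>\<open>c1\<close> is the length of the warm-up, with the 11 from \<alpha>;
    \<open>c2\<close> that of the convergence phase, its summand 1 giving the lower bound on T;
    \<open>c3\<close> is the threshold in \<open>snr'\<close>, with 440 = 22 * 20. In
    \<open>C\<close>, 2000000 exceeds (64 * 20)^2 = 1638400, and 9 bounds e^2.\<close>
  define K where "K = track_const q"
  define c1 where "c1 = 16 * exp 2 * K * 11 powr (q - 2) / q"
  define c2 where "c2 = 16 * exp 3 * K / q + 1"
  define c3 where "c3 = 32 * exp 3 * K * 3 powr (q - 1) * 440 powr (q - 2)"
  define C where "C = 2000000 + 9 * q + c1 + c2 + c3"
  \<comment> \<open>The power of the logarithm has to cover L^(q-2) in the signal-to-noise condition
    and L^2 in the dimension condition.\<close>
  define k where "k = nat \<lceil>q\<rceil> + 2"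
  have K: "K > 0" using track_const_pos[OF hq] by (simp add: K_def)
  have c: "c1 > 0" "c2 \<ge> 1" "c3 > 0" using K hq by (auto simp: c1_def c2_def c3_def)
  have C: "C \<ge> 2000000" "C \<ge> 9 * q" "C \<ge> c3" "C \<ge> c1 + c2 + 4" using c hq by (auto simp: C_def)
  have k: "real k \<ge> q - 2" "real k \<ge> 2"
    using real_nat_ceiling_ge[of q] by (auto simp: k_def)
  show ?thesis
  proof (rule exI[of _ C], rule conjI, use C in simp, rule exI[of _ k], intro allI impI, elim conjE)
    fix d n m :: nat and \<mu> :: "nat \<Rightarrow> real" and \<sigma>\<^sub>p \<sigma>\<^sub>0 \<eta> \<epsilon> :: real
    assume d: "d \<ge> 1" and n: "n \<ge> 1" and m: "m \<ge> 1" and \<mu>: "vnorm d \<mu> > 0" and \<sigma>p: "\<sigma>\<^sub>p > 0"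
      and \<sigma>0: "\<sigma>\<^sub>0 > 0" and \<eta>: "\<eta> > 0" and \<epsilon>: "\<epsilon> > 0"
      and d_ge: "C * plog k d * real m powr (max 2 (4 / (q - 2))) * real n powr (max 4 ((2 * q - 2) / (q - 2))) \<le> real d"
      and n_ge: "C * plog k d \<le> real n" and m_ge: "C * plog k d \<le> real m"
      and \<eta>_le: "\<eta> \<le> min (1 / (vnorm d \<mu>)\<^sup>2) (1 / (\<sigma>\<^sub>p\<^sup>2 * real d)) / (C * plog k d)"
      and \<sigma>0_le: "\<sigma>\<^sub>0 \<le> real m powr (- 2 / (q - 2)) * real n powr (- max (1 / (q - 2)) 1)
         * min (1 / (\<sigma>\<^sub>p * sqrt (real d))) (1 / vnorm d \<mu>) / (C * plog k d)"
      and snr: "C * plog k d * (1 + \<bar>ln \<epsilon>\<bar>) ^ k \<le> real n * (vnorm d \<mu> / (\<sigma>\<^sub>p * sqrt (real d))) powr q"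
    define L where "L = 1 + ln (real d)"
    define Q where "Q = plog k d"
    have n1: "real n \<ge> 1" and m1: "real m \<ge> 1" and d0: "real d > 0" using n m d by auto
    have L1: "L \<ge> 1" using d by (simp add: L_def)
    have Q: "L powr p \<le> Q" if "p \<le> real k" for p
      unfolding L_def Q_def by (rule powr_le_plog[OF d that])
    have QL2: "Q \<ge> L\<^sup>2" using Q[of 2] k L1 by simp
    have "L * 1 \<le> L * L" using L1 by (intro mult_left_mono) auto
    then have QL: "Q \<ge> L" using QL2 by (simp add: power2_eq_square)
    have Q1: "Q \<ge> 1" using QL L1 by simp
    have C0: "C > 0" and Q0: "Q > 0" using C Q1 by auto
    have CQ: "c * L \<le> C * Q" if "c \<le> C" "c \<ge> 0" for c
      using that QL L1 C by (intro mult_mono) auto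
    have CQ1: "C * Q \<ge> C" using Q1 C by simp
    have CQ_1: "1 \<le> C * Q" using C CQ1 by linarith
    have nL: "real n \<ge> 80 * L" and mL: "real m \<ge> 200 * L"
      using CQ[of 80] CQ[of 200] n_ge m_ge C unfolding Q_def[symmetric] by linarith+

    have "real m ^ 2 \<le> real m powr (max 2 (4 / (q - 2)))"
      using powr_mono[of 2 "max 2 (4 / (q - 2))" "real m"] m1 by simp
    moreover have "real n ^ 4 \<le> real n powr (max 4 ((2 * q - 2) / (q - 2)))"
      using powr_mono[of 4 "max 4 ((2 * q - 2) / (q - 2))" "real n"] n1 by simp
    ultimately have "(C * Q) * real m ^ 2 * real n ^ 4 \<le> (C * Q) * real m powr (max 2 (4 / (q - 2))) * real n powr (max 4 ((2 * q - 2) / (q - 2)))"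
      using C0 Q0 by (intro mult_mono) auto
    then have dge: "(C * Q) * real m ^ 2 * real n ^ 4 \<le> real d" using d_ge by (simp add: Q_def)
    have m2: "real m ^ 2 \<ge> real m" and n4: "real n ^ 4 \<ge> (real n)\<^sup>2" and n2: "(real n)\<^sup>2 \<ge> real n"
      and m21: "real m ^ 2 \<ge> 1"
      using m1 n1 by (auto intro!: power_increasing simp: self_le_power)
    have "(C * Q) * 1 * (real n)\<^sup>2 \<le> (C * Q) * real m ^ 2 * real n ^ 4"
      using m21 n4 C0 Q0 by (intro mult_mono) auto
    then have dn: "C * Q * (real n)\<^sup>2 \<le> real d" using dge by simp
    have "1 * (real n)\<^sup>2 \<le> C * Q * (real n)\<^sup>2" by (intro mult_right_mono CQ_1) auto
    then have "real n \<le> real d" using dn n2 by linarith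
    then have nd: "n \<le> d" by simp
    have "1 * real m * 1 \<le> (C * Q) * real m ^ 2 * real n ^ 4"
      using m2 n1 CQ_1 C0 Q0 by (intro mult_mono) (auto simp: one_le_power)
    then have md: "m \<le> d" using dge by simp
    have sd: "64 * real n * (20 * L) \<le> sqrt d"
    proof (rule real_le_rsqrt)
      have "(64 * real n * (20 * L))\<^sup>2 = 1638400 * L\<^sup>2 * (real n)\<^sup>2" by (simp add: power_mult_distrib)
      also have "\<dots> \<le> C * Q * (real n)\<^sup>2" using C QL2 C0 by (intro mult_right_mono mult_mono) auto
      also have "\<dots> \<le> real d" by (rule dn)
      finally show "(64 * real n * (20 * L))\<^sup>2 \<le> real d" .
    qed

    have "\<eta> \<le> (1 / (vnorm d \<mu>)\<^sup>2) / (C * Q)"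
      unfolding Q_def using \<eta>_le C0 Q0[unfolded Q_def] by (smt (verit) divide_right_mono min.cobounded1 mult_nonneg_nonneg)
    then have \<eta>\<mu>: "\<eta> * (vnorm d \<mu>)\<^sup>2 * (C * Q) \<le> 1" using C0 Q0 \<mu> by (simp add: field_simps)
    have "exp 1 * exp (1 :: real) \<le> 3 * 3" using exp_le by (intro mult_mono) auto
    then have e2: "exp (2 :: real) \<le> 9" by (simp flip: exp_add)
    have "exp 2 * q \<le> C * Q" using e2 C(2) CQ1 hq mult_right_mono[OF e2, of q] by linarith
    then have "exp 2 * q * (\<eta> * (vnorm d \<mu>)\<^sup>2) \<le> C * Q * (\<eta> * (vnorm d \<mu>)\<^sup>2)"
      using \<eta> by (intro mult_right_mono) auto
    then have \<eta>2: "exp 2 * q * \<eta> * (vnorm d \<mu>)\<^sup>2 \<le> 1" using \<eta>\<mu> by (simp add: ac_simps)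
    have "1 * (\<eta> * (vnorm d \<mu>)\<^sup>2) \<le> C * Q * (\<eta> * (vnorm d \<mu>)\<^sup>2)"
      using \<eta> by (intro mult_right_mono CQ_1) auto
    then have \<eta>1: "\<eta> * (vnorm d \<mu>)\<^sup>2 \<le> 1" using \<eta>\<mu> by (simp add: ac_simps)

    have "real m powr (- 2 / (q - 2)) \<le> real m powr 0" using m1 hq by (intro powr_mono) auto
    then have mp: "real m powr (- 2 / (q - 2)) \<le> 1" using m1 by simp
    \<comment> \<open>The exponent is at most -1, which supplies the factor 1/n that
      \<open>small3\<close> consumes.\<close>
    have "real n powr (- max (1 / (q - 2)) 1) \<le> real n powr (- 1)" using n1 by (intro powr_mono) auto
    then have np: "real n powr (- max (1 / (q - 2)) 1) \<le> 1 / real n" using n1 by (simp add: powr_minus_divide)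
    have \<sigma>0b: "\<sigma>\<^sub>0 \<le> 1 / real n * x / (C * Q)"
      if x: "x \<ge> min (1 / (\<sigma>\<^sub>p * sqrt (real d))) (1 / vnorm d \<mu>)" for x
    proof -
      have "real m powr (- 2 / (q - 2)) * real n powr (- max (1 / (q - 2)) 1)
          * min (1 / (\<sigma>\<^sub>p * sqrt (real d))) (1 / vnorm d \<mu>) \<le> 1 * (1 / real n) * x"
        using mp np x \<sigma>p \<mu> n1 by (intro mult_mono) (auto simp: min_def)
      then have "real m powr (- 2 / (q - 2)) * real n powr (- max (1 / (q - 2)) 1)
          * min (1 / (\<sigma>\<^sub>p * sqrt (real d))) (1 / vnorm d \<mu>) / (C * Q) \<le> 1 * (1 / real n) * x / (C * Q)"
        using C0 Q0 by (intro divide_right_mono) auto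
      then show ?thesis using \<sigma>0_le by (simp add: Q_def)
    qed
    have b1: "\<sigma>\<^sub>0 * \<sigma>\<^sub>p * sqrt d * real n * (C * Q) \<le> 1"
      using \<sigma>0b[of "1 / (\<sigma>\<^sub>p * sqrt (real d))"] C0 Q0 n1 \<sigma>p d0 by (simp add: field_simps)
    have b2: "\<sigma>\<^sub>0 * vnorm d \<mu> * real n * (C * Q) \<le> 1"
      using \<sigma>0b[of "1 / vnorm d \<mu>"] C0 Q0 n1 \<mu> by (simp add: field_simps)
    have bound: "x * (c * L) \<le> 1" "x * c \<le> 1" "x * real n * c \<le> 1"
      if x: "x * real n * (C * Q) \<le> 1" "x > 0" and c: "c \<le> C" "c \<ge> 0" for x c
    proof -
      have "x * 1 \<le> x * real n" using x n1 by (intro mult_left_mono) auto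
      from mult_mono[OF this CQ[OF c]] have "x * 1 * (c * L) \<le> x * real n * (C * Q)" using x c L1 by simp
      also note x(1)
      finally show 1: "x * (c * L) \<le> 1" by (simp only: mult_1_right)
      have "x * (c * 1) \<le> x * (c * L)" using x c L1 by (intro mult_left_mono) auto
      also note 1
      finally show "x * c \<le> 1" by (simp only: mult_1_right)
      have "x * real n * c \<le> x * real n * (C * Q)" using x c CQ1 by (intro mult_left_mono) auto
      also note x(1)
      finally show "x * real n * c \<le> 1" .
    qed
    have \<sigma>\<mu>pos: "\<sigma>\<^sub>0 * vnorm d \<mu> > 0" and \<psi>pos: "\<sigma>\<^sub>0 * \<sigma>\<^sub>p * sqrt d > 0" using \<sigma>0 \<mu> \<sigma>p d0 by auto
    have small1: "\<sigma>\<^sub>0 * vnorm d \<mu> * (20 * L) \<le> 1/2"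
      using bound(1)[OF b2 \<sigma>\<mu>pos, of 40] C by simp
    have small2: "6 * (20 * L) * \<sigma>\<^sub>0 * \<sigma>\<^sub>p * sqrt d \<le> 1"
      using bound(1)[OF b1 \<psi>pos, of 120] C by (simp add: ac_simps)
    have small3: "6 * real n * (\<sigma>\<^sub>0 * \<sigma>\<^sub>p * sqrt d) \<le> 1"
      using bound(3)[OF b1 \<psi>pos, of 6] C by (simp add: ac_simps)
    have \<sigma>\<mu>1: "\<sigma>\<^sub>0 * vnorm d \<mu> \<le> 1" using bound(2)[OF b2 \<sigma>\<mu>pos, of 1] C by simp

    have snr': "32 * exp 3 * track_const q * 3 powr (q - 1) * (22 * (20 * L)) powr (q - 2)
        \<le> real n * (vnorm d \<mu> / (\<sigma>\<^sub>p * sqrt d)) powr q"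
    proof -
      have "(22 * (20 * L)) powr (q - 2) = 440 powr (q - 2) * L powr (q - 2)"
        using L1 by (simp add: powr_mult[symmetric])
      then have "32 * exp 3 * track_const q * 3 powr (q - 1) * (22 * (20 * L)) powr (q - 2) = c3 * L powr (q - 2)"
        by (simp add: c3_def K_def)
      also have "\<dots> \<le> C * Q" using C c Q[OF k(1)] C0 by (intro mult_mono) auto
      also have "\<dots> \<le> C * Q * (1 + \<bar>ln \<epsilon>\<bar>) ^ k" using C0 Q0 by (simp add: one_le_power)
      also have "\<dots> \<le> real n * (vnorm d \<mu> / (\<sigma>\<^sub>p * sqrt d)) powr q" using snr by (simp add: Q_def)
      finally show ?thesis .
    qed
    have "q \<le> real n" using n_ge CQ1 C(2) hq unfolding Q_def[symmetric] by linarith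
    then have nq: "4 * (real n)\<^sup>2 \<ge> q" using n2 n1 by linarith

    define z where "z = (\<sigma>\<^sub>0 * vnorm d \<mu>) powr (-(q - 2))"
    define X1 where "X1 = real m * \<sigma>\<^sub>0 powr (- (q - 2)) * vnorm d \<mu> powr (- q) / \<eta>"
    define X2 where "X2 = real m ^ 3 / (\<eta> * \<epsilon> * (vnorm d \<mu>)\<^sup>2)"
    define X where "X = X1 + X2"
    define a where "a = \<eta> * q * (vnorm d \<mu>)\<^sup>2 / real m"
    \<comment> \<open>\<open>training_result\<close> takes targets of at most 1, so larger
      \<epsilon> are capped.\<close>
    define e where "e = min \<epsilon> 1"
    have e: "0 < e" "e \<le> 1" "e \<le> \<epsilon>" using \<epsilon> by (auto simp: e_def)
    have a0: "a > 0" using \<eta> hq \<mu> m1 by (simp add: a_def)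
    have z1: "z \<ge> 1"
    proof -
      have "(\<sigma>\<^sub>0 * vnorm d \<mu>) powr 0 \<le> z"
        unfolding z_def using \<sigma>\<mu>pos \<sigma>\<mu>1 hq by (intro powr_mono') auto
      then show ?thesis using \<sigma>0 \<mu> by simp
    qed
    have "vnorm d \<mu> powr (- q) = vnorm d \<mu> powr (-(q - 2)) / (vnorm d \<mu>)\<^sup>2"
      using powr_diff[of "vnorm d \<mu>" "-(q - 2)" 2] \<mu> by simp
    then have X1: "X1 = real m * z / (\<eta> * (vnorm d \<mu>)\<^sup>2)"
      unfolding X1_def z_def using \<sigma>0 \<mu> by (simp add: powr_mult ac_simps)
    have aX1: "a * X1 = q * z" unfolding X1 a_def using \<eta> \<mu> m1 by (simp add: field_simps)
    have X1_1: "X1 \<ge> 1"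
    proof -
      have "\<eta> * (vnorm d \<mu>)\<^sup>2 \<le> 1 * 1" using \<eta>1 by simp
      also have "\<dots> \<le> real m * z" using m1 z1 by (intro mult_mono) auto
      finally show ?thesis unfolding X1 using \<eta> \<mu> by (simp add: field_simps)
    qed
    have X2_0: "X2 \<ge> 0" using \<eta> \<epsilon> by (simp add: X2_def)
    \<comment> \<open>For \<epsilon> \<le> 1 the second summand of \<open>X\<close> contributes q
      m^2. For larger \<epsilon> it may be tiny, and the first summand takes over with a X1 = q z
      \<ge> q.\<close>
    have aeX: "a * X * e \<ge> q"
    proof (cases "\<epsilon> \<le> 1")
      case True
      have "a * X2 * e = q * (real m)\<^sup>2"
        using True \<eta> \<mu> \<epsilon> m1 by (simp add: a_def X2_def e_def field_simps power2_eq_square power3_eq_cube)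
      moreover have "q * 1 \<le> q * (real m)\<^sup>2" using m21 hq by (intro mult_left_mono) auto
      moreover have "a * X1 * e \<ge> 0" using a0 X1_1 e by simp
      ultimately show ?thesis by (simp add: X_def distrib_left distrib_right)
    next
      case False
      then have "e = 1" by (simp add: e_def)
      moreover have "q * 1 \<le> q * z" using z1 hq by (intro mult_left_mono) auto
      moreover have "a * X2 \<ge> 0" using a0 X2_0 by simp
      ultimately show ?thesis using aX1 by (simp add: X_def distrib_left)
    qed
    \<comment> \<open>The extra 1 after rounding makes the required inequalities strict.
      \<open>T2\<close> is a multiple of \<open>X\<close> and not of \<open>X2\<close> alone because
      of the case of large \<epsilon>.\<close>
    define T1 where "T1 = nat \<lceil>c1 * X1\<rceil> + 1"
    define T2 where "T2 = nat \<lceil>c2 * X\<rceil> + 1"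
    have ceil: "real (nat \<lceil>x\<rceil>) \<ge> x" "real (nat \<lceil>x\<rceil>) \<le> x + 1" if "x \<ge> 0" for x :: real
      using that by linarith+
    \<comment> \<open>With X \<ge> 1 the at most 4 steps added by rounding are absorbed into a
      multiple of X.\<close>
    have X0: "X \<ge> 1" using X1_1 X2_0 by (simp add: X_def)
    have c1X: "c1 * X1 \<ge> 0" and c2X: "c2 * X \<ge> 0" using c X1_1 X0 by auto
    have T1g: "real T1 > c1 * X1" using ceil(1)[OF c1X] by (simp add: T1_def)
    have T2g: "real T2 > c2 * X" using ceil(1)[OF c2X] by (simp add: T2_def)
    have T1: "real T1 * (\<eta> * q * (vnorm d \<mu>)\<^sup>2 / real m)
       > 16 * exp 2 * (track_const q * (\<sigma>\<^sub>0 * vnorm d \<mu> / 11) powr (-(q - 2)))"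
    proof -
      have "(\<sigma>\<^sub>0 * vnorm d \<mu> / 11) powr (-(q - 2)) = 11 powr (q - 2) * z"
        unfolding z_def powr_divide powr_minus_divide by simp
      then have "16 * exp 2 * (track_const q * (\<sigma>\<^sub>0 * vnorm d \<mu> / 11) powr (-(q - 2))) = c1 * (q * z)"
        using hq by (simp add: c1_def K_def)
      also have "\<dots> = c1 * X1 * a" unfolding aX1[symmetric] by simp
      also have "\<dots> < real T1 * a" using T1g a0 by (rule mult_strict_right_mono)
      finally show ?thesis by (simp add: a_def)
    qed
    have T2: "real T2 * (\<eta> * q * (vnorm d \<mu>)\<^sup>2 / real m) * e > 16 * exp 3 * track_const q"
    proof -
      have "16 * exp 3 * track_const q \<le> c2 * q" using hq by (simp add: c2_def K_def field_simps)
      also have "\<dots> \<le> c2 * (a * X * e)" using aeX c by (intro mult_left_mono) auto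
      also have "\<dots> = c2 * X * (a * e)" by simp
      also have "\<dots> < real T2 * (a * e)" using T2g a0 e by (intro mult_strict_right_mono) auto
      finally show ?thesis by (simp add: a_def)
    qed
    define T where "T = T1 + T2"
    have T_ge: "real T \<ge> X / (C * Q)"
    proof -
      have "X / (C * Q) \<le> X / 1" using X0 CQ_1 by (intro divide_left_mono) auto
      also have "\<dots> \<le> c2 * X" using c X0 by simp
      also have "\<dots> \<le> real T" using T2g by (simp add: T_def)
      finally show ?thesis .
    qed
    have T_le: "real T \<le> C * Q * X"
    proof -
      have "c1 * X1 \<le> c1 * X" using c X2_0 by (intro mult_left_mono) (auto simp: X_def)
      moreover have "real T \<le> (c1 * X1 + 2) + (c2 * X + 2)"
        using ceil(2)[OF c1X] ceil(2)[OF c2X] by (simp add: T_def T1_def T2_def)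
      ultimately have "real T \<le> (c1 + c2 + 4) * X" using X0 by (simp add: distrib_right)
      also have "\<dots> \<le> C * Q * X" using C(4) CQ1 X0 by (intro mult_right_mono) auto
      finally show ?thesis .
    qed
    have "whp (train_space n m d \<sigma>\<^sub>0) (1 / real d) (good_sample n m d \<mu> \<sigma>\<^sub>0 (20 * L))"
      by (rule good_sample_prob[OF d \<sigma>0 \<mu> L_def nL nd mL md])
    then obtain A where A: "A \<in> sets (train_space n m d \<sigma>\<^sub>0)" "measure (train_space n m d \<sigma>\<^sub>0) A \<ge> 1 - 1 / real d"
      and good: "\<And>\<omega>. \<omega> \<in> A \<Longrightarrow> good_sample n m d \<mu> \<sigma>\<^sub>0 (20 * L) \<omega>"
      unfolding whp_def by blast
    have s1: "20 * L \<ge> 1" using L1 by simp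
    have main: "\<exists>t\<le>T.
              (\<forall>j\<in>{-1, 1::int}.
                 Max ((\<lambda>r. gamma_coeff d n \<mu> \<sigma>\<^sub>p \<omega> (gd_iter d m q n \<mu> \<sigma>\<^sub>p \<eta> \<omega> t) j r) ` {..<m})
                   \<ge> 1 / C)
            \<and> (\<forall>j\<in>{-1, 1::int}. \<forall>r<m. \<forall>i<n.
                 \<bar>rho_coeff d n \<mu> \<sigma>\<^sub>p \<omega> (gd_iter d m q n \<mu> \<sigma>\<^sub>p \<eta> \<omega> T) j r i\<bar>
                   \<le> C * plog k d * \<sigma>\<^sub>0 * \<sigma>\<^sub>p * sqrt (real d))
            \<and> train_loss d m q n \<mu> \<sigma>\<^sub>p \<omega> (gd_iter d m q n \<mu> \<sigma>\<^sub>p \<eta> \<omega> t) \<le> \<epsilon>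
            \<and> test_loss d m q \<mu> \<sigma>\<^sub>p (gd_iter d m q n \<mu> \<sigma>\<^sub>p \<eta> \<omega> t)
                \<le> ennreal (6 * \<epsilon> + exp (- (real n)\<^sup>2))" if "\<omega> \<in> A" for \<omega>
    proof (intro exI[of _ T] conjI ballI allI impI)
      note res = good_sample_conclusion[OF good[OF that] \<mu> \<sigma>p \<sigma>0 s1 sd n m hq \<eta> small1 small2 \<eta>2 snr'
          small3 nq T_def e(1,2) T1 T2]
      fix j :: int assume j: "j \<in> {-1, 1}"
      have "1 / C \<le> 1 / 2" using C by (intro divide_left_mono) auto
      with res(1)[OF j] show "Max ((\<lambda>r. gamma_coeff d n \<mu> \<sigma>\<^sub>p \<omega> (gd_iter d m q n \<mu> \<sigma>\<^sub>p \<eta> \<omega> T) j r) ` {..<m}) \<ge> 1 / C"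
        by linarith
      fix r i assume "r < m" "i < n"
      from res(2)[OF j this] have "\<bar>rho_coeff d n \<mu> \<sigma>\<^sub>p \<omega> (gd_iter d m q n \<mu> \<sigma>\<^sub>p \<eta> \<omega> T) j r i\<bar> \<le> 40 * L * (\<sigma>\<^sub>0 * \<sigma>\<^sub>p * sqrt d)"
        by simp
      also have "\<dots> \<le> C * Q * (\<sigma>\<^sub>0 * \<sigma>\<^sub>p * sqrt d)"
        using CQ[of 40] C \<psi>pos by (intro mult_right_mono) auto
      finally show "\<bar>rho_coeff d n \<mu> \<sigma>\<^sub>p \<omega> (gd_iter d m q n \<mu> \<sigma>\<^sub>p \<eta> \<omega> T) j r i\<bar>
          \<le> C * plog k d * \<sigma>\<^sub>0 * \<sigma>\<^sub>p * sqrt (real d)" by (simp add: Q_def mult.assoc)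
    next
      note res = good_sample_conclusion[OF good[OF that] \<mu> \<sigma>p \<sigma>0 s1 sd n m hq \<eta> small1 small2 \<eta>2 snr'
          small3 nq T_def e(1,2) T1 T2]
      show "train_loss d m q n \<mu> \<sigma>\<^sub>p \<omega> (gd_iter d m q n \<mu> \<sigma>\<^sub>p \<eta> \<omega> T) \<le> \<epsilon>" using res(3) e by linarith
      have "ennreal (e + exp (- (real n)\<^sup>2)) \<le> ennreal (6 * \<epsilon> + exp (- (real n)\<^sup>2))"
        using e \<epsilon> by (intro ennreal_leI) auto
      with res(4) show "test_loss d m q \<mu> \<sigma>\<^sub>p (gd_iter d m q n \<mu> \<sigma>\<^sub>p \<eta> \<omega> T)
                \<le> ennreal (6 * \<epsilon> + exp (- (real n)\<^sup>2))" by (rule order_trans)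
    qed simp
    show "\<exists>T::nat.
        real T \<ge> (real m * \<sigma>\<^sub>0 powr (- (q - 2)) * vnorm d \<mu> powr (- q) / \<eta>
                   + real m ^ 3 / (\<eta> * \<epsilon> * (vnorm d \<mu>)\<^sup>2)) / (C * plog k d)
      \<and> real T \<le> C * plog k d * (real m * \<sigma>\<^sub>0 powr (- (q - 2)) * vnorm d \<mu> powr (- q) / \<eta>
                   + real m ^ 3 / (\<eta> * \<epsilon> * (vnorm d \<mu>)\<^sup>2))
      \<and> (\<exists>A \<in> sets (train_space n m d \<sigma>\<^sub>0).
           measure (train_space n m d \<sigma>\<^sub>0) A \<ge> 1 - 1 / real d
         \<and> (\<forall>\<omega>\<in>A. \<exists>t\<le>T.
              (\<forall>j\<in>{-1, 1::int}.
                 Max ((\<lambda>r. gamma_coeff d n \<mu> \<sigma>\<^sub>p \<omega> (gd_iter d m q n \<mu> \<sigma>\<^sub>p \<eta> \<omega> t) j r) ` {..<m})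
                   \<ge> 1 / C)
            \<and> (\<forall>j\<in>{-1, 1::int}. \<forall>r<m. \<forall>i<n.
                 \<bar>rho_coeff d n \<mu> \<sigma>\<^sub>p \<omega> (gd_iter d m q n \<mu> \<sigma>\<^sub>p \<eta> \<omega> T) j r i\<bar>
                   \<le> C * plog k d * \<sigma>\<^sub>0 * \<sigma>\<^sub>p * sqrt (real d))
            \<and> train_loss d m q n \<mu> \<sigma>\<^sub>p \<omega> (gd_iter d m q n \<mu> \<sigma>\<^sub>p \<eta> \<omega> t) \<le> \<epsilon>
            \<and> test_loss d m q \<mu> \<sigma>\<^sub>p (gd_iter d m q n \<mu> \<sigma>\<^sub>p \<eta> \<omega> t)
                \<le> ennreal (6 * \<epsilon> + exp (- (real n)\<^sup>2))))"
      by (rule exI[of _ T], rule conjI[OF T_ge[unfolded X_def X1_def X2_def Q_def]],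
          rule conjI[OF T_le[unfolded X_def X1_def X2_def Q_def]],
          rule bexI[OF _ A(1)], rule conjI[OF A(2)], rule ballI, rule main)
  qed
qed

end
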